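(* Let $P$ be an upper stable C*-property and let $A$ be a C*-algebra. Then: (i) $\mathfrak{r}_P^{\triangleright}(A)$ is the largest $\mathsf{G}P$-ideal of $A$ (the largest ideal belonging to $\mathsf{G}P$) and the smallest ideal $I$ of $A$ with $A/I\in\mathsf{NG}P$. There is an ascending transfinite $\ll_P$-series of ideals from $\{0\}$ to $\mathfrak{r}_P^{\triangleright}(A)$. (ii) $A$ is a $\mathsf{G}P$-algebra if and only if $A=\mathfrak{r}_P^{\triangleright}(A)$; $A$ is an $\mathsf{NG}P$-algebra if and only if $\mathfrak{r}_P^{\triangleright}(A)=\{0\}$.
   Context: For a C*-algebra $A$, $\mathrm{Id}_A$ is the complete lattice of all closed two-sided ideals of $A$ (called ideals), ordered by inclusion. A C*-property is a class $P$ of C*-algebras with $\{0\}\in P$ that is closed under *-isomorphism; members of $P$ are called $P$-algebras, and ideals belonging to $P$ are called $P$-ideals. $P$ is upper stable if $A\in P$ implies $A/I\in P$ for all $I\in\mathrm{Id}_A$. The relation $\ll_P$ in $\mathrm{Id}_A$ is: $I\ll_P J$ iff $I\subseteq J$ and $J/I\in P$. An ascending transfinite $\ll_P$-series of ideals from $I$ to $J$ is a family of ideals $(I_\lambda)_{1\le\lambda\le\gamma}$ ($\gamma$ an ordinal) with $I_1=I$, $I_\gamma=J$, $I_\mu\subseteq I_\lambda$ for $\mu\le\lambda$, $I_{\lambda+1}/I_\lambda\in P$ for all $\lambda<\gamma$, and $I_\beta=\overline{\bigcup_{\lambda<\beta}I_\lambda}$ for limit ordinals $\beta$. Write $I\ll_P^{\triangleright}J$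 if such a series exists. For $P$ upper stable, $\mathfrak{r}_P^{\triangleright}(A)=\overline{\sum\{J\in\mathrm{Id}_A:\{0\}\ll_P^{\triangleright}J\}}$ (the $\ll_P^{\triangleright}$-radical). $\mathsf{G}P$ is the class of all C*-algebras $A$ such that $A=\{0\}$ or each non-zero quotient $A/I$ has a non-zero $P$-ideal. $\mathsf{NG}P$ is the class of all C*-algebras having no non-zero $P$-ideals. *)

theory Defs
  imports "HOL-Analysis.Analysis" "HOL-Algebra.Coset"
begin

section \<open>C*-algebras\<close>

text \<open>C*-algebras (complex, not necessarily unital) are records with an explicit carrier, so that
  ideals and quotients of a C*-algebra are again objects of the same kind.\<close>

record 'a cstar = "'a partial_object" +
  vzero :: 'a
  vadd :: "'a \<Rightarrow> 'a \<Rightarrow> 'a"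
  vscale :: "complex \<Rightarrow> 'a \<Rightarrow> 'a"
  vmult :: "'a \<Rightarrow> 'a \<Rightarrow> 'a"
  vstar :: "'a \<Rightarrow> 'a"
  vnorm :: "'a \<Rightarrow> real"

definition add_group :: "'a cstar \<Rightarrow> 'a monoid" where
  "add_group A = \<lparr>carrier = carrier A, monoid.mult = vadd A, one = vzero A\<rparr>"

text \<open>The locale \<^locale>\<open>Metric_space\<close> asks for non-negativity and symmetry also off the carrier;
  hence the value 0 there.\<close>

definition cdist :: "'a cstar \<Rightarrow> 'a \<Rightarrow> 'a \<Rightarrow> real" where
  "cdist A x y =
     (if x \<in> carrier A \<and> y \<in> carrier A then vnorm A (vadd A x (vscale A (- 1) y)) else 0)"

abbreviation ctopology :: "'a cstar \<Rightarrow> 'a topology" where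
  "ctopology A \<equiv> Metric_space.mtopology (carrier A) (cdist A)"

locale cstar_algebra =
  fixes A :: "'a cstar"
  assumes add_group: "comm_group (add_group A)"
    and scale_closed: "x \<in> carrier A \<Longrightarrow> vscale A c x \<in> carrier A"
    and scale_add_right:
      "\<lbrakk>x \<in> carrier A; y \<in> carrier A\<rbrakk>
        \<Longrightarrow> vscale A c (vadd A x y) = vadd A (vscale A c x) (vscale A c y)"
    and scale_add_left:
      "x \<in> carrier A \<Longrightarrow> vscale A (c + d) x = vadd A (vscale A c x) (vscale A d x)"
    and scale_scale: "x \<in> carrier A \<Longrightarrow> vscale A c (vscale A d x) = vscale A (c * d) x"
    and scale_one: "x \<in> carrier A \<Longrightarrow> vscale A 1 x = x"
    and mult_closed: "\<lbrakk>x \<in> carrier A; y \<in> carrier A\<rbrakk> \<Longrightarrow> vmult A x y \<in> carrier A"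
    and mult_assoc:
      "\<lbrakk>x \<in> carrier A; y \<in> carrier A; z \<in> carrier A\<rbrakk>
        \<Longrightarrow> vmult A (vmult A x y) z = vmult A x (vmult A y z)"
    and mult_add_left:
      "\<lbrakk>x \<in> carrier A; y \<in> carrier A; z \<in> carrier A\<rbrakk>
        \<Longrightarrow> vmult A (vadd A x y) z = vadd A (vmult A x z) (vmult A y z)"
    and mult_add_right:
      "\<lbrakk>x \<in> carrier A; y \<in> carrier A; z \<in> carrier A\<rbrakk>
        \<Longrightarrow> vmult A x (vadd A y z) = vadd A (vmult A x y) (vmult A x z)"
    and mult_scale_left:
      "\<lbrakk>x \<in> carrier A; y \<in> carrier A\<rbrakk>
        \<Longrightarrow> vmult A (vscale A c x) y = vscale A c (vmult A x y)"
    and mult_scale_right: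
      "\<lbrakk>x \<in> carrier A; y \<in> carrier A\<rbrakk>
        \<Longrightarrow> vmult A x (vscale A c y) = vscale A c (vmult A x y)"
    and star_closed: "x \<in> carrier A \<Longrightarrow> vstar A x \<in> carrier A"
    and star_star: "x \<in> carrier A \<Longrightarrow> vstar A (vstar A x) = x"
    and star_add:
      "\<lbrakk>x \<in> carrier A; y \<in> carrier A\<rbrakk> \<Longrightarrow> vstar A (vadd A x y) = vadd A (vstar A x) (vstar A y)"
    and star_scale: "x \<in> carrier A \<Longrightarrow> vstar A (vscale A c x) = vscale A (cnj c) (vstar A x)"
    and star_mult:
      "\<lbrakk>x \<in> carrier A; y \<in> carrier A\<rbrakk>
        \<Longrightarrow> vstar A (vmult A x y) = vmult A (vstar A y) (vstar A x)"
    and norm_nonneg: "x \<in> carrier A \<Longrightarrow> 0 \<le> vnorm A x"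
    and norm_eq_zero_iff: "x \<in> carrier A \<Longrightarrow> vnorm A x = 0 \<longleftrightarrow> x = vzero A"
    and norm_triangle:
      "\<lbrakk>x \<in> carrier A; y \<in> carrier A\<rbrakk> \<Longrightarrow> vnorm A (vadd A x y) \<le> vnorm A x + vnorm A y"
    and norm_scale: "x \<in> carrier A \<Longrightarrow> vnorm A (vscale A c x) = cmod c * vnorm A x"
    and norm_mult:
      "\<lbrakk>x \<in> carrier A; y \<in> carrier A\<rbrakk> \<Longrightarrow> vnorm A (vmult A x y) \<le> vnorm A x * vnorm A y"
    and cstar_identity: "x \<in> carrier A \<Longrightarrow> vnorm A (vmult A (vstar A x) x) = (vnorm A x)\<^sup>2"
    and complete: "Metric_space.mcomplete (carrier A) (cdist A)"

definition star_iso :: "'a cstar \<Rightarrow> 'b cstar \<Rightarrow> ('a \<Rightarrow> 'b) \<Rightarrow> bool" where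
  "star_iso A B f \<longleftrightarrow>
     bij_betw f (carrier A) (carrier B) \<and>
     (\<forall>x\<in>carrier A. \<forall>y\<in>carrier A. f (vadd A x y) = vadd B (f x) (f y)) \<and>
     (\<forall>c. \<forall>x\<in>carrier A. f (vscale A c x) = vscale B c (f x)) \<and>
     (\<forall>x\<in>carrier A. \<forall>y\<in>carrier A. f (vmult A x y) = vmult B (f x) (f y)) \<and>
     (\<forall>x\<in>carrier A. f (vstar A x) = vstar B (f x))"

definition star_isomorphic :: "'a cstar \<Rightarrow> 'b cstar \<Rightarrow> bool" where
  "star_isomorphic A B \<longleftrightarrow> (\<exists>f. star_iso A B f)"


section \<open>Ideals and quotients\<close>

definition closed_ideals :: "'a cstar \<Rightarrow> 'a set set" where
  "closed_ideals A = {I. subgroup I (add_group A) \<and>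
              (\<forall>c. \<forall>x\<in>I. vscale A c x \<in> I) \<and>
              (\<forall>a\<in>carrier A. \<forall>x\<in>I. vmult A a x \<in> I \<and> vmult A x a \<in> I) \<and>
              closedin (ctopology A) I}"

definition restr :: "'a cstar \<Rightarrow> 'a set \<Rightarrow> 'a cstar" where
  "restr A J = A\<lparr>carrier := J\<rparr>"

text \<open>The operations on cosets are those induced by representatives; the union over all
  representatives is the common value. The norm is the usual quotient norm.\<close>

definition quot :: "'a cstar \<Rightarrow> 'a set \<Rightarrow> 'a set cstar" where
  "quot A I =
     \<lparr>carrier = rcosets\<^bsub>add_group A\<^esub> I,
      vzero = I,
      vadd = (\<lambda>X Y. X <#>\<^bsub>add_group A\<^esub> Y),
      vscale = (\<lambda>c X. \<Union>x\<in>X. I #>\<^bsub>add_group A\<^esub> (vscale A c x)),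
      vmult = (\<lambda>X Y. \<Union>x\<in>X. \<Union>y\<in>Y. I #>\<^bsub>add_group A\<^esub> (vmult A x y)),
      vstar = (\<lambda>X. \<Union>x\<in>X. I #>\<^bsub>add_group A\<^esub> (vstar A x)),
      vnorm = (\<lambda>X. INF x\<in>X. vnorm A x)\<rparr>"

definition ideal_sum :: "'a cstar \<Rightarrow> 'a set set \<Rightarrow> 'a set" where
  "ideal_sum A S = {foldr (vadd A) xs (vzero A) | xs. set xs \<subseteq> \<Union>S}"


section \<open>C*-properties\<close>

text \<open>A C*-property is given by its members \<open>P\<close> whose carrier lies in an arbitrary type
  \<open>'u\<close>; a C*-algebra on any other type belongs to the property iff it is *-isomorphic to one of
  these. For every isomorphism-closed class and every algebra \<open>A\<close> over \<open>'a\<close>, taking \<open>'u = 'a\<close>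
  captures all subquotients of \<open>A\<close>, because a subquotient of \<open>A\<close> has a copy whose carrier is a
  set of coset representatives.\<close>

definition cstar_property :: "'u cstar set \<Rightarrow> bool" where
  "cstar_property P \<longleftrightarrow>
     (\<forall>B\<in>P. cstar_algebra B) \<and>
     (\<forall>B. cstar_algebra B \<and> carrier B = {vzero B} \<longrightarrow> B \<in> P) \<and>
     (\<forall>B\<in>P. \<forall>C. cstar_algebra C \<and> star_isomorphic B C \<longrightarrow> C \<in> P)"

definition P_algebra :: "'u cstar set \<Rightarrow> 'a cstar \<Rightarrow> bool" where
  "P_algebra P B \<longleftrightarrow> cstar_algebra B \<and> (\<exists>C\<in>P. star_isomorphic B C)"

definition upper_stable :: "'u cstar set \<Rightarrow> bool" where
  "upper_stable P \<longleftrightarrow> (\<forall>B\<in>P. \<forall>I\<in>closed_ideals B. P_algebra P (quot B I))"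

definition has_nonzero_P_ideal :: "'u cstar set \<Rightarrow> 'a cstar \<Rightarrow> bool" where
  "has_nonzero_P_ideal P B \<longleftrightarrow> (\<exists>K\<in>closed_ideals B. K \<noteq> {vzero B} \<and> P_algebra P (restr B K))"

definition GP_algebra :: "'u cstar set \<Rightarrow> 'a cstar \<Rightarrow> bool" where
  "GP_algebra P B \<longleftrightarrow>
     cstar_algebra B \<and>
     (carrier B = {vzero B} \<or>
      (\<forall>I\<in>closed_ideals B. carrier (quot B I) \<noteq> {vzero (quot B I)} \<longrightarrow> has_nonzero_P_ideal P (quot B I)))"

definition NGP_algebra :: "'u cstar set \<Rightarrow> 'a cstar \<Rightarrow> bool" where
  "NGP_algebra P B \<longleftrightarrow> cstar_algebra B \<and> \<not> has_nonzero_P_ideal P B"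


section \<open>Transfinite series and the radical\<close>

definition ll :: "'u cstar set \<Rightarrow> 'a cstar \<Rightarrow> 'a set \<Rightarrow> 'a set \<Rightarrow> bool" where
  "ll P A I J \<longleftrightarrow> I \<in> closed_ideals A \<and> J \<in> closed_ideals A \<and> I \<subseteq> J \<and> P_algebra P (quot (restr A J) I)"

definition is_least :: "'i rel \<Rightarrow> 'i \<Rightarrow> bool" where
  "is_least r a \<longleftrightarrow> a \<in> Field r \<and> (\<forall>l\<in>Field r. (a, l) \<in> r)"

definition is_greatest :: "'i rel \<Rightarrow> 'i \<Rightarrow> bool" where
  "is_greatest r g \<longleftrightarrow> g \<in> Field r \<and> (\<forall>l\<in>Field r. (l, g) \<in> r)"

definition is_next :: "'i rel \<Rightarrow> 'i \<Rightarrow> 'i \<Rightarrow> bool" where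
  "is_next r l m \<longleftrightarrow> (l, m) \<in> r \<and> l \<noteq> m \<and> (\<forall>n. (l, n) \<in> r \<and> (n, m) \<in> r \<longrightarrow> n = l \<or> n = m)"

definition is_limit :: "'i rel \<Rightarrow> 'i \<Rightarrow> bool" where
  "is_limit r b \<longleftrightarrow> b \<in> Field r \<and> \<not> is_least r b \<and> (\<nexists>l. is_next r l b)"

text \<open>The ordinal interval \<open>[1, \<gamma>]\<close> is rendered by a well-order relation \<open>r\<close> with a greatest
  element; its least element plays the role of 1. Well-orders in
  \<^theory>\<open>HOL.BNF_Wellorder_Relation\<close> are reflexive on their field.\<close>

definition ascending_series ::
  "'u cstar set \<Rightarrow> 'a cstar \<Rightarrow> 'i rel \<Rightarrow> ('i \<Rightarrow> 'a set) \<Rightarrow> 'a set \<Rightarrow> 'a set \<Rightarrow> bool" where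
  "ascending_series P A r F I J \<longleftrightarrow>
     Well_order r \<and>
     (\<forall>l\<in>Field r. F l \<in> closed_ideals A) \<and>
     (\<exists>a. is_least r a \<and> F a = I) \<and>
     (\<exists>g. is_greatest r g \<and> F g = J) \<and>
     (\<forall>l m. (l, m) \<in> r \<longrightarrow> F l \<subseteq> F m) \<and>
     (\<forall>l m. is_next r l m \<longrightarrow> ll P A (F l) (F m)) \<and>
     (\<forall>b. is_limit r b \<longrightarrow> F b = (ctopology A) closure_of (\<Union>l\<in>underS r b. F l))"

text \<open>Index sets are taken in the type \<open>'a set\<close>, which is large enough for all ordinals: see
  \<open>ll_tri_if_ascending_series\<close> below.\<close>

definition ll_tri :: "'u cstar set \<Rightarrow> 'a cstar \<Rightarrow> 'a set \<Rightarrow> 'a set \<Rightarrow> bool" where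
  "ll_tri P A I J \<longleftrightarrow> (\<exists>(r :: 'a set rel) F. ascending_series P A r F I J)"

definition ll_radical :: "'u cstar set \<Rightarrow> 'a cstar \<Rightarrow> 'a set" where
  "ll_radical P A = (ctopology A) closure_of (ideal_sum A {J \<in> closed_ideals A. ll_tri P A {vzero A} J})"

lemma ll_tri_if_ascending_series:
  fixes r :: "'i rel" and A :: "'a cstar"
  assumes "ascending_series P A r F I J"
  shows "ll_tri P A I J"
proof -
  have wo: "Well_order r" and ideal: "\<And>l. l \<in> Field r \<Longrightarrow> F l \<in> closed_ideals A"
    and mono: "\<And>l m. (l, m) \<in> r \<Longrightarrow> F l \<subseteq> F m"
    and nxt: "\<And>l m. is_next r l m \<Longrightarrow> ll P A (F l) (F m)"
    and lim: "\<And>b. is_limit r b \<Longrightarrow> F b = (ctopology A) closure_of (\<Union>l\<in>underS r b. F l)"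
    using assms by (auto simp: ascending_series_def)
  obtain a g where a: "is_least r a" "F a = I" and g: "is_greatest r g" "F g = J"
    using assms by (auto simp: ascending_series_def)
  have wor: "wo_rel r" by (simp add: wo_rel_def wo)
  have tot: "\<And>l m. l \<in> Field r \<Longrightarrow> m \<in> Field r \<Longrightarrow> (l, m) \<in> r \<or> (m, l) \<in> r"
    using wo_rel.TOTALS[OF wor] by blast
  have fld: "\<And>l m. (l, m) \<in> r \<Longrightarrow> l \<in> Field r \<and> m \<in> Field r"
    by (auto simp: Field_def)
  have asym: "\<And>l m. (l, m) \<in> r \<Longrightarrow> (m, l) \<in> r \<Longrightarrow> l = m"
    using wo_rel.ANTISYM[OF wor] by (auto dest: antisymD)
  have least: "\<exists>b\<in>B. \<forall>m\<in>B. (b, m) \<in> r" if "B \<subseteq> Field r" "B \<noteq> {}" for B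
    using wo_rel.Well_order_isMinim_exists[OF wor that] by (auto simp: wo_rel.isMinim_def[OF wor])
  define S where "S = F ` Field r"
  define s where "s = {(K, L). K \<in> S \<and> L \<in> S \<and> K \<subseteq> L}"
  have Fs: "Field s = S"
    by (auto simp: s_def Field_def)
  have chain: "K \<subseteq> L \<or> L \<subseteq> K" if "K \<in> S" "L \<in> S" for K L
    using that tot mono unfolding S_def by blast
  have "wf (s - Id)"
    unfolding wf_eq_minimal
  proof (intro allI impI)
    fix Q :: "'a set set" and x assume x: "x \<in> Q"
    show "\<exists>z\<in>Q. \<forall>y. (y, z) \<in> s - Id \<longrightarrow> y \<notin> Q"
    proof (cases "x \<in> S")
      case False
      then show ?thesis using x by (auto simp: s_def)
    next
      case True
      then have "{l \<in> Field r. F l \<in> Q} \<noteq> {}"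
        using x by (auto simp: S_def)
      then obtain b where b: "b \<in> Field r" "F b \<in> Q"
        and bm: "\<And>m. m \<in> Field r \<Longrightarrow> F m \<in> Q \<Longrightarrow> (b, m) \<in> r"
        using least[of "{l \<in> Field r. F l \<in> Q}"] by auto
      have "y \<notin> Q" if y: "(y, F b) \<in> s - Id" for y
      proof
        assume "y \<in> Q"
        from y obtain m where m: "m \<in> Field r" "y = F m" "F m \<subseteq> F b" "F m \<noteq> F b"
          by (auto simp: s_def S_def)
        then show False using bm[of m] mono \<open>y \<in> Q\<close> by blast
      qed
      then show ?thesis using b by blast
    qed
  qed
  moreover have "Refl s" "trans s" "antisym s" "Total s" "s \<subseteq> Field s \<times> Field s"
    using chain unfolding Fs by (auto simp: s_def refl_on_def trans_def antisym_def total_on_def)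
  ultimately have WOs: "Well_order s"
    by (simp add: well_order_on_def linear_order_on_def partial_order_on_def preorder_on_def)
  have "is_least s (F a)"
    using a mono by (auto simp: is_least_def Fs) (auto simp: s_def S_def)
  moreover have "is_greatest s (F g)"
    using g mono by (auto simp: is_greatest_def Fs) (auto simp: s_def S_def)
  moreover have "ll P A K L" if KL: "is_next s K L" for K L
  proof -
    from KL have KS: "K \<in> S" "L \<in> S" "K \<subseteq> L" "K \<noteq> L"
      by (auto simp: is_next_def s_def)
    then obtain k where k: "k \<in> Field r" "K = F k" by (auto simp: S_def)
    define C where "C = {m \<in> Field r. K \<subset> F m}"
    have "C \<noteq> {}" using KS by (auto simp: C_def S_def)
    then obtain b where b: "b \<in> Field r" "K \<subset> F b" and bm: "\<And>m. m \<in> C \<Longrightarrow> (b, m) \<in> r"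
      using least[of C] unfolding C_def by blast
    have below: "F m \<subseteq> K" if "(m, b) \<in> r" "m \<noteq> b" for m
    proof -
      have "m \<notin> C" using bm asym that by blast
      then show ?thesis using chain[of "F m" K] KS fld[OF that(1)] by (auto simp: C_def S_def)
    qed
    have "F b \<subseteq> L"
      using KS bm mono unfolding S_def C_def by blast
    then have "F b = L"
      using KL b KS unfolding is_next_def s_def S_def by blast
    have kb: "(k, b) \<in> r" "k \<noteq> b"
      using tot[OF k(1) b(1)] mono b k by blast+
    have "\<not> is_limit r b"
    proof
      assume "is_limit r b"
      moreover have "(ctopology A) closure_of (\<Union>l\<in>underS r b. F l) \<subseteq> K"
      proof (rule closure_of_minimal)
        show "(\<Union>l\<in>underS r b. F l) \<subseteq> K" using below by (auto simp: underS_def)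
        show "closedin (ctopology A) K" using ideal[OF k(1)] k(2) by (simp add: closed_ideals_def)
      qed
      ultimately show False using lim b by blast
    qed
    moreover have "\<not> is_least r b"
      using kb asym k unfolding is_least_def by blast
    ultimately obtain l where l: "is_next r l b"
      using b by (auto simp: is_limit_def)
    then have lb: "(l, b) \<in> r" "l \<noteq> b" by (auto simp: is_next_def)
    have "(k, l) \<in> r"
      using l kb tot[OF k(1)] fld[OF lb(1)] unfolding is_next_def by blast
    then have "F l = K" using mono below[OF lb] k by blast
    then show ?thesis using nxt[OF l] \<open>F b = L\<close> by simp
  qed
  moreover have "K = (ctopology A) closure_of (\<Union>X\<in>underS s K. X)" if K: "is_limit s K" for K
  proof -
    have KS: "K \<in> S" using K by (simp add: is_limit_def Fs)
    then obtain b where b: "b \<in> Field r" "F b = K"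
      and bm: "\<And>m. m \<in> Field r \<Longrightarrow> F m = K \<Longrightarrow> (b, m) \<in> r"
      using least[of "{l \<in> Field r. F l = K}"] unfolding S_def by blast
    have "\<not> is_least r b"
    proof
      assume "is_least r b"
      then have "is_least s K"
        using mono b KS by (auto simp: is_least_def Fs) (auto simp: s_def S_def)
      then show False using K by (simp add: is_limit_def)
    qed
    moreover have "\<not> is_next r l b" for l
    proof
      assume l: "is_next r l b"
      then have lb: "(l, b) \<in> r" "l \<noteq> b" "l \<in> Field r" using fld by (auto simp: is_next_def)
      have "F l \<noteq> K" using bm lb asym by blast
      moreover have "Y = F l \<or> Y = K" if Y: "Y \<in> S" "F l \<subseteq> Y" "Y \<subseteq> K" for Y
      proof -
        obtain m where m: "m \<in> Field r" "Y = F m" using Y by (auto simp: S_def)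
        have "(m, l) \<in> r \<or> (b, m) \<in> r"
          using l tot[OF m(1) lb(3)] tot[OF m(1) b(1)] unfolding is_next_def by blast
        then show ?thesis using mono m Y b by blast
      qed
      ultimately have "is_next s (F l) K"
        using mono[OF lb(1)] b lb(3) KS by (auto simp: is_next_def s_def S_def)
      then show False using K by (auto simp: is_limit_def)
    qed
    ultimately have "is_limit r b" using b by (simp add: is_limit_def)
    moreover have "(\<Union>l\<in>underS r b. F l) = (\<Union>X\<in>underS s K. X)"
    proof (intro equalityI subsetI)
      fix x assume "x \<in> (\<Union>l\<in>underS r b. F l)"
      then obtain l where l: "(l, b) \<in> r" "l \<noteq> b" "x \<in> F l" by (auto simp: underS_def)
      then have "F l \<noteq> K" using bm asym fld by blast
      then have "F l \<in> underS s K"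
        using mono[OF l(1)] fld[OF l(1)] b KS by (auto simp: underS_def s_def S_def)
      then show "x \<in> (\<Union>X\<in>underS s K. X)" using l by blast
    next
      fix x assume "x \<in> (\<Union>X\<in>underS s K. X)"
      then obtain m where m: "m \<in> Field r" "F m \<subseteq> K" "F m \<noteq> K" "x \<in> F m"
        by (auto simp: underS_def s_def S_def)
      then have "(m, b) \<in> r" "m \<noteq> b" using tot[OF m(1) b(1)] mono b by blast+
      then show "x \<in> (\<Union>l\<in>underS r b. F l)" using m by (auto simp: underS_def)
    qed
    ultimately show ?thesis using lim b by simp
  qed
  moreover have "\<forall>K\<in>Field s. K \<in> closed_ideals A" using ideal by (auto simp: Fs S_def)
  moreover have "K \<subseteq> L" if "(K, L) \<in> s" for K L using that by (auto simp: s_def)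
  ultimately have "ascending_series P A s (\<lambda>K. K) I J"
    using WOs a(2) g(2) unfolding ascending_series_def by blast
  then show ?thesis unfolding ll_tri_def by blast
qed

end

theory Submission
  imports Defs "HOL-Library.Bourbaki_Witt_Fixpoint"
begin

text \<open>
  Call \<open>J\<close> a \<open>P\<close>-step above \<open>I\<close> if \<open>I \<subseteq> J\<close> and \<open>J / I\<close> is a \<open>P\<close>-algebra. Iterating \<open>P\<close>-steps transfinitely
  from \<open>{0}\<close>, with closures of unions at limits, leads to an ideal \<open>M\<close> that admits no proper \<open>P\<close>-step
  (\<open>maximal_series_exists\<close>), which means that \<open>A / M\<close> has no non-zero \<open>P\<close>-ideal.

  Everything else follows from one transfer principle (\<open>nonzero_P_ideal_quotI\<close>): if \<open>L\<close> is a \<open>P\<close>-step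
  above \<open>K\<close> and \<open>I\<close> contains \<open>K\<close> but not \<open>L\<close>, then the image of \<open>L\<close> in \<open>A / I\<close> is a non-zero \<open>P\<close>-ideal, being a
  quotient of \<open>L / K\<close>. A series that leaves \<open>I\<close> contains such a step (\<open>ll_tri_leaves_ideal\<close>). So an ideal
  \<open>I\<close> for which \<open>A / I\<close> has no non-zero \<open>P\<close>-ideal contains the end of every series from \<open>{0}\<close>; taking
  \<open>I = M\<close> shows that \<open>M\<close> is the radical, and the same argument inside \<open>M\<close> shows that every non-zero quotient
  of \<open>M\<close> has a non-zero \<open>P\<close>-ideal. Finally, if an ideal \<open>J\<close> with this last property were not contained
  in \<open>M\<close>, then some ideal contained in \<open>J\<close> would be a proper \<open>P\<close>-step above
  \<open>J \<inter> M\<close>, and its image in \<open>A / M\<close> would be a non-zero \<open>P\<close>-ideal.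

  The transfer principle needs a part of C*-theory: closed ideals and quotients of C*-algebras are
  C*-algebras, a closed ideal of a closed ideal is a closed ideal, kernels of homomorphisms are closed,
  and images of closed ideals in quotients are closed. All of this is derived without spectral theory from
  the observation that unitaries act isometrically (\<open>unitary_contraction\<close>). Banach's fixed point theorem
  supplies the square roots and resolvents of hermitian elements that produce enough unitaries.
  They give the contractivity of homomorphisms (\<open>star_hom_contractive\<close>) and, via a Cayley
  transform, the elements \<open>e\<close> of a closed ideal for which \<open>1 - e\<close> is a contraction that nearly annihilates
  a given element (\<open>approximate_unit\<close>); the latter yield the statements about ideals and quotients.
\<close>

section \<open>Linear identities and sequences\<close>

lemma tendsto_zero_squeeze:
  fixes f g :: "nat \<Rightarrow> real"
  assumes "\<And>n. 0 \<le> f n" "\<And>n. f n \<le> g n" "g \<longlonglongrightarrow> 0"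
  shows "f \<longlonglongrightarrow> 0"
  using assms by (intro tendsto_sandwich[of "\<lambda>_. 0" f sequentially g 0]) auto

context cstar_algebra
begin

abbreviation add_A (infixl "\<boxplus>" 65) where "x \<boxplus> y \<equiv> vadd A x y"
abbreviation scale_A (infixr "\<cdot>" 75) where "c \<cdot> x \<equiv> vscale A c x"
abbreviation sub_A (infixl "\<boxminus>" 65) where "x \<boxminus> y \<equiv> vadd A x (vscale A (- 1) y)"
abbreviation mult_A (infixl "\<boxtimes>" 70) where "x \<boxtimes> y \<equiv> vmult A x y"
abbreviation star_A where "star_A x \<equiv> vstar A x"
abbreviation norm_A ("\<parallel>_\<parallel>") where "\<parallel>x\<parallel> \<equiv> vnorm A x"
abbreviation zero_A ("\<zero>\<^sub>A") where "\<zero>\<^sub>A \<equiv> vzero A"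

lemma add_closed: "\<lbrakk>x \<in> carrier A; y \<in> carrier A\<rbrakk> \<Longrightarrow> x \<boxplus> y \<in> carrier A"
  using comm_group.axioms(2)[OF add_group] group.is_monoid monoid.m_closed[of "add_group A" x y]
  by (auto simp: add_group_def)

lemma zero_closed: "\<zero>\<^sub>A \<in> carrier A"
  using comm_group.axioms(2)[OF add_group] group.is_monoid monoid.one_closed[of "add_group A"]
  by (auto simp: add_group_def)

lemmas closed [simp, intro] =
  add_closed zero_closed scale_closed mult_closed star_closed

lemma add_assoc:
  "\<lbrakk>x \<in> carrier A; y \<in> carrier A; z \<in> carrier A\<rbrakk> \<Longrightarrow> x \<boxplus> y \<boxplus> z = x \<boxplus> (y \<boxplus> z)"
  using comm_group.axioms(2)[OF add_group] group.is_monoid monoid.m_assoc[of "add_group A" x y z]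
  by (auto simp: add_group_def)

lemma add_commute: "\<lbrakk>x \<in> carrier A; y \<in> carrier A\<rbrakk> \<Longrightarrow> x \<boxplus> y = y \<boxplus> x"
  using comm_monoid.m_comm[OF comm_group.axioms(1)[OF add_group], of x y]
  by (auto simp: add_group_def)

lemma add_left_commute:
  "\<lbrakk>x \<in> carrier A; y \<in> carrier A; z \<in> carrier A\<rbrakk> \<Longrightarrow> x \<boxplus> (y \<boxplus> z) = y \<boxplus> (x \<boxplus> z)"
  by (metis add_assoc add_commute)

lemmas add_ac = add_assoc add_commute add_left_commute

lemma add_zero [simp]: "x \<in> carrier A \<Longrightarrow> x \<boxplus> \<zero>\<^sub>A = x" "x \<in> carrier A \<Longrightarrow> \<zero>\<^sub>A \<boxplus> x = x"
  using comm_group.axioms(2)[OF add_group] group.is_monoid monoid.r_one[of "add_group A" x]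
    monoid.l_one[of "add_group A" x]
  by (auto simp: add_group_def)

lemma add_left_cancel:
  "\<lbrakk>x \<in> carrier A; y \<in> carrier A; z \<in> carrier A\<rbrakk> \<Longrightarrow> x \<boxplus> y = x \<boxplus> z \<longleftrightarrow> y = z"
  using comm_group.axioms(2)[OF add_group] group.is_monoid group.Units_eq
    monoid.Units_l_cancel[of "add_group A" x y z]
  by (fastforce simp: add_group_def)

lemma scale_zero_left [simp]: assumes "x \<in> carrier A" shows "0 \<cdot> x = \<zero>\<^sub>A"
  using scale_add_left[of x 0 0] add_left_cancel[of "0 \<cdot> x" "0 \<cdot> x" "\<zero>\<^sub>A"] assms by simp

lemma scale_zero_right [simp]: "c \<cdot> \<zero>\<^sub>A = \<zero>\<^sub>A"
  using scale_scale[of "\<zero>\<^sub>A" c 0] by simp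

lemma minus_self [simp]: assumes "x \<in> carrier A" shows "x \<boxminus> x = \<zero>\<^sub>A"
  using scale_add_left[of x 1 "- 1"] assms by (simp add: scale_one)

lemma inv_eq:
  assumes "x \<in> carrier A" shows "inv\<^bsub>add_group A\<^esub> x = (- 1) \<cdot> x"
  using group.inv_equality[OF comm_group.axioms(2)[OF add_group], of "(- 1) \<cdot> x" x] assms
    minus_self[OF assms]
  by (simp add: add_group_def add_commute)

text \<open>Simplification alone does not decide identities between linear combinations when every rewrite
  rule carries membership conditions. Writing each vector as \<open>f\<close> of a unit coefficient
  tuple, with \<open>f\<close> left opaque, turns such an identity into one between coefficients, and the
  rewriting of \<open>x\<close> into \<open>f 1 0 0 0 0\<close> terminates because \<open>x\<close> no longer occurs on the right.\<close>

lemma linear_coordinates5: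
  assumes "x \<in> carrier A" "y \<in> carrier A" "z \<in> carrier A" "w \<in> carrier A" "v \<in> carrier A"
  obtains f where "x = f 1 0 0 0 0" "y = f 0 1 0 0 0" "z = f 0 0 1 0 0" "w = f 0 0 0 1 0"
      "v = f 0 0 0 0 1" "\<zero>\<^sub>A = f 0 0 0 0 0"
    and "\<And>a b c d e a' b' c' d' e'.
      f a b c d e \<boxplus> f a' b' c' d' e' = f (a + a') (b + b') (c + c') (d + d') (e + e')"
    and "\<And>k a b c d e. k \<cdot> f a b c d e = f (k * a) (k * b) (k * c) (k * d) (k * e)"
  using assms
  by (intro that[of "\<lambda>a b c d e. a \<cdot> x \<boxplus> (b \<cdot> y \<boxplus> (c \<cdot> z \<boxplus> (d \<cdot> w \<boxplus> e \<cdot> v)))"])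
    (simp_all add: scale_one scale_add_left scale_add_right scale_scale add_ac)

lemma linear_coordinates2:
  assumes "x \<in> carrier A" "y \<in> carrier A"
  obtains f where "x = f 1 0" "y = f 0 1" "\<zero>\<^sub>A = f 0 0"
    and "\<And>a b a' b'. f a b \<boxplus> f a' b' = f (a + a') (b + b')"
    and "\<And>k a b. k \<cdot> f a b = f (k * a) (k * b)"
  using assms
  by (intro that[of "\<lambda>a b. a \<cdot> x \<boxplus> b \<cdot> y"])
    (simp_all add: scale_one scale_add_left scale_add_right scale_scale add_ac)

lemma linear_coordinates3:
  assumes "x \<in> carrier A" "y \<in> carrier A" "z \<in> carrier A"
  obtains f where "x = f 1 0 0" "y = f 0 1 0" "z = f 0 0 1" "\<zero>\<^sub>A = f 0 0 0"
    and "\<And>a b c a' b' c'. f a b c \<boxplus> f a' b' c' = f (a + a') (b + b') (c + c')"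
    and "\<And>k a b c. k \<cdot> f a b c = f (k * a) (k * b) (k * c)"
  using assms
  by (intro that[of "\<lambda>a b c. a \<cdot> x \<boxplus> (b \<cdot> y \<boxplus> c \<cdot> z)"])
    (simp_all add: scale_one scale_add_left scale_add_right scale_scale add_ac)

lemma mult_zero [simp]:
  assumes "x \<in> carrier A" shows "x \<boxtimes> \<zero>\<^sub>A = \<zero>\<^sub>A" "\<zero>\<^sub>A \<boxtimes> x = \<zero>\<^sub>A"
  using mult_scale_right[of x "\<zero>\<^sub>A" 0] mult_scale_left[of "\<zero>\<^sub>A" x 0] assms by simp_all

lemma star_zero [simp]: "star_A \<zero>\<^sub>A = \<zero>\<^sub>A"
  using star_scale[of "\<zero>\<^sub>A" 0] by simp

lemma norm_zero [simp]: "\<parallel>\<zero>\<^sub>A\<parallel> = 0"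
  by (simp add: norm_eq_zero_iff)

lemma norm_star:
  assumes x: "x \<in> carrier A" shows "\<parallel>star_A x\<parallel> = \<parallel>x\<parallel>"
proof -
  have le: "\<parallel>z\<parallel> \<le> \<parallel>star_A z\<parallel>" if z: "z \<in> carrier A" for z
  proof (cases "z = \<zero>\<^sub>A")
    case False
    then have "0 < \<parallel>z\<parallel>" using norm_nonneg[OF z] norm_eq_zero_iff[OF z] by linarith
    moreover have "\<parallel>z\<parallel> * \<parallel>z\<parallel> \<le> \<parallel>star_A z\<parallel> * \<parallel>z\<parallel>"
      using norm_mult[of "star_A z" z] cstar_identity[OF z] z by (simp add: power2_eq_square)
    ultimately show ?thesis by simp
  qed simp
  show ?thesis using le[OF x] le[of "star_A x"] x by (simp add: star_star)
qed

lemma norm_minus: "x \<in> carrier A \<Longrightarrow> \<parallel>(- 1) \<cdot> x\<parallel> = \<parallel>x\<parallel>"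
  by (simp add: norm_scale)

lemma minus_swap:
  assumes "x \<in> carrier A" "y \<in> carrier A" shows "(- 1) \<cdot> (x \<boxminus> y) = y \<boxminus> x"
  by (rule linear_coordinates2[of x y]) (simp_all add: assms)

lemma norm_minus_commute:
  assumes "x \<in> carrier A" "y \<in> carrier A" shows "\<parallel>x \<boxminus> y\<parallel> = \<parallel>y \<boxminus> x\<parallel>"
  using norm_minus[of "x \<boxminus> y"] minus_swap[of x y] assms by simp

lemma minus_trans:
  assumes "x \<in> carrier A" "y \<in> carrier A" "z \<in> carrier A"
  shows "(x \<boxminus> y) \<boxplus> (y \<boxminus> z) = x \<boxminus> z"
  by (rule linear_coordinates3[of x y z]) (simp_all add: assms)

lemma minus_add_cancel:
  assumes "x \<in> carrier A" "y \<in> carrier A" shows "(x \<boxminus> y) \<boxplus> y = x"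
  by (rule linear_coordinates2[of x y]) (simp_all add: assms)

lemma norm_minus_triangle:
  assumes "x \<in> carrier A" "y \<in> carrier A" "z \<in> carrier A"
  shows "\<parallel>x \<boxminus> z\<parallel> \<le> \<parallel>x \<boxminus> y\<parallel> + \<parallel>y \<boxminus> z\<parallel>"
  using norm_triangle[of "x \<boxminus> y" "y \<boxminus> z"] minus_trans[OF assms] assms by simp

lemma minus_eq_zero_iff:
  assumes "x \<in> carrier A" "y \<in> carrier A" shows "x \<boxminus> y = \<zero>\<^sub>A \<longleftrightarrow> x = y"
  using minus_add_cancel[OF assms] assms by auto

lemma norm_le_add:
  assumes "x \<in> carrier A" "y \<in> carrier A" shows "\<parallel>x\<parallel> \<le> \<parallel>x \<boxminus> y\<parallel> + \<parallel>y\<parallel>"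
  using norm_triangle[of "x \<boxminus> y" y] minus_add_cancel[OF assms] assms by simp

sublocale Metric_space "carrier A" "cdist A"
proof
  show "0 \<le> cdist A x y" for x y by (auto simp: cdist_def intro: norm_nonneg)
  show "cdist A x y = cdist A y x" for x y by (auto simp: cdist_def norm_minus_commute)
  show "cdist A x y = 0 \<longleftrightarrow> x = y" if "x \<in> carrier A" "y \<in> carrier A" for x y
    using that by (simp add: cdist_def norm_eq_zero_iff minus_eq_zero_iff)
  show "cdist A x z \<le> cdist A x y + cdist A y z"
    if "x \<in> carrier A" "y \<in> carrier A" "z \<in> carrier A" for x y z
    using that by (simp add: cdist_def norm_minus_triangle)
qed

definition tends :: "(nat \<Rightarrow> 'a) \<Rightarrow> 'a \<Rightarrow> bool" where
  "tends \<sigma> l \<longleftrightarrow> l \<in> carrier A \<and> (\<forall>n. \<sigma> n \<in> carrier A) \<and> (\<lambda>n. \<parallel>\<sigma> n \<boxminus> l\<parallel>) \<longlonglongrightarrow> 0"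

lemma tends_iff_limitin:
  assumes "\<And>n. \<sigma> n \<in> carrier A"
  shows "tends \<sigma> l \<longleftrightarrow> limitin mtopology \<sigma> l sequentially"
proof -
  have "tends \<sigma> l \<longleftrightarrow> l \<in> carrier A \<and> (\<lambda>n. cdist A (\<sigma> n) l) \<longlonglongrightarrow> 0"
    using assms by (auto simp: tends_def cdist_def)
  also have "\<dots> \<longleftrightarrow> limitin mtopology \<sigma> l sequentially"
    using assms by (auto simp: limitin_metric_dist_null)
  finally show ?thesis .
qed

lemma closedin_iff_tends:
  "closedin mtopology S \<longleftrightarrow> S \<subseteq> carrier A \<and> (\<forall>\<sigma> l. (\<forall>n. \<sigma> n \<in> S) \<and> tends \<sigma> l \<longrightarrow> l \<in> S)"
  (is "?L \<longleftrightarrow> ?R")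
proof -
  have "?L \<longleftrightarrow> S \<subseteq> carrier A \<and> (\<forall>\<sigma> l. range \<sigma> \<subseteq> S \<and> limitin mtopology \<sigma> l sequentially \<longrightarrow> l \<in> S)"
    by (rule metric_closedin_iff_sequentially_closed)
  also have "\<dots> \<longleftrightarrow> ?R"
    using tends_iff_limitin by (metis UNIV_I image_subset_iff subsetD)
  finally show ?thesis .
qed

lemma MCauchy_iff:
  "MCauchy \<sigma> \<longleftrightarrow> (\<forall>n. \<sigma> n \<in> carrier A) \<and> (\<forall>\<epsilon>>0. \<exists>N. \<forall>m\<ge>N. \<forall>n\<ge>N. \<parallel>\<sigma> m \<boxminus> \<sigma> n\<parallel> < \<epsilon>)"
  (is "?L \<longleftrightarrow> ?R")
proof -
  have "?L \<longleftrightarrow> (\<forall>n. \<sigma> n \<in> carrier A) \<and> (\<forall>\<epsilon>>0. \<exists>N. \<forall>m n. N \<le> m \<longrightarrow> N \<le> n \<longrightarrow> cdist A (\<sigma> m) (\<sigma> n) < \<epsilon>)"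
    by (auto simp: MCauchy_def)
  also have "\<dots> \<longleftrightarrow> ?R"
  proof (rule conj_cong[OF refl])
    assume "\<forall>n. \<sigma> n \<in> carrier A"
    then have "cdist A (\<sigma> m) (\<sigma> n) = \<parallel>\<sigma> m \<boxminus> \<sigma> n\<parallel>" for m n by (simp add: cdist_def)
    then show "(\<forall>\<epsilon>>0. \<exists>N. \<forall>m n. N \<le> m \<longrightarrow> N \<le> n \<longrightarrow> cdist A (\<sigma> m) (\<sigma> n) < \<epsilon>) \<longleftrightarrow>
      (\<forall>\<epsilon>>0. \<exists>N. \<forall>m\<ge>N. \<forall>n\<ge>N. \<parallel>\<sigma> m \<boxminus> \<sigma> n\<parallel> < \<epsilon>)" by simp
  qed
  finally show ?thesis .
qed

lemma Cauchy_tends: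
  assumes "\<And>n. \<sigma> n \<in> carrier A"
    and "\<And>\<epsilon>. \<epsilon> > 0 \<Longrightarrow> \<exists>N. \<forall>m\<ge>N. \<forall>n\<ge>N. \<parallel>\<sigma> m \<boxminus> \<sigma> n\<parallel> < \<epsilon>"
  obtains l where "tends \<sigma> l"
proof -
  have "MCauchy \<sigma>" using assms by (simp add: MCauchy_iff)
  then obtain l where "limitin mtopology \<sigma> l sequentially"
    using complete by (auto simp: mcomplete_def)
  then show ?thesis using that tends_iff_limitin[of \<sigma>] assms(1) by blast
qed

text \<open>Both Banach's fixed point theorem below and the completeness of quotients are obtained from
  sequences whose consecutive terms approach each other geometrically.\<close>

lemma geometric_tends:
  assumes \<sigma>: "\<And>n. \<sigma> n \<in> carrier A" and k: "0 \<le> k" "k < (1::real)"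
    and step: "\<And>n. \<parallel>\<sigma> (Suc n) \<boxminus> \<sigma> n\<parallel> \<le> C * k ^ n"
  obtains l where "tends \<sigma> l"
proof (rule Cauchy_tends)
  have C: "0 \<le> C" using step[of 0] norm_nonneg[of "\<sigma> 1 \<boxminus> \<sigma> 0"] \<sigma> by (simp add: order_trans)
  have far: "\<parallel>\<sigma> (n + m) \<boxminus> \<sigma> n\<parallel> \<le> C * k ^ n / (1 - k) * (1 - k ^ m)" for n m
  proof (induction m)
    case 0 then show ?case using \<sigma> by simp
  next
    case (Suc m)
    have "\<parallel>\<sigma> (n + Suc m) \<boxminus> \<sigma> n\<parallel> \<le> C * k ^ (n + m) + C * k ^ n / (1 - k) * (1 - k ^ m)"
      using norm_minus_triangle[of "\<sigma> (n + Suc m)" "\<sigma> (n + m)" "\<sigma> n"] Suc step[of "n + m"] \<sigma>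
      by simp
    also have "\<dots> = C * k ^ n / (1 - k) * (1 - k ^ Suc m)"
      using k by (simp add: field_simps power_add)
    finally show ?case .
  qed
  have far': "\<parallel>\<sigma> m \<boxminus> \<sigma> n\<parallel> \<le> C / (1 - k) * k ^ n" if "n \<le> m" for m n
  proof -
    have "C * k ^ n / (1 - k) * (1 - k ^ (m - n)) \<le> C * k ^ n / (1 - k) * 1"
      using k C by (intro mult_left_mono) auto
    then show ?thesis using far[of n "m - n"] that by simp
  qed
  fix \<epsilon> :: real assume \<epsilon>: "\<epsilon> > 0"
  have "(\<lambda>n. C / (1 - k) * k ^ n) \<longlonglongrightarrow> C / (1 - k) * 0"
    using k by (intro tendsto_mult tendsto_const LIMSEQ_realpow_zero) auto
  then obtain N where N: "\<And>n. n \<ge> N \<Longrightarrow> C / (1 - k) * k ^ n < \<epsilon>"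
    using order_tendstoD(2)[of _ "C / (1 - k) * 0" sequentially \<epsilon>] \<epsilon>
    unfolding eventually_sequentially by (metis mult_zero_right)
  have "\<parallel>\<sigma> m \<boxminus> \<sigma> n\<parallel> < \<epsilon>" if "m \<ge> N" "n \<ge> N" for m n
  proof (cases "n \<le> m")
    case True then show ?thesis using far'[of n m] N[of n] that by linarith
  next
    case False then show ?thesis
      using far'[of m n] N[of m] that norm_minus_commute[of "\<sigma> m" "\<sigma> n"] \<sigma> by simp
  qed
  then show "\<exists>N. \<forall>m\<ge>N. \<forall>n\<ge>N. \<parallel>\<sigma> m \<boxminus> \<sigma> n\<parallel> < \<epsilon>" by blast
qed (use \<sigma> that in auto)

lemma tends_unique: "tends \<sigma> l \<Longrightarrow> tends \<sigma> l' \<Longrightarrow> l = l'"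
  using tends_iff_limitin[of \<sigma>] limitin_metric_unique[of \<sigma> _ sequentially]
  by (metis tends_def trivial_limit_sequentially)

lemma tends_Lipschitz:
  assumes "tends \<sigma> l" and "\<And>n. f (\<sigma> n) \<in> carrier A" "f l \<in> carrier A"
    and "\<And>n. \<parallel>f (\<sigma> n) \<boxminus> f l\<parallel> \<le> K * \<parallel>\<sigma> n \<boxminus> l\<parallel>"
  shows "tends (\<lambda>n. f (\<sigma> n)) (f l)"
proof -
  have "(\<lambda>n. K * \<parallel>\<sigma> n \<boxminus> l\<parallel>) \<longlonglongrightarrow> K * 0"
    using assms(1) unfolding tends_def by (intro tendsto_intros) auto
  then have "(\<lambda>n. \<parallel>f (\<sigma> n) \<boxminus> f l\<parallel>) \<longlonglongrightarrow> 0"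
    using assms by (intro tendsto_zero_squeeze[OF _ assms(4)]) (simp_all add: norm_nonneg)
  then show ?thesis using assms by (auto simp: tends_def)
qed

lemma mult_minus_right:
  assumes "c \<in> carrier A" "x \<in> carrier A" "y \<in> carrier A"
  shows "c \<boxtimes> x \<boxminus> c \<boxtimes> y = c \<boxtimes> (x \<boxminus> y)" "x \<boxtimes> c \<boxminus> y \<boxtimes> c = (x \<boxminus> y) \<boxtimes> c"
  using assms by (simp_all add: mult_add_left mult_add_right mult_scale_left mult_scale_right)

lemma scale_minus_right:
  assumes "x \<in> carrier A" "y \<in> carrier A" shows "c \<cdot> x \<boxminus> c \<cdot> y = c \<cdot> (x \<boxminus> y)"
  using assms by (simp add: scale_add_right scale_scale)

lemma star_minus:
  assumes "x \<in> carrier A" "y \<in> carrier A" shows "star_A x \<boxminus> star_A y = star_A (x \<boxminus> y)"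
  using assms by (simp add: star_add star_scale)

lemma tends_mult_left:
  assumes \<sigma>: "tends \<sigma> l" and c: "c \<in> carrier A" shows "tends (\<lambda>n. c \<boxtimes> \<sigma> n) (c \<boxtimes> l)"
proof (rule tends_Lipschitz[OF \<sigma>, where K = "\<parallel>c\<parallel>" and f = "\<lambda>x. c \<boxtimes> x"])
  show "\<parallel>c \<boxtimes> \<sigma> n \<boxminus> c \<boxtimes> l\<parallel> \<le> \<parallel>c\<parallel> * \<parallel>\<sigma> n \<boxminus> l\<parallel>" for n
    using norm_mult[of c "\<sigma> n \<boxminus> l"] \<sigma> c by (auto simp: tends_def mult_minus_right)
qed (use \<sigma> c in \<open>auto simp: tends_def\<close>)

lemma tends_mult_right:
  assumes \<sigma>: "tends \<sigma> l" and c: "c \<in> carrier A" shows "tends (\<lambda>n. \<sigma> n \<boxtimes> c) (l \<boxtimes> c)"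
proof (rule tends_Lipschitz[OF \<sigma>, where K = "\<parallel>c\<parallel>" and f = "\<lambda>x. x \<boxtimes> c"])
  show "\<parallel>\<sigma> n \<boxtimes> c \<boxminus> l \<boxtimes> c\<parallel> \<le> \<parallel>c\<parallel> * \<parallel>\<sigma> n \<boxminus> l\<parallel>" for n
    using norm_mult[of "\<sigma> n \<boxminus> l" c] \<sigma> c by (auto simp: tends_def mult_minus_right mult.commute)
qed (use \<sigma> c in \<open>auto simp: tends_def\<close>)

lemma tends_scale: assumes \<sigma>: "tends \<sigma> l" shows "tends (\<lambda>n. c \<cdot> \<sigma> n) (c \<cdot> l)"
proof (rule tends_Lipschitz[OF \<sigma>, where K = "cmod c" and f = "\<lambda>x. c \<cdot> x"])
  show "\<parallel>c \<cdot> \<sigma> n \<boxminus> c \<cdot> l\<parallel> \<le> cmod c * \<parallel>\<sigma> n \<boxminus> l\<parallel>" for n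
    using \<sigma> scale_minus_right[of "\<sigma> n" l c] norm_scale[of "\<sigma> n \<boxminus> l" c] by (auto simp: tends_def)
qed (use \<sigma> in \<open>auto simp: tends_def\<close>)

lemma tends_star: assumes \<sigma>: "tends \<sigma> l" shows "tends (\<lambda>n. star_A (\<sigma> n)) (star_A l)"
proof (rule tends_Lipschitz[OF \<sigma>, where K = 1 and f = star_A])
  show "\<parallel>star_A (\<sigma> n) \<boxminus> star_A l\<parallel> \<le> 1 * \<parallel>\<sigma> n \<boxminus> l\<parallel>" for n
    using \<sigma> star_minus[of "\<sigma> n" l] norm_star[of "\<sigma> n \<boxminus> l"] by (auto simp: tends_def)
qed (use \<sigma> in \<open>auto simp: tends_def\<close>)

lemma tends_add: assumes "tends \<sigma> l" "tends \<tau> m" shows "tends (\<lambda>n. \<sigma> n \<boxplus> \<tau> n) (l \<boxplus> m)"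
proof -
  have c: "\<sigma> n \<in> carrier A" "\<tau> n \<in> carrier A" "l \<in> carrier A" "m \<in> carrier A" for n
    using assms by (auto simp: tends_def)
  have "(\<sigma> n \<boxplus> \<tau> n) \<boxminus> (l \<boxplus> m) = (\<sigma> n \<boxminus> l) \<boxplus> (\<tau> n \<boxminus> m)" for n
    using c by (simp add: add_ac scale_add_right)
  then have le: "\<parallel>(\<sigma> n \<boxplus> \<tau> n) \<boxminus> (l \<boxplus> m)\<parallel> \<le> \<parallel>\<sigma> n \<boxminus> l\<parallel> + \<parallel>\<tau> n \<boxminus> m\<parallel>" for n
    using norm_triangle[of "\<sigma> n \<boxminus> l" "\<tau> n \<boxminus> m"] c by simp
  have "(\<lambda>n. \<parallel>\<sigma> n \<boxminus> l\<parallel> + \<parallel>\<tau> n \<boxminus> m\<parallel>) \<longlonglongrightarrow> 0 + 0"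
    using assms unfolding tends_def by (intro tendsto_intros) auto
  then have "(\<lambda>n. \<parallel>(\<sigma> n \<boxplus> \<tau> n) \<boxminus> (l \<boxplus> m)\<parallel>) \<longlonglongrightarrow> 0"
    using c by (intro tendsto_zero_squeeze[OF _ le]) (simp_all add: norm_nonneg)
  then show ?thesis using c by (simp add: tends_def)
qed

lemma tends_const: "x \<in> carrier A \<Longrightarrow> tends (\<lambda>n. x) x"
  by (simp add: tends_def)

text \<open>Banach's fixed point theorem on a closed subset. It replaces the continuous functional calculus: the
  functions of a hermitian element that are needed are fixed points of explicit contractions.\<close>

lemma contraction_fixed_point:
  assumes S: "closedin mtopology S" and s: "s \<in> S" and maps: "\<And>z. z \<in> S \<Longrightarrow> f z \<in> S"
    and k: "0 \<le> k" "k < (1::real)"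
    and contr: "\<And>z w. \<lbrakk>z \<in> S; w \<in> S\<rbrakk> \<Longrightarrow> \<parallel>f z \<boxminus> f w\<parallel> \<le> k * \<parallel>z \<boxminus> w\<parallel>"
  obtains z where "z \<in> S" "f z = z"
proof -
  have SA: "S \<subseteq> carrier A" using S by (simp add: closedin_iff_tends)
  define \<sigma> where "\<sigma> n = (f ^^ n) s" for n
  have \<sigma>S: "\<sigma> n \<in> S" for n
    by (induction n) (auto simp: \<sigma>_def s maps)
  have "\<parallel>\<sigma> (Suc n) \<boxminus> \<sigma> n\<parallel> \<le> \<parallel>\<sigma> 1 \<boxminus> \<sigma> 0\<parallel> * k ^ n" for n
  proof (induction n)
    case (Suc n)
    have "\<parallel>\<sigma> (Suc (Suc n)) \<boxminus> \<sigma> (Suc n)\<parallel> \<le> k * \<parallel>\<sigma> (Suc n) \<boxminus> \<sigma> n\<parallel>"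
      using contr[OF \<sigma>S[of "Suc n"] \<sigma>S[of n]] by (simp add: \<sigma>_def)
    also have "\<dots> \<le> k * (\<parallel>\<sigma> 1 \<boxminus> \<sigma> 0\<parallel> * k ^ n)"
      using Suc k by (intro mult_left_mono) auto
    finally show ?case by (simp add: mult_ac)
  qed simp
  then obtain l where l: "tends \<sigma> l"
    using geometric_tends[of \<sigma> k "\<parallel>\<sigma> 1 \<boxminus> \<sigma> 0\<parallel>"] k \<sigma>S SA by blast
  have lS: "l \<in> S" using S l \<sigma>S by (auto simp: closedin_iff_tends)
  have "tends (\<lambda>n. f (\<sigma> n)) (f l)"
    by (rule tends_Lipschitz[OF l, where K = k and f = f]) (use contr \<sigma>S lS maps SA in auto)
  moreover have "tends (\<lambda>n. f (\<sigma> n)) l"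
  proof -
    have "(\<lambda>n. \<parallel>\<sigma> (Suc n) \<boxminus> l\<parallel>) \<longlonglongrightarrow> 0"
      using l unfolding tends_def by (intro LIMSEQ_Suc) auto
    then show ?thesis using l unfolding tends_def by (auto simp: \<sigma>_def maps \<sigma>S[unfolded \<sigma>_def] intro: subsetD[OF SA])
  qed
  ultimately show ?thesis using that lS tends_unique by blast
qed

section \<open>Functions of a hermitian element and approximate units\<close>

lemma closed_ideal_iff:
  "I \<in> closed_ideals A \<longleftrightarrow> I \<subseteq> carrier A \<and> \<zero>\<^sub>A \<in> I \<and> (\<forall>x\<in>I. \<forall>y\<in>I. x \<boxplus> y \<in> I) \<and>
     (\<forall>c. \<forall>x\<in>I. c \<cdot> x \<in> I) \<and> (\<forall>a\<in>carrier A. \<forall>x\<in>I. a \<boxtimes> x \<in> I \<and> x \<boxtimes> a \<in> I) \<and>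
     closedin mtopology I" (is "?L \<longleftrightarrow> ?R")
proof
  assume L: ?L
  then have sg: "subgroup I (add_group A)" by (simp add: closed_ideals_def)
  show ?R
    using L subgroup.subset[OF sg] subgroup.one_closed[OF sg] subgroup.m_closed[OF sg]
    by (simp add: closed_ideals_def add_group_def)
next
  assume R: ?R
  have "subgroup I (add_group A)"
  proof
    show "inv\<^bsub>add_group A\<^esub> x \<in> I" if "x \<in> I" for x
      using R that inv_eq[of x] by auto
  qed (use R in \<open>auto simp: add_group_def\<close>)
  then show ?L using R by (simp add: closed_ideals_def)
qed

lemma
  assumes "I \<in> closed_ideals A"
  shows ideal_subset: "I \<subseteq> carrier A"
    and ideal_carrier: "x \<in> I \<Longrightarrow> x \<in> carrier A"
    and ideal_zero: "\<zero>\<^sub>A \<in> I"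
    and ideal_add: "\<lbrakk>x \<in> I; y \<in> I\<rbrakk> \<Longrightarrow> x \<boxplus> y \<in> I"
    and ideal_scale: "x \<in> I \<Longrightarrow> c \<cdot> x \<in> I"
    and ideal_mult_left: "\<lbrakk>a \<in> carrier A; x \<in> I\<rbrakk> \<Longrightarrow> a \<boxtimes> x \<in> I"
    and ideal_mult_right: "\<lbrakk>a \<in> carrier A; x \<in> I\<rbrakk> \<Longrightarrow> x \<boxtimes> a \<in> I"
    and ideal_closedin: "closedin mtopology I"
  using assms by (auto simp: closed_ideal_iff)

lemma ideal_tends: "\<lbrakk>I \<in> closed_ideals A; \<And>n. \<sigma> n \<in> I; tends \<sigma> l\<rbrakk> \<Longrightarrow> l \<in> I"
  using ideal_closedin[of I] by (auto simp: closedin_iff_tends)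

lemma carrier_closed_ideal: "carrier A \<in> closed_ideals A"
  by (auto simp: closed_ideal_iff closedin_iff_tends tends_def)

lemma tends_zero_diff: assumes "tends (\<lambda>n. \<zero>\<^sub>A) l" shows "l = \<zero>\<^sub>A"
  using assms tends_const[OF zero_closed] tends_unique by blast

lemma zero_closed_ideal: "{\<zero>\<^sub>A} \<in> closed_ideals A"
proof -
  have "\<sigma> = (\<lambda>n. \<zero>\<^sub>A)" if "\<forall>n. \<sigma> n = \<zero>\<^sub>A" for \<sigma> :: "nat \<Rightarrow> 'a" using that by auto
  then show ?thesis
    by (auto simp: closed_ideal_iff closedin_iff_tends dest: tends_zero_diff)
qed

lemma closedin_approx:
  assumes S: "closedin mtopology S" and x: "x \<in> carrier A"
    and approx: "\<And>\<epsilon>. \<epsilon> > 0 \<Longrightarrow> \<exists>s\<in>S. \<parallel>s \<boxminus> x\<parallel> < \<epsilon>"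
  shows "x \<in> S"
proof -
  have "\<forall>n. \<exists>s\<in>S. \<parallel>s \<boxminus> x\<parallel> < inverse (real (Suc n))" using approx by simp
  then obtain \<sigma> where \<sigma>: "\<And>n. \<sigma> n \<in> S" "\<And>n. \<parallel>\<sigma> n \<boxminus> x\<parallel> < inverse (real (Suc n))" by metis
  have \<sigma>A: "\<sigma> n \<in> carrier A" for n using S \<sigma>(1) by (auto simp: closedin_iff_tends)
  have "(\<lambda>n. \<parallel>\<sigma> n \<boxminus> x\<parallel>) \<longlonglongrightarrow> 0"
    using \<sigma>(2) \<sigma>A x
    by (intro tendsto_zero_squeeze[OF _ _ LIMSEQ_inverse_real_of_nat])
      (auto simp: norm_nonneg less_imp_le)
  then have "tends \<sigma> x" using \<sigma>A x by (simp add: tends_def)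
  then show ?thesis using S \<sigma>(1) by (auto simp: closedin_iff_tends)
qed

text \<open>The hermitian part of \<open>I\<close> inside the bicommutant of \<open>h\<close>. For hermitian \<open>h\<close> it is a closed
  commutative real algebra that contains \<open>h\<close>, so iterations that start in it stay in \<open>I\<close>,
  stay hermitian, and keep commuting with \<open>h\<close> and with each other.\<close>

definition hermitian_calculus :: "'a set \<Rightarrow> 'a \<Rightarrow> 'a set" where
  "hermitian_calculus I h =
    {z \<in> I. star_A z = z \<and> (\<forall>x\<in>carrier A. x \<boxtimes> h = h \<boxtimes> x \<longrightarrow> x \<boxtimes> z = z \<boxtimes> x)}"

context
  fixes I h
  assumes I: "I \<in> closed_ideals A" and h: "h \<in> I" and h_star: "star_A h = h"
begin

lemma hc_carrier: "z \<in> hermitian_calculus I h \<Longrightarrow> z \<in> carrier A"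
  using ideal_carrier[OF I] by (auto simp: hermitian_calculus_def)

lemma hc_self: "h \<in> hermitian_calculus I h"
  using h h_star by (simp add: hermitian_calculus_def)

lemma hc_zero: "\<zero>\<^sub>A \<in> hermitian_calculus I h"
  using ideal_zero[OF I] by (auto simp: hermitian_calculus_def)

lemma hc_commute:
  assumes "z \<in> hermitian_calculus I h" "w \<in> hermitian_calculus I h"
  shows "z \<boxtimes> w = w \<boxtimes> z"
proof -
  have "h \<boxtimes> w = w \<boxtimes> h"
    using assms(2) ideal_carrier[OF I h] by (auto simp: hermitian_calculus_def)
  then show ?thesis
    using assms(1) hc_carrier[OF assms(2)] by (auto simp: hermitian_calculus_def)
qed

lemma hc_add:
  assumes "z \<in> hermitian_calculus I h" "w \<in> hermitian_calculus I h"
  shows "z \<boxplus> w \<in> hermitian_calculus I h"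
  using assms hc_carrier[OF assms(1)] hc_carrier[OF assms(2)] ideal_add[OF I, of z w]
  by (auto simp: hermitian_calculus_def star_add mult_add_left mult_add_right)

lemma hc_scale:
  assumes "z \<in> hermitian_calculus I h" "cnj c = c"
  shows "c \<cdot> z \<in> hermitian_calculus I h"
  using assms hc_carrier[OF assms(1)] ideal_scale[OF I, of z c]
  by (auto simp: hermitian_calculus_def star_scale mult_scale_left mult_scale_right)

lemma hc_mult:
  assumes "z \<in> hermitian_calculus I h" "w \<in> hermitian_calculus I h"
  shows "z \<boxtimes> w \<in> hermitian_calculus I h"
proof -
  have c: "z \<in> carrier A" "w \<in> carrier A" using assms hc_carrier by auto
  have "x \<boxtimes> (z \<boxtimes> w) = z \<boxtimes> w \<boxtimes> x" if "x \<in> carrier A" "x \<boxtimes> h = h \<boxtimes> x" for x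
  proof -
    have "x \<boxtimes> (z \<boxtimes> w) = z \<boxtimes> x \<boxtimes> w"
      using assms(1) that c by (auto simp: hermitian_calculus_def mult_assoc[symmetric])
    also have "\<dots> = z \<boxtimes> w \<boxtimes> x"
      using assms(2) that c by (auto simp: hermitian_calculus_def mult_assoc)
    finally show ?thesis .
  qed
  moreover have "star_A (z \<boxtimes> w) = z \<boxtimes> w"
    using assms c hc_commute[OF assms] by (simp add: star_mult hermitian_calculus_def)
  ultimately show ?thesis
    using ideal_mult_right[OF I, of w z] c assms by (auto simp: hermitian_calculus_def)
qed

lemma hc_closed: "closedin mtopology (hermitian_calculus I h)"
  unfolding closedin_iff_tends
proof (intro conjI allI impI subsetI)
  show "z \<in> carrier A" if "z \<in> hermitian_calculus I h" for z using that by (rule hc_carrier)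
  fix \<sigma> l assume \<sigma>: "(\<forall>n. \<sigma> n \<in> hermitian_calculus I h) \<and> tends \<sigma> l"
  then have star: "star_A (\<sigma> n) = \<sigma> n" for n by (simp add: hermitian_calculus_def)
  have "star_A l = l"
    using tends_star[of \<sigma> l] \<sigma> tends_unique star by simp
  moreover have "x \<boxtimes> l = l \<boxtimes> x" if x: "x \<in> carrier A" "x \<boxtimes> h = h \<boxtimes> x" for x
  proof -
    have "x \<boxtimes> \<sigma> n = \<sigma> n \<boxtimes> x" for n using \<sigma> x by (simp add: hermitian_calculus_def)
    then show ?thesis
      using tends_mult_left[of \<sigma> l x] tends_mult_right[of \<sigma> l x] \<sigma> tends_unique x by simp
  qed
  moreover have "l \<in> I"
    using ideal_tends[OF I, of \<sigma> l] \<sigma> by (simp add: hermitian_calculus_def)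
  ultimately show "l \<in> hermitian_calculus I h" by (simp add: hermitian_calculus_def)
qed

end

lemma closedin_norm_ball: "closedin mtopology {z \<in> carrier A. \<parallel>z\<parallel> \<le> r}"
  unfolding closedin_iff_tends
proof (intro conjI allI impI subsetI CollectI)
  fix \<sigma> l assume \<sigma>: "(\<forall>n. \<sigma> n \<in> {z \<in> carrier A. \<parallel>z\<parallel> \<le> r}) \<and> tends \<sigma> l"
  then show l: "l \<in> carrier A" by (simp add: tends_def)
  have "\<parallel>l\<parallel> \<le> \<parallel>\<sigma> n \<boxminus> l\<parallel> + r" for n
    using norm_le_add[of l "\<sigma> n"] norm_minus_commute[of l "\<sigma> n"] \<sigma> l
    by (smt (verit) mem_Collect_eq)
  moreover have "(\<lambda>n. \<parallel>\<sigma> n \<boxminus> l\<parallel> + r) \<longlonglongrightarrow> 0 + r"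
    using \<sigma> unfolding tends_def by (intro tendsto_intros) auto
  ultimately show "\<parallel>l\<parallel> \<le> r"
    using LIMSEQ_le_const[of "\<lambda>n. \<parallel>\<sigma> n \<boxminus> l\<parallel> + r" "0 + r" "\<parallel>l\<parallel>"] by simp
qed auto

text \<open>The source of all norm estimates. In the unitization, \<open>u = 1 - p + \<i>q\<close> satisfies
  \<open>u\<^sup>* u = (1 - p)\<^sup>2 + q\<^sup>2 = 1\<close>, so by the C*-identity multiplication by \<open>u\<close>, and likewise by \<open>u\<^sup>*\<close>,
  is isometric. Both \<open>1 - p\<close> and \<open>q\<close> are combinations of \<open>u\<close> and \<open>u\<^sup>*\<close> with total absolute weight 1.
  Stated with multiplication operators on \<open>A\<close>, no unit has to be adjoined.\<close>

lemma unitary_contraction: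
  assumes p: "p \<in> carrier A" "star_A p = p" and q: "q \<in> carrier A" "star_A q = q"
    and comm: "p \<boxtimes> q = q \<boxtimes> p" and circle: "p \<boxtimes> p \<boxplus> q \<boxtimes> q = 2 \<cdot> p"
    and c: "c \<in> carrier A"
  shows "\<parallel>c \<boxminus> p \<boxtimes> c\<parallel> \<le> \<parallel>c\<parallel>" "\<parallel>q \<boxtimes> c\<parallel> \<le> \<parallel>c\<parallel>"
proof -
  define u where "u = c \<boxminus> p \<boxtimes> c"
  define v where "v = q \<boxtimes> c"
  have uv: "u \<in> carrier A" "v \<in> carrier A" using p q c by (auto simp: u_def v_def)
  have su: "star_A u = star_A c \<boxminus> star_A c \<boxtimes> p" and sv: "star_A v = star_A c \<boxtimes> q"
    using p q c by (simp_all add: u_def v_def star_add star_scale star_mult)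
  have mixed: "star_A u \<boxtimes> v = star_A v \<boxtimes> u"
  proof -
    have "q \<boxtimes> (p \<boxtimes> c) = p \<boxtimes> (q \<boxtimes> c)" using comm p q c by (simp add: mult_assoc[symmetric])
    then show ?thesis
      using p q c unfolding su sv
      by (simp add: u_def v_def mult_add_left mult_add_right mult_scale_left mult_scale_right mult_assoc)
  qed
  have sum: "star_A u \<boxtimes> u \<boxplus> star_A v \<boxtimes> v = star_A c \<boxtimes> c"
  proof -
    let ?X = "star_A c \<boxtimes> c" and ?Y = "star_A c \<boxtimes> (p \<boxtimes> c)"
      and ?Z = "star_A c \<boxtimes> (p \<boxtimes> (p \<boxtimes> c))" and ?W = "star_A c \<boxtimes> (q \<boxtimes> (q \<boxtimes> c))"
    have YZW: "?X \<in> carrier A" "?Y \<in> carrier A" "?Z \<in> carrier A" "?W \<in> carrier A"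
      using p q c by auto
    have "star_A c \<boxtimes> ((p \<boxtimes> p \<boxplus> q \<boxtimes> q) \<boxtimes> c) = ?Z \<boxplus> ?W"
      using p q c by (simp add: mult_add_left mult_add_right mult_assoc)
    then have ZW: "?Z \<boxplus> ?W = 2 \<cdot> ?Y"
      using p q c unfolding circle by (simp add: mult_scale_left mult_scale_right)
    have "star_A u \<boxtimes> u \<boxplus> star_A v \<boxtimes> v = (?X \<boxminus> ?Y) \<boxminus> (?Y \<boxminus> ?Z) \<boxplus> ?W"
      using p q c unfolding su sv
      by (simp add: u_def v_def mult_add_left mult_add_right mult_scale_left mult_scale_right
          mult_assoc scale_add_right add_ac)
    also have "\<dots> = (?X \<boxplus> (- 2) \<cdot> ?Y) \<boxplus> (?Z \<boxplus> ?W)"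
      by (rule linear_coordinates5[OF YZW YZW(4)]; simp only: add_ac)
         (use YZW in \<open>simp_all add: add_ac scale_add_right scale_scale\<close>)
    also have "\<dots> = ?X"
      unfolding ZW by (rule linear_coordinates2[OF YZW(1,2)]) simp
    finally show ?thesis .
  qed
  have isom: "\<parallel>u \<boxplus> s \<cdot> v\<parallel> = \<parallel>c\<parallel>" if s: "cnj s = - s" "s * s = - 1" for s
  proof -
    let ?w = "u \<boxplus> s \<cdot> v"
    have "star_A ?w \<boxtimes> ?w = (star_A u \<boxtimes> u \<boxplus> s \<cdot> (star_A u \<boxtimes> v)) \<boxplus>
        ((- s) \<cdot> (star_A v \<boxtimes> u) \<boxplus> star_A v \<boxtimes> v)"
      using uv s by (simp add: star_add star_scale mult_add_left mult_add_right mult_scale_left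
          mult_scale_right scale_add_right scale_scale scale_one add_ac)
    also have "\<dots> = star_A u \<boxtimes> u \<boxplus> star_A v \<boxtimes> v"
      unfolding mixed
      by (rule linear_coordinates3[of "star_A u \<boxtimes> u" "star_A v \<boxtimes> u" "star_A v \<boxtimes> v"])
        (use uv in simp_all)
    finally have "(\<parallel>?w\<parallel>)\<^sup>2 = (\<parallel>c\<parallel>)\<^sup>2"
      using cstar_identity[of ?w] cstar_identity[OF c] uv sum by simp
    then show ?thesis using norm_nonneg[of ?w] norm_nonneg[OF c] uv by simp
  qed
  \<comment> \<open>\<open>?a\<close> and \<open>?b\<close> are the two unitaries \<open>1 - p \<plusminus> \<i>q\<close> applied to \<open>c\<close>\<close>
  let ?a = "u \<boxplus> \<i> \<cdot> v" and ?b = "u \<boxplus> (- \<i>) \<cdot> v"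
  have ab: "?a \<in> carrier A" "?b \<in> carrier A" "\<parallel>?a\<parallel> = \<parallel>c\<parallel>" "\<parallel>?b\<parallel> = \<parallel>c\<parallel>"
    using uv isom[of \<i>] isom[of "- \<i>"] by auto
  have "u = (1/2) \<cdot> (?a \<boxplus> ?b)" "v = (- \<i> / 2) \<cdot> (?a \<boxminus> ?b)"
    by (rule linear_coordinates2[OF uv]; simp)+
  then have "\<parallel>u\<parallel> = \<parallel>(1/2) \<cdot> (?a \<boxplus> ?b)\<parallel>" "\<parallel>v\<parallel> = \<parallel>(- \<i> / 2) \<cdot> (?a \<boxminus> ?b)\<parallel>" by simp_all
  moreover have "\<parallel>?a \<boxplus> ?b\<parallel> \<le> 2 * \<parallel>c\<parallel>" "\<parallel>?a \<boxminus> ?b\<parallel> \<le> 2 * \<parallel>c\<parallel>"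
    using norm_triangle[of ?a ?b] norm_triangle[of ?a "(- 1) \<cdot> ?b"] norm_minus[of ?b] ab by auto
  ultimately show "\<parallel>c \<boxminus> p \<boxtimes> c\<parallel> \<le> \<parallel>c\<parallel>" "\<parallel>q \<boxtimes> c\<parallel> \<le> \<parallel>c\<parallel>"
    using ab norm_scale[of "?a \<boxplus> ?b" "1/2"] norm_scale[of "?a \<boxminus> ?b" "- \<i> / 2"]
    unfolding u_def[symmetric] v_def[symmetric] by (simp_all add: norm_divide)
qed

text \<open>The element \<open>y\<close> is \<open>1 - sqrt (1 - h\<^sup>2)\<close>. It is the fixed point of \<open>z \<mapsto> (h\<^sup>2 + z\<^sup>2) / 2\<close>, which maps
  the ball of radius \<open>\<parallel>h\<parallel> < 1\<close> into itself and has Lipschitz constant \<open>\<parallel>h\<parallel>\<close> there.\<close>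

lemma square_root:
  assumes I: "I \<in> closed_ideals A" and h: "h \<in> I" "star_A h = h" and small: "\<parallel>h\<parallel> < 1"
  obtains y where "y \<in> hermitian_calculus I h" "y \<boxtimes> y \<boxplus> h \<boxtimes> h = 2 \<cdot> y"
proof -
  note hc = hc_carrier[OF I h] hc_zero[OF I h] hc_add[OF I h] hc_scale[OF I h] hc_mult[OF I h]
    hc_self[OF I h] hc_closed[OF I h]
  have hA: "h \<in> carrier A" using ideal_carrier[OF I h(1)] .
  let ?r = "\<parallel>h\<parallel>"
  have r: "0 \<le> ?r" using norm_nonneg[OF hA] .
  let ?S = "hermitian_calculus I h \<inter> {z \<in> carrier A. \<parallel>z\<parallel> \<le> ?r}"
  let ?f = "\<lambda>z. (1/2) \<cdot> (h \<boxtimes> h \<boxplus> z \<boxtimes> z)"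
  have sq: "\<parallel>z \<boxtimes> z\<parallel> \<le> ?r" if "z \<in> carrier A" "\<parallel>z\<parallel> \<le> ?r" for z
  proof -
    have "\<parallel>z \<boxtimes> z\<parallel> \<le> \<parallel>z\<parallel> * \<parallel>z\<parallel>" using norm_mult that by blast
    also have "\<dots> \<le> ?r * 1" using that small norm_nonneg[OF that(1)] by (intro mult_mono) auto
    finally show ?thesis by simp
  qed
  obtain y where y: "y \<in> ?S" "?f y = y"
  proof (rule contraction_fixed_point[of ?S "\<zero>\<^sub>A" ?f ?r])
    show "closedin mtopology ?S" using hc(7) closedin_norm_ball by blast
    show "\<zero>\<^sub>A \<in> ?S" using hc(2) r by simp
    show "?f z \<in> ?S" if z: "z \<in> ?S" for z
    proof -
      have "\<parallel>h \<boxtimes> h \<boxplus> z \<boxtimes> z\<parallel> \<le> ?r + ?r"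
        using norm_triangle[of "h \<boxtimes> h" "z \<boxtimes> z"] sq[of z] sq[of h] z hA by auto
      then show ?thesis using z hA hc by (auto simp: norm_scale)
    qed
    show "\<parallel>?f z \<boxminus> ?f w\<parallel> \<le> ?r * \<parallel>z \<boxminus> w\<parallel>" if zw: "z \<in> ?S" "w \<in> ?S" for z w
    proof -
      have c: "z \<in> carrier A" "w \<in> carrier A" using zw by auto
      have "?f z \<boxminus> ?f w = (1/2) \<cdot> (z \<boxtimes> z \<boxminus> w \<boxtimes> w)"
        by (rule linear_coordinates3[of "h \<boxtimes> h" "z \<boxtimes> z" "w \<boxtimes> w"]) (use hA c in simp_all)
      also have "z \<boxtimes> z \<boxminus> w \<boxtimes> w = z \<boxtimes> (z \<boxminus> w) \<boxplus> (z \<boxminus> w) \<boxtimes> w"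
        using c minus_trans[of "z \<boxtimes> z" "z \<boxtimes> w" "w \<boxtimes> w"] by (simp add: mult_minus_right)
      finally have "\<parallel>?f z \<boxminus> ?f w\<parallel> = \<parallel>z \<boxtimes> (z \<boxminus> w) \<boxplus> (z \<boxminus> w) \<boxtimes> w\<parallel> / 2"
        using c by (simp add: norm_scale)
      also have "\<dots> \<le> (\<parallel>z\<parallel> * \<parallel>z \<boxminus> w\<parallel> + \<parallel>z \<boxminus> w\<parallel> * \<parallel>w\<parallel>) / 2"
        using norm_triangle[of "z \<boxtimes> (z \<boxminus> w)" "(z \<boxminus> w) \<boxtimes> w"] norm_mult[of z "z \<boxminus> w"]
          norm_mult[of "z \<boxminus> w" w] c by simp
      also have "\<dots> \<le> (?r * \<parallel>z \<boxminus> w\<parallel> + \<parallel>z \<boxminus> w\<parallel> * ?r) / 2"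
        using zw norm_nonneg[of "z \<boxminus> w"]
        by (intro divide_right_mono add_mono mult_right_mono mult_left_mono) auto
      finally show ?thesis by (simp add: mult.commute)
    qed
  qed (use small r in auto)
  have yA: "y \<in> carrier A" using y by auto
  have "2 \<cdot> y = 2 \<cdot> ?f y" using y by simp
  also have "\<dots> = y \<boxtimes> y \<boxplus> h \<boxtimes> h"
    using yA hA by (simp only: scale_scale add_closed mult_closed) (simp add: scale_one add_ac)
  finally show ?thesis using that y by auto
qed


text \<open>Squares of hermitian elements are positive in the sense that \<open>1 - r h\<^sup>2\<close> is a contraction for small
  \<open>r \<ge> 0\<close>: with \<open>y\<close> as in the previous lemma, for \<open>sqrt r h\<close>, it equals \<open>(1 - y)\<^sup>2\<close>, and \<open>1 - y\<close> is a
  contraction because \<open>1 - y + \<i> sqrt r h\<close> is unitary.\<close>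

lemma square_contraction:
  assumes h: "h \<in> carrier A" "star_A h = h" and r: "0 \<le> r" "r * \<parallel>h\<parallel>\<^sup>2 < 1" and c: "c \<in> carrier A"
  shows "\<parallel>c \<boxminus> of_real r \<cdot> (h \<boxtimes> h \<boxtimes> c)\<parallel> \<le> \<parallel>c\<parallel>"
proof -
  let ?g = "of_real (sqrt r) \<cdot> h"
  have g: "?g \<in> carrier A" "star_A ?g = ?g" using h by (simp_all add: star_scale)
  have "(\<parallel>?g\<parallel>)\<^sup>2 < 1"
    using r h norm_nonneg[of h] by (simp add: norm_scale power_mult_distrib)
  then have small: "\<parallel>?g\<parallel> < 1" using norm_nonneg[OF g(1)] by (simp add: power_less_one_iff abs_square_less_1)
  obtain y where y: "y \<in> hermitian_calculus (carrier A) ?g" "y \<boxtimes> y \<boxplus> ?g \<boxtimes> ?g = 2 \<cdot> y"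
    using square_root[OF carrier_closed_ideal g small] by blast
  have yA: "y \<in> carrier A" and ys: "star_A y = y" and yg: "y \<boxtimes> ?g = ?g \<boxtimes> y"
    using y(1) hc_commute[OF carrier_closed_ideal g y(1) hc_self[OF carrier_closed_ideal g]]
    by (auto simp: hermitian_calculus_def)
  have contr: "\<parallel>u \<boxminus> y \<boxtimes> u\<parallel> \<le> \<parallel>u\<parallel>" if "u \<in> carrier A" for u
    using unitary_contraction(1)[OF yA ys g yg y(2) that] .
  let ?u = "c \<boxminus> y \<boxtimes> c"
  have gg: "?g \<boxtimes> ?g = of_real r \<cdot> (h \<boxtimes> h)"
    using h r by (simp add: mult_scale_left mult_scale_right scale_scale flip: of_real_mult)
  have "(y \<boxtimes> y \<boxplus> of_real r \<cdot> (h \<boxtimes> h)) \<boxtimes> c = (2 \<cdot> y) \<boxtimes> c"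
    using y(2) unfolding gg by simp
  then have circle: "y \<boxtimes> (y \<boxtimes> c) \<boxplus> of_real r \<cdot> (h \<boxtimes> h \<boxtimes> c) = 2 \<cdot> (y \<boxtimes> c)"
    using yA h c by (simp add: mult_add_left mult_scale_left mult_assoc)
  have "c \<boxminus> of_real r \<cdot> (h \<boxtimes> h \<boxtimes> c) =
      (c \<boxplus> y \<boxtimes> (y \<boxtimes> c)) \<boxminus> (y \<boxtimes> (y \<boxtimes> c) \<boxplus> of_real r \<cdot> (h \<boxtimes> h \<boxtimes> c))"
    by (rule linear_coordinates3[of c "y \<boxtimes> (y \<boxtimes> c)" "of_real r \<cdot> (h \<boxtimes> h \<boxtimes> c)"])
      (use yA h c in simp_all)
  also have "\<dots> = ?u \<boxminus> (y \<boxtimes> c \<boxminus> y \<boxtimes> (y \<boxtimes> c))"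
    unfolding circle
    by (rule linear_coordinates3[of c "y \<boxtimes> c" "y \<boxtimes> (y \<boxtimes> c)"]) (use yA c in simp_all)
  also have "\<dots> = ?u \<boxminus> y \<boxtimes> ?u"
    using yA c by (simp add: mult_minus_right)
  finally show ?thesis using contr[of ?u] contr[OF c] yA c by simp
qed

text \<open>The element \<open>e\<close> is \<open>h\<^sup>2 (1 + h\<^sup>2)\<^sup>-\<^sup>1\<close>, for \<open>h\<close> of any norm. A small step of size \<open>s\<close> towards solving
  \<open>(1 + b) z = b\<close>, \<open>b = h\<^sup>2\<close>, changes a difference \<open>d\<close> into \<open>(1 - s) (d - r b d)\<close> with \<open>(1 - s) r = s\<close>, and
  the positivity of squares bounds this by \<open>(1 - s) \<parallel>d\<parallel>\<close>.\<close>

lemma resolvent: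
  assumes I: "I \<in> closed_ideals A" and h: "h \<in> I" "star_A h = h"
  obtains e where "e \<in> hermitian_calculus I h" "e = h \<boxtimes> h \<boxminus> h \<boxtimes> h \<boxtimes> e"
proof -
  note hc = hc_carrier[OF I h] hc_zero[OF I h] hc_add[OF I h] hc_scale[OF I h] hc_mult[OF I h]
    hc_self[OF I h] hc_closed[OF I h]
  have hA: "h \<in> carrier A" using ideal_carrier[OF I h(1)] .
  define b where "b = h \<boxtimes> h"
  \<comment> \<open>the two constants satisfy \<open>(1 - s) r = s\<close>, and \<open>r\<close> is small enough for \<open>square_contraction\<close>\<close>
  define r where "r = 1 / (1 + \<parallel>h\<parallel>\<^sup>2)"
  define s where "s = 1 / (2 + \<parallel>h\<parallel>\<^sup>2)"
  have n: "0 < 1 + \<parallel>h\<parallel>\<^sup>2" "0 < 2 + \<parallel>h\<parallel>\<^sup>2" by (simp_all add: add_pos_nonneg)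
  then have s: "0 < s" "s < 1" and r: "0 \<le> r" "r * \<parallel>h\<parallel>\<^sup>2 < 1" and rs: "(1 - s) * r = s"
    by (simp_all add: s_def r_def divide_simps del: add_pos_nonneg)
  have b: "b \<in> hermitian_calculus I h" "b \<in> carrier A" using hc hA by (auto simp: b_def)
  let ?f = "\<lambda>z. z \<boxplus> of_real s \<cdot> ((b \<boxminus> b \<boxtimes> z) \<boxminus> z)"
  obtain e where e: "e \<in> hermitian_calculus I h" "?f e = e"
  proof (rule contraction_fixed_point[of "hermitian_calculus I h" "\<zero>\<^sub>A" ?f "1 - s"])
    show "?f z \<in> hermitian_calculus I h" if z: "z \<in> hermitian_calculus I h" for z
      using hc b z by simp
    show "\<parallel>?f z \<boxminus> ?f w\<parallel> \<le> (1 - s) * \<parallel>z \<boxminus> w\<parallel>"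
      if zw: "z \<in> hermitian_calculus I h" "w \<in> hermitian_calculus I h" for z w
    proof -
      have c: "z \<in> carrier A" "w \<in> carrier A" using zw hc by auto
      let ?d = "z \<boxminus> w"
      have "r * s = r - s" using rs by (simp add: algebra_simps)
      then have rs': "complex_of_real r * of_real s = of_real r - of_real s"
        by (metis of_real_diff of_real_mult)
      have "?f z \<boxminus> ?f w = of_real (1 - s) \<cdot> (?d \<boxminus> of_real r \<cdot> (b \<boxtimes> z \<boxminus> b \<boxtimes> w))"
        by (rule linear_coordinates5[of b z w "b \<boxtimes> z" "b \<boxtimes> w"])
          (use b c in \<open>simp_all add: rs' right_diff_distrib left_diff_distrib mult.commute[of "of_real s" "of_real r"]\<close>)
      then have "\<parallel>?f z \<boxminus> ?f w\<parallel> = (1 - s) * \<parallel>?d \<boxminus> of_real r \<cdot> (b \<boxtimes> ?d)\<parallel>"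
        using b c s by (simp add: mult_minus_right norm_scale del: of_real_diff)
      also have "\<dots> \<le> (1 - s) * \<parallel>?d\<parallel>"
        using square_contraction[OF hA h(2) r, of ?d] c s unfolding b_def by (intro mult_left_mono) auto
      finally show ?thesis .
    qed
  qed (use hc s in auto)
  have eA: "e \<in> carrier A" using e hc by blast
  let ?x = "(b \<boxminus> b \<boxtimes> e) \<boxminus> e"
  have "of_real s \<cdot> ?x = \<zero>\<^sub>A"
    using add_left_cancel[of e "of_real s \<cdot> ?x" "\<zero>\<^sub>A"] e eA b by simp
  then have "of_real (1 / s) \<cdot> (of_real s \<cdot> ?x) = \<zero>\<^sub>A" by simp
  then have "?x = \<zero>\<^sub>A" using eA b s by (simp only: scale_scale closed) (simp add: scale_one)
  then have "e = b \<boxminus> b \<boxtimes> e" using minus_eq_zero_iff[of "b \<boxminus> b \<boxtimes> e" e] eA b by simp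
  then show ?thesis using that e(1) unfolding b_def by blast
qed

text \<open>For \<open>h = t j\<^sup>* j\<close> take \<open>e = h\<^sup>2 (1 + h\<^sup>2)\<^sup>-\<^sup>1\<close>, which lies in \<open>I\<close> since \<open>I\<close> absorbs \<open>j\<^sup>*\<close>. The element
  \<open>1 - 2 e + 2 \<i> h (1 - e)\<close> is the Cayley transform \<open>(1 + \<i> h) (1 - \<i> h)\<^sup>-\<^sup>1\<close>, hence unitary, so \<open>1 - 2 e\<close> and
  therefore \<open>1 - e\<close> are contractions, while \<open>\<parallel>h (1 - e)\<parallel> \<le> 1/2\<close>. Dividing by \<open>t\<close> and using the
  C*-identity, \<open>\<parallel>j (1 - e)\<parallel>\<^sup>2 \<le> \<parallel>j\<^sup>* j (1 - e)\<parallel> \<le> 1 / (2 t)\<close>.\<close>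

theorem approximate_unit:
  assumes I: "I \<in> closed_ideals A" and j: "j \<in> I" and \<epsilon>: "0 < \<epsilon>"
  obtains e where "e \<in> I" "star_A e = e" "\<parallel>j \<boxminus> j \<boxtimes> e\<parallel> < \<epsilon>"
    and "\<And>c. c \<in> carrier A \<Longrightarrow> \<parallel>c \<boxminus> e \<boxtimes> c\<parallel> \<le> \<parallel>c\<parallel>"
    and "\<And>c. c \<in> carrier A \<Longrightarrow> \<parallel>c \<boxminus> c \<boxtimes> e\<parallel> \<le> \<parallel>c\<parallel>"
proof -
  have jA: "j \<in> carrier A" using ideal_carrier[OF I j] .
  define a where "a = star_A j \<boxtimes> j"
  define t where "t = 1 / \<epsilon>\<^sup>2"
  define h where "h = of_real t \<cdot> a"
  have t: "0 < t" using \<epsilon> by (simp add: t_def)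
  have a: "a \<in> I" "a \<in> carrier A" "star_A a = a"
    using ideal_mult_left[OF I, of "star_A j" j] j jA by (auto simp: a_def star_mult star_star)
  have h: "h \<in> I" "star_A h = h" and hA: "h \<in> carrier A"
    using a ideal_scale[OF I a(1)] by (auto simp: h_def star_scale)
  obtain e where e: "e \<in> hermitian_calculus I h" and e_eq: "e = h \<boxtimes> h \<boxminus> h \<boxtimes> h \<boxtimes> e"
    using resolvent[OF I h] by blast
  have eI: "e \<in> I" and eA: "e \<in> carrier A" and es: "star_A e = e" and eh: "e \<boxtimes> h = h \<boxtimes> e"
    using e hc_carrier[OF I h e] hc_commute[OF I h e hc_self[OF I h]]
    by (auto simp: hermitian_calculus_def)
  have eh': "e \<boxtimes> (h \<boxtimes> x) = h \<boxtimes> (e \<boxtimes> x)" if "x \<in> carrier A" for x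
    using eh eA hA that by (simp add: mult_assoc[symmetric])
  define d where "d = h \<boxminus> h \<boxtimes> e"
  have dA: "d \<in> carrier A" and ds: "star_A d = d"
    using hA eA h es eh by (auto simp: d_def star_add star_scale star_mult)
  have ed: "e \<boxtimes> d = d \<boxtimes> e"
    using hA eA eh eh' by (simp add: d_def mult_add_left mult_add_right mult_scale_left mult_scale_right mult_assoc)
  have dd: "d \<boxtimes> d = e \<boxminus> e \<boxtimes> e"
  proof -
    have "d \<boxtimes> d = (h \<boxtimes> h \<boxminus> h \<boxtimes> h \<boxtimes> e) \<boxminus> (h \<boxtimes> h \<boxminus> h \<boxtimes> h \<boxtimes> e) \<boxtimes> e"
      using hA eA eh eh' by (simp add: d_def mult_add_left mult_add_right mult_scale_left
          mult_scale_right mult_assoc scale_add_right scale_scale add_ac)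
    then show ?thesis using e_eq by simp
  qed
  let ?p = "2 \<cdot> e" and ?q = "2 \<cdot> d"
  have "?p \<boxtimes> ?p \<boxplus> ?q \<boxtimes> ?q = 4 \<cdot> (e \<boxtimes> e) \<boxplus> 4 \<cdot> (d \<boxtimes> d)"
    using eA dA by (simp add: mult_scale_left mult_scale_right scale_scale)
  also have "\<dots> = 2 \<cdot> ?p"
    unfolding dd by (rule linear_coordinates2[of e "e \<boxtimes> e"]) (use eA in simp_all)
  finally have circle: "?p \<boxtimes> ?p \<boxplus> ?q \<boxtimes> ?q = 2 \<cdot> ?p" .
  have pq: "?p \<in> carrier A" "star_A ?p = ?p" "?q \<in> carrier A" "star_A ?q = ?q" "?p \<boxtimes> ?q = ?q \<boxtimes> ?p"
    using eA dA es ds ed by (simp_all add: star_scale mult_scale_left mult_scale_right)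
  note U = unitary_contraction[OF pq circle]
  have left: "\<parallel>c \<boxminus> e \<boxtimes> c\<parallel> \<le> \<parallel>c\<parallel>" if c: "c \<in> carrier A" for c
  proof -
    have "c \<boxminus> e \<boxtimes> c = (1/2) \<cdot> (c \<boxplus> (c \<boxminus> ?p \<boxtimes> c))"
      using eA c by (simp add: mult_scale_left)
        (rule linear_coordinates2[of c "e \<boxtimes> c"]; simp)
    then have "\<parallel>c \<boxminus> e \<boxtimes> c\<parallel> = \<parallel>c \<boxplus> (c \<boxminus> ?p \<boxtimes> c)\<parallel> / 2"
      using c eA by (simp add: norm_scale norm_divide)
    then show ?thesis using norm_triangle[of c "c \<boxminus> ?p \<boxtimes> c"] U(1)[OF c] c eA by simp
  qed
  have right: "\<parallel>c \<boxminus> c \<boxtimes> e\<parallel> \<le> \<parallel>c\<parallel>" if c: "c \<in> carrier A" for c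
    using left[of "star_A c"] norm_star[of "c \<boxminus> c \<boxtimes> e"] norm_star[OF c] c eA es
    by (simp add: star_add star_scale star_mult)
  \<comment> \<open>multiplication by \<open>2 d\<close> is a contraction; applied to \<open>d\<close> itself it bounds the norm of \<open>d\<close>\<close>
  have "\<parallel>d\<parallel> \<le> 1/2"
  proof -
    have "2 * \<parallel>d\<parallel>\<^sup>2 \<le> \<parallel>d\<parallel>"
      using U(2)[OF dA] cstar_identity[OF dA] ds dA by (simp add: mult_scale_left norm_scale)
    then have "(2 * \<parallel>d\<parallel>) * \<parallel>d\<parallel> \<le> 1 * \<parallel>d\<parallel>" by (simp add: power2_eq_square)
    then show ?thesis using norm_nonneg[OF dA] by (cases "\<parallel>d\<parallel> = 0") auto
  qed
  moreover have "d = of_real t \<cdot> (a \<boxminus> a \<boxtimes> e)"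
    using a eA by (simp add: d_def h_def mult_scale_left scale_add_right scale_scale)
  ultimately have "t * \<parallel>a \<boxminus> a \<boxtimes> e\<parallel> \<le> 1/2"
    using a eA t by (simp add: norm_scale)
  then have bound: "\<parallel>a \<boxminus> a \<boxtimes> e\<parallel> \<le> \<epsilon>\<^sup>2 / 2"
    using \<epsilon> by (simp add: t_def field_simps)
  let ?w = "j \<boxminus> j \<boxtimes> e"
  have "star_A ?w \<boxtimes> ?w = (a \<boxminus> a \<boxtimes> e) \<boxminus> e \<boxtimes> (a \<boxminus> a \<boxtimes> e)"
    using jA eA es by (simp add: a_def star_add star_scale star_mult mult_add_left mult_add_right
        mult_scale_left mult_scale_right mult_assoc scale_add_right scale_scale add_ac)
  then have "(\<parallel>?w\<parallel>)\<^sup>2 \<le> \<parallel>a \<boxminus> a \<boxtimes> e\<parallel>"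
    using cstar_identity[of ?w] left[of "a \<boxminus> a \<boxtimes> e"] jA eA a by simp
  also have "\<dots> < \<epsilon>\<^sup>2" using bound \<epsilon> by (smt (verit) field_sum_of_halves zero_less_power)
  finally have "\<parallel>?w\<parallel> < \<epsilon>" using \<epsilon> by (simp add: power_less_imp_less_base)
  then show ?thesis using that eI es left right by blast
qed

text \<open>\<open>x\<^sup>*\<close> is the limit of \<open>(x e)\<^sup>* = e x\<^sup>*\<close>, which lies in \<open>I\<close> because \<open>e\<close> does.\<close>

lemma ideal_star:
  assumes I: "I \<in> closed_ideals A" and x: "x \<in> I" shows "star_A x \<in> I"
proof (rule closedin_approx[OF ideal_closedin[OF I]])
  have xA: "x \<in> carrier A" using ideal_carrier[OF I x] .
  then show "star_A x \<in> carrier A" by simp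
  fix \<epsilon> :: real assume \<epsilon>: "0 < \<epsilon>"
  obtain e where e: "e \<in> I" "star_A e = e" "\<parallel>x \<boxminus> x \<boxtimes> e\<parallel> < \<epsilon>"
    by (rule approximate_unit[OF I x \<epsilon>]) (rule that; assumption)
  have eA: "e \<in> carrier A" using ideal_carrier[OF I e(1)] .
  have "\<parallel>e \<boxtimes> star_A x \<boxminus> star_A x\<parallel> = \<parallel>star_A (x \<boxtimes> e \<boxminus> x)\<parallel>"
    using xA eA e by (simp add: star_add star_scale star_mult)
  also have "\<dots> < \<epsilon>"
    using norm_star[of "x \<boxtimes> e \<boxminus> x"] norm_minus_commute[of "x \<boxtimes> e" x] e xA eA by simp
  finally show "\<exists>s\<in>I. \<parallel>s \<boxminus> star_A x\<parallel> < \<epsilon>"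
    using ideal_mult_right[OF I, of "star_A x" e] e xA by auto
qed

end

section \<open>Homomorphisms are contractive\<close>

definition star_hom :: "'a cstar \<Rightarrow> 'b cstar \<Rightarrow> ('a \<Rightarrow> 'b) \<Rightarrow> bool" where
  "star_hom A B f \<longleftrightarrow>
     f ` carrier A \<subseteq> carrier B \<and>
     (\<forall>x\<in>carrier A. \<forall>y\<in>carrier A. f (vadd A x y) = vadd B (f x) (f y)) \<and>
     (\<forall>c. \<forall>x\<in>carrier A. f (vscale A c x) = vscale B c (f x)) \<and>
     (\<forall>x\<in>carrier A. \<forall>y\<in>carrier A. f (vmult A x y) = vmult B (f x) (f y)) \<and>
     (\<forall>x\<in>carrier A. f (vstar A x) = vstar B (f x))"

lemma star_homD:
  assumes "star_hom A B f"
  shows "x \<in> carrier A \<Longrightarrow> f x \<in> carrier B"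
    and "\<lbrakk>x \<in> carrier A; y \<in> carrier A\<rbrakk> \<Longrightarrow> f (vadd A x y) = vadd B (f x) (f y)"
    and "x \<in> carrier A \<Longrightarrow> f (vscale A c x) = vscale B c (f x)"
    and "\<lbrakk>x \<in> carrier A; y \<in> carrier A\<rbrakk> \<Longrightarrow> f (vmult A x y) = vmult B (f x) (f y)"
    and "x \<in> carrier A \<Longrightarrow> f (vstar A x) = vstar B (f x)"
  using assms by (auto simp: star_hom_def)

lemma star_hom_comp: "star_hom A B f \<Longrightarrow> star_hom B C g \<Longrightarrow> star_hom A C (g \<circ> f)"
  unfolding star_hom_def by (auto simp: image_subset_iff)

text \<open>A hermitian \<open>h\<close> with \<open>\<parallel>h\<parallel> < 1\<close> is the imaginary part of a unitary \<open>1 - y + \<i> h\<close>, and homomorphisms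
  preserve the algebraic relation that makes this element unitary. So \<open>f h\<close> acts as a contraction,
  and applying it to \<open>f h\<close> gives \<open>\<parallel>f h\<parallel> \<le> 1\<close>. The general case follows from the C*-identity.\<close>

lemma star_hom_contractive:
  assumes A: "cstar_algebra A" and B: "cstar_algebra B" and f: "star_hom A B f"
    and x: "x \<in> carrier A"
  shows "vnorm B (f x) \<le> vnorm A x"
proof -
  interpret A: cstar_algebra A by (rule A)
  interpret B: cstar_algebra B by (rule B)
  have f_in: "f z \<in> carrier B" if "z \<in> carrier A" for z using f that by (auto simp: star_hom_def)
  have hom: "f (vadd A z w) = vadd B (f z) (f w)" "f (vmult A z w) = vmult B (f z) (f w)"
    "f (vscale A c z) = vscale B c (f z)" "f (vstar A z) = vstar B (f z)"
    if "z \<in> carrier A" "w \<in> carrier A" for z w c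
    using f that by (auto simp: star_hom_def)
  have unit: "vnorm B (f h) \<le> 1"
    if h: "h \<in> carrier A" "vstar A h = h" and small: "vnorm A h < 1" for h
  proof -
    obtain y where y: "y \<in> A.hermitian_calculus (carrier A) h"
        "vadd A (vmult A y y) (vmult A h h) = vscale A 2 y"
      using A.square_root[OF A.carrier_closed_ideal h small] by blast
    have yA: "y \<in> carrier A" and ys: "vstar A y = y" and yh: "vmult A y h = vmult A h y"
      using y(1) A.hc_commute[OF A.carrier_closed_ideal h y(1) A.hc_self[OF A.carrier_closed_ideal h]]
      by (auto simp: A.hermitian_calculus_def)
    have "vnorm B (vmult B (f h) (f h)) \<le> vnorm B (f h)"
    proof (rule B.unitary_contraction(2)[of "f y"])
      show "vstar B (f y) = f y" "vstar B (f h) = f h"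
        using hom(4)[of y y] hom(4)[of h h] yA ys h by auto
      show "vmult B (f y) (f h) = vmult B (f h) (f y)"
        using hom(2)[of y h] hom(2)[of h y] yh yA h by simp
      show "vadd B (vmult B (f y) (f y)) (vmult B (f h) (f h)) = vscale B 2 (f y)"
        using arg_cong[OF y(2), of f] yA h by (simp add: hom)
    qed (use yA h f_in in auto)
    moreover have "vnorm B (vmult B (f h) (f h)) = (vnorm B (f h))\<^sup>2"
      using B.cstar_identity[of "f h"] hom(4)[of h h] h f_in by simp
    ultimately have "vnorm B (f h) * vnorm B (f h) \<le> 1 * vnorm B (f h)"
      by (simp add: power2_eq_square)
    then show ?thesis using B.norm_nonneg[of "f h"] f_in[OF h(1)] by (cases "vnorm B (f h) = 0") auto
  qed
  have hermitian: "vnorm B (f h) \<le> vnorm A h" if h: "h \<in> carrier A" "vstar A h = h" for h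
  proof (rule field_le_epsilon)
    fix \<epsilon> :: real assume \<epsilon>: "0 < \<epsilon>"
    let ?s = "vnorm A h + \<epsilon>"
    have s: "0 < ?s" using \<epsilon> A.norm_nonneg[OF h(1)] by simp
    let ?g = "vscale A (of_real (1 / ?s)) h"
    have "vnorm A ?g = vnorm A h / ?s"
      using h s by (simp only: A.norm_scale norm_of_real) simp
    then have "vnorm A ?g < 1" using s \<epsilon> by simp
    then have "vnorm B (f ?g) \<le> 1" using h by (intro unit) (auto simp: A.star_scale)
    moreover have "vnorm B (f ?g) = vnorm B (f h) / ?s"
      using h s f_in[OF h(1)] by (simp only: hom(3)[OF h(1) h(1)] B.norm_scale norm_of_real) simp
    ultimately show "vnorm B (f h) \<le> ?s" using s by simp
  qed
  have "(vnorm B (f x))\<^sup>2 = vnorm B (f (vmult A (vstar A x) x))"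
    using B.cstar_identity[of "f x"] f_in x by (simp add: hom)
  also have "\<dots> \<le> vnorm A (vmult A (vstar A x) x)"
    using x by (intro hermitian) (auto simp: A.star_mult A.star_star)
  also have "\<dots> = (vnorm A x)\<^sup>2" using A.cstar_identity x by simp
  finally show ?thesis using A.norm_nonneg[OF x] by (simp add: power2_le_iff_abs_le)
qed

section \<open>Closed ideals as C*-algebras\<close>

lemma restr_simps [simp]:
  "carrier (restr A J) = J" "vzero (restr A J) = vzero A" "vadd (restr A J) = vadd A"
  "vscale (restr A J) = vscale A" "vmult (restr A J) = vmult A" "vstar (restr A J) = vstar A"
  "vnorm (restr A J) = vnorm A"
  by (simp_all add: restr_def)

lemma add_group_simps [simp]:
  "carrier (add_group A) = carrier A" "x \<otimes>\<^bsub>add_group A\<^esub> y = vadd A x y" "\<one>\<^bsub>add_group A\<^esub> = vzero A"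
  by (simp_all add: add_group_def)

lemma restr_restr [simp]: "restr (restr A J) K = restr A K"
  by (simp add: restr_def)

lemma restr_carrier [simp]: "restr A (carrier A) = A"
  by (simp add: restr_def)

text \<open>For records that are not yet known to be C*-algebras.\<close>

lemma mcomplete_cdistI:
  assumes M: "Metric_space (carrier A) (cdist A)"
    and lim: "\<And>\<sigma>. \<lbrakk>\<And>n. \<sigma> n \<in> carrier A;
        \<And>\<epsilon>. \<epsilon> > 0 \<Longrightarrow> \<exists>N. \<forall>m\<ge>N. \<forall>n\<ge>N. vnorm A (vadd A (\<sigma> m) (vscale A (- 1) (\<sigma> n))) < \<epsilon>\<rbrakk> \<Longrightarrow>
        \<exists>l\<in>carrier A. (\<lambda>n. vnorm A (vadd A (\<sigma> n) (vscale A (- 1) l))) \<longlonglongrightarrow> 0"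
  shows "Metric_space.mcomplete (carrier A) (cdist A)"
proof -
  interpret Metric_space "carrier A" "cdist A" by (rule M)
  show ?thesis
    unfolding mcomplete_def
  proof (intro allI impI)
    fix \<sigma> assume \<sigma>: "MCauchy \<sigma>"
    then have c: "\<sigma> n \<in> carrier A" for n by (auto simp: MCauchy_def)
    have cau: "\<exists>N. \<forall>m\<ge>N. \<forall>n\<ge>N. vnorm A (vadd A (\<sigma> m) (vscale A (- 1) (\<sigma> n))) < \<epsilon>" if "\<epsilon> > 0" for \<epsilon>
    proof -
      have "\<exists>N. \<forall>m n. N \<le> m \<longrightarrow> N \<le> n \<longrightarrow> cdist A (\<sigma> m) (\<sigma> n) < \<epsilon>"
        using \<sigma> that by (simp add: MCauchy_def)
      then show ?thesis using c by (auto simp: cdist_def)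
    qed
    then obtain l where "l \<in> carrier A"
        "(\<lambda>n. vnorm A (vadd A (\<sigma> n) (vscale A (- 1) l))) \<longlonglongrightarrow> 0"
      using lim[of \<sigma>, OF c cau] by blast
    then have "limitin mtopology \<sigma> l sequentially"
      using c by (auto simp: limitin_metric_dist_null cdist_def)
    then show "\<exists>x. limitin mtopology \<sigma> x sequentially" by blast
  qed
qed

context cstar_algebra
begin

lemma cstar_restr:
  assumes J: "J \<in> closed_ideals A" shows "cstar_algebra (restr A J)"
proof (rule cstar_algebra.intro)
  note JA = ideal_carrier[OF J]
  show "comm_group (add_group (restr A J))"
  proof (rule comm_groupI)
    fix x assume "x \<in> carrier (add_group (restr A J))"
    then have x: "x \<in> J" by (simp add: add_group_def)
    have "(- 1) \<cdot> x \<boxplus> x = \<zero>\<^sub>A"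
      using JA[OF x] minus_self[of x] by (simp add: add_commute)
    then show "\<exists>y\<in>carrier (add_group (restr A J)). y \<otimes>\<^bsub>add_group (restr A J)\<^esub> x = \<one>\<^bsub>add_group (restr A J)\<^esub>"
      using ideal_scale[OF J x, of "- 1"] by (auto simp: add_group_def)
  qed (use J JA ideal_add[OF J] ideal_zero[OF J] in \<open>auto simp: add_group_def add_ac\<close>)
  have "Metric_space J (cdist (restr A J))"
  proof
    show "0 \<le> cdist (restr A J) x y" for x y by (auto simp: cdist_def JA norm_nonneg)
    show "cdist (restr A J) x y = cdist (restr A J) y x" for x y
      by (auto simp: cdist_def JA norm_minus_commute)
    show "cdist (restr A J) x y = 0 \<longleftrightarrow> x = y" if "x \<in> J" "y \<in> J" for x y
      using that JA by (simp add: cdist_def norm_eq_zero_iff minus_eq_zero_iff)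
    show "cdist (restr A J) x z \<le> cdist (restr A J) x y + cdist (restr A J) y z"
      if "x \<in> J" "y \<in> J" "z \<in> J" for x y z
      using that JA by (simp add: cdist_def norm_minus_triangle)
  qed
  then show "Metric_space.mcomplete (carrier (restr A J)) (cdist (restr A J))"
  proof (intro mcomplete_cdistI; simp)
    fix \<sigma> :: "nat \<Rightarrow> 'a"
    assume \<sigma>: "\<And>n. \<sigma> n \<in> J" "\<And>\<epsilon>. 0 < \<epsilon> \<Longrightarrow> \<exists>N. \<forall>m\<ge>N. \<forall>n\<ge>N. \<parallel>\<sigma> m \<boxminus> \<sigma> n\<parallel> < \<epsilon>"
    then obtain l where "tends \<sigma> l" using JA Cauchy_tends[of \<sigma>] by blast
    then show "\<exists>l\<in>J. (\<lambda>n. \<parallel>\<sigma> n \<boxminus> l\<parallel>) \<longlonglongrightarrow> 0"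
      using ideal_tends[OF J, of \<sigma> l] \<sigma> by (auto simp: tends_def)
  qed
qed (use ideal_carrier[OF J] in \<open>simp_all add: ideal_add[OF J] ideal_scale[OF J] ideal_star[OF J]
  ideal_mult_left[OF J] scale_add_right scale_add_left scale_scale scale_one mult_assoc mult_add_left mult_add_right
  mult_scale_left mult_scale_right star_star star_add star_scale star_mult norm_nonneg norm_eq_zero_iff
  norm_triangle norm_scale norm_mult cstar_identity\<close>)

text \<open>Being a closed ideal is transitive: for \<open>k \<in> K\<close> and an approximate unit \<open>e\<close> of \<open>K\<close>, the product
  \<open>k a\<close> is the limit of \<open>k (e a)\<close>, and \<open>e a \<in> J\<close> multiplies \<open>k\<close> into \<open>K\<close>.\<close>

lemma closed_ideals_restr:
  assumes J: "J \<in> closed_ideals A"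
  shows "K \<in> closed_ideals (restr A J) \<longleftrightarrow> K \<in> closed_ideals A \<and> K \<subseteq> J"
proof -
  interpret R: cstar_algebra "restr A J" by (rule cstar_restr[OF J])
  note JA = ideal_carrier[OF J]
  have tends: "R.tends \<sigma> l \<longleftrightarrow> (\<forall>n. \<sigma> n \<in> J) \<and> l \<in> J \<and> tends \<sigma> l" for \<sigma> l
    using JA by (auto simp: R.tends_def tends_def)
  have closedin: "closedin R.mtopology K \<longleftrightarrow> closedin mtopology K" if "K \<subseteq> J" for K
  proof -
    have "l \<in> J" if "\<forall>n. \<sigma> n \<in> K" "tends \<sigma> l" for \<sigma> l
      using ideal_tends[OF J _ that(2)] that(1) \<open>K \<subseteq> J\<close> by blast
    then have eq: "(\<forall>n. \<sigma> n \<in> K) \<and> R.tends \<sigma> l \<longleftrightarrow> (\<forall>n. \<sigma> n \<in> K) \<and> tends \<sigma> l" for \<sigma> l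
      using that unfolding tends by auto
    have "K \<subseteq> carrier A" using that JA by blast
    then show ?thesis
      using that unfolding closedin_iff_tends R.closedin_iff_tends eq by simp
  qed
  show ?thesis
  proof
    assume K: "K \<in> closed_ideals A \<and> K \<subseteq> J"
    then show "K \<in> closed_ideals (restr A J)"
      using closedin[of K] JA by (auto simp: R.closed_ideal_iff closed_ideal_iff)
  next
    assume K: "K \<in> closed_ideals (restr A J)"
    then have KJ: "K \<subseteq> J" using R.ideal_subset by simp
    then have KA: "k \<in> carrier A" if "k \<in> K" for k using JA that by blast
    have clo: "closedin mtopology K" using R.ideal_closedin[OF K] closedin[OF KJ] by simp
    have right: "k \<boxtimes> a \<in> K" if k: "k \<in> K" and a: "a \<in> carrier A" for k a
    proof (rule closedin_approx[OF clo])
      show "k \<boxtimes> a \<in> carrier A" using k a KA by simp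
      fix \<epsilon> :: real assume \<epsilon>: "0 < \<epsilon>"
      have pos: "0 < 1 + \<parallel>a\<parallel>" using norm_nonneg[OF a] by simp
      then have \<epsilon>': "0 < \<epsilon> / (1 + \<parallel>a\<parallel>)" using \<epsilon> by simp
      obtain e where e: "e \<in> K" "\<parallel>k \<boxminus> k \<boxtimes> e\<parallel> < \<epsilon> / (1 + \<parallel>a\<parallel>)"
        by (rule R.approximate_unit[OF K k \<epsilon>']) (rule that; simp)
      have "e \<boxtimes> a \<in> J" using ideal_mult_right[OF J a] e KJ by blast
      then have "k \<boxtimes> (e \<boxtimes> a) \<in> K" using R.ideal_mult_right[OF K _ k] by simp
      moreover have "\<parallel>k \<boxtimes> (e \<boxtimes> a) \<boxminus> k \<boxtimes> a\<parallel> < \<epsilon>"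
      proof -
        have "\<parallel>k \<boxtimes> (e \<boxtimes> a) \<boxminus> k \<boxtimes> a\<parallel> = \<parallel>(k \<boxtimes> e \<boxminus> k) \<boxtimes> a\<parallel>"
          using KA k e a by (simp add: mult_add_left mult_scale_left mult_assoc)
        also have "\<dots> \<le> \<parallel>k \<boxminus> k \<boxtimes> e\<parallel> * \<parallel>a\<parallel>"
          using norm_mult[of "k \<boxtimes> e \<boxminus> k" a] norm_minus_commute[of k "k \<boxtimes> e"] KA k e a by simp
        also have "\<dots> \<le> \<parallel>k \<boxminus> k \<boxtimes> e\<parallel> * (1 + \<parallel>a\<parallel>)"
          using norm_nonneg[of "k \<boxminus> k \<boxtimes> e"] KA k e by (intro mult_left_mono) auto
        also have "\<dots> < \<epsilon>" using e pos by (simp add: pos_less_divide_eq)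
        finally show ?thesis .
      qed
      ultimately show "\<exists>s\<in>K. \<parallel>s \<boxminus> k \<boxtimes> a\<parallel> < \<epsilon>" by blast
    qed
    have left: "a \<boxtimes> k \<in> K" if k: "k \<in> K" and a: "a \<in> carrier A" for k a
    proof -
      have "star_A k \<boxtimes> star_A a \<in> K" using right R.ideal_star[OF K k] a by simp
      then have "star_A (star_A k \<boxtimes> star_A a) \<in> K" using R.ideal_star[OF K] by fastforce
      then show ?thesis using k a KA by (simp add: star_mult star_star)
    qed
    show "K \<in> closed_ideals A \<and> K \<subseteq> J"
      using K KJ KA clo left right by (auto simp: R.closed_ideal_iff closed_ideal_iff)
  qed
qed

end

section \<open>Quotients are C*-algebras\<close>

abbreviation coset :: "'a cstar \<Rightarrow> 'a set \<Rightarrow> 'a \<Rightarrow> 'a set" where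
  "coset A I x \<equiv> I #>\<^bsub>add_group A\<^esub> x"

lemma coset_restr [simp]: "coset (restr A J) I = coset A I"
  by (simp add: fun_eq_iff r_coset_def add_group_def)

context cstar_algebra
begin

context
  fixes I
  assumes I: "I \<in> closed_ideals A"
begin

lemma coset_iff:
  assumes x: "x \<in> carrier A" shows "y \<in> coset A I x \<longleftrightarrow> y \<in> carrier A \<and> y \<boxminus> x \<in> I"
proof
  assume "y \<in> coset A I x"
  then obtain i where i: "i \<in> I" "y = i \<boxplus> x" by (auto simp: r_coset_def add_group_def)
  have iA: "i \<in> carrier A" using ideal_carrier[OF I i(1)] .
  have "i \<boxplus> x \<boxminus> x = i" by (rule linear_coordinates2[of i x]) (use x iA in simp_all)
  then show "y \<in> carrier A \<and> y \<boxminus> x \<in> I" using i iA x by simp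
next
  assume "y \<in> carrier A \<and> y \<boxminus> x \<in> I"
  then show "y \<in> coset A I x"
    using minus_add_cancel[of y x] x by (force simp: r_coset_def add_group_def)
qed

lemma coset_self: "x \<in> carrier A \<Longrightarrow> x \<in> coset A I x"
  by (simp add: coset_iff ideal_zero[OF I])

lemma coset_eq_iff:
  assumes x: "x \<in> carrier A" and y: "y \<in> carrier A"
  shows "coset A I x = coset A I y \<longleftrightarrow> x \<boxminus> y \<in> I"
proof
  assume "coset A I x = coset A I y"
  then show "x \<boxminus> y \<in> I" using coset_self[OF x] x y by (simp add: coset_iff)
next
  assume xy: "x \<boxminus> y \<in> I"
  then have yx: "y \<boxminus> x \<in> I" using ideal_scale[OF I xy, of "- 1"] minus_swap[OF x y] by simp
  have "z \<in> coset A I a \<Longrightarrow> z \<in> coset A I b"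
    if "a \<boxminus> b \<in> I" "a \<in> carrier A" "b \<in> carrier A" for a b z
    using ideal_add[OF I, of "z \<boxminus> a" "a \<boxminus> b"] minus_trans[of z a b] that by (simp add: coset_iff)
  from this[OF xy x y] this[OF yx y x] show "coset A I x = coset A I y" by blast
qed

lemma coset_eq_ideal_iff: "x \<in> carrier A \<Longrightarrow> coset A I x = I \<longleftrightarrow> x \<in> I"
  using coset_eq_iff[of x "\<zero>\<^sub>A"] coset_iff[of "\<zero>\<^sub>A"] ideal_carrier[OF I] by auto

text \<open>The quotient operations are defined as unions over representatives; this reduces each to one
  representative.\<close>

lemma union_coset:
  assumes x: "x \<in> carrier A" and g: "\<And>z. \<lbrakk>z \<in> carrier A; z \<boxminus> x \<in> I\<rbrakk> \<Longrightarrow> g z = g x"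
  shows "(\<Union>z\<in>coset A I x. g z) = g x"
proof -
  have "(\<Union>z\<in>coset A I x. g z) = (\<Union>z\<in>coset A I x. g x)"
    using coset_iff[OF x] by (intro SUP_cong refl g) auto
  then show ?thesis using coset_self[OF x] by auto
qed

lemma quot_carrier: "carrier (quot A I) = coset A I ` carrier A"
  by (auto simp: quot_def RCOSETS_def add_group_def)

lemma quot_zero: "vzero (quot A I) = coset A I \<zero>\<^sub>A"
  using coset_eq_ideal_iff[of "\<zero>\<^sub>A"] ideal_zero[OF I] by (simp add: quot_def)

lemma quot_add:
  assumes x: "x \<in> carrier A" and y: "y \<in> carrier A"
  shows "vadd (quot A I) (coset A I x) (coset A I y) = coset A I (x \<boxplus> y)"
proof -
  have "subgroup I (add_group A)" using I by (simp add: closed_ideals_def)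
  then have "I \<lhd> add_group A" by (rule comm_group.subgroup_imp_normal[OF add_group])
  from normal.rcos_sum[OF this, of x y] show ?thesis
    using x y by (simp add: quot_def add_group_def)
qed

lemma quot_scale:
  assumes x: "x \<in> carrier A"
  shows "vscale (quot A I) c (coset A I x) = coset A I (c \<cdot> x)"
proof -
  have "coset A I (c \<cdot> z) = coset A I (c \<cdot> x)" if "z \<in> carrier A" "z \<boxminus> x \<in> I" for z
    using ideal_scale[OF I that(2), of c] that x scale_minus_right[of z x c]
    by (simp add: coset_eq_iff)
  then show ?thesis using union_coset[OF x, of "\<lambda>z. coset A I (c \<cdot> z)"] by (simp add: quot_def)
qed

lemma quot_star:
  assumes x: "x \<in> carrier A"
  shows "vstar (quot A I) (coset A I x) = coset A I (star_A x)"
proof -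
  have "coset A I (star_A z) = coset A I (star_A x)" if "z \<in> carrier A" "z \<boxminus> x \<in> I" for z
    using ideal_star[OF I that(2)] that x star_minus[of z x] by (simp add: coset_eq_iff)
  then show ?thesis using union_coset[OF x, of "\<lambda>z. coset A I (star_A z)"] by (simp add: quot_def)
qed

lemma quot_mult:
  assumes x: "x \<in> carrier A" and y: "y \<in> carrier A"
  shows "vmult (quot A I) (coset A I x) (coset A I y) = coset A I (x \<boxtimes> y)"
proof -
  have left: "coset A I (z \<boxtimes> w) = coset A I (x \<boxtimes> w)"
    if "z \<in> carrier A" "z \<boxminus> x \<in> I" "w \<in> carrier A" for z w
    using ideal_mult_right[OF I that(3,2)] that x by (simp add: coset_eq_iff mult_minus_right)
  have right: "coset A I (z \<boxtimes> w) = coset A I (z \<boxtimes> y)"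
    if "w \<in> carrier A" "w \<boxminus> y \<in> I" "z \<in> carrier A" for z w
    using ideal_mult_left[OF I that(3,2)] that y by (simp add: coset_eq_iff mult_minus_right)
  have inner: "(\<Union>w\<in>coset A I y. coset A I (z \<boxtimes> w)) = coset A I (z \<boxtimes> y)" if "z \<in> carrier A" for z
    using right that by (intro union_coset[OF y]) auto
  have "(\<Union>z\<in>coset A I x. \<Union>w\<in>coset A I y. coset A I (z \<boxtimes> w)) = (\<Union>w\<in>coset A I y. coset A I (x \<boxtimes> w))"
  proof (rule union_coset[OF x])
    fix z assume "z \<in> carrier A" "z \<boxminus> x \<in> I"
    then show "(\<Union>w\<in>coset A I y. coset A I (z \<boxtimes> w)) = (\<Union>w\<in>coset A I y. coset A I (x \<boxtimes> w))"
      using inner left y x by simp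
  qed
  then show ?thesis using inner x by (simp add: quot_def)
qed

lemmas quot_ops = quot_zero quot_add quot_scale quot_star quot_mult

lemma quot_norm_le:
  assumes "x \<in> carrier A" "z \<in> coset A I x" shows "vnorm (quot A I) (coset A I x) \<le> \<parallel>z\<parallel>"
  unfolding quot_def using assms norm_nonneg coset_iff
  by (auto intro!: cINF_lower bdd_belowI2[where m = 0])

lemma quot_norm_le_self: "x \<in> carrier A \<Longrightarrow> vnorm (quot A I) (coset A I x) \<le> \<parallel>x\<parallel>"
  using quot_norm_le coset_self by blast

text \<open>With the factor \<open>k\<close>, infima over several cosets can be taken one after the other.\<close>

lemma quot_norm_greatest:
  assumes x: "x \<in> carrier A" and k: "0 \<le> k" and le: "\<And>z. z \<in> coset A I x \<Longrightarrow> c \<le> k * \<parallel>z\<parallel>"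
  shows "c \<le> k * vnorm (quot A I) (coset A I x)"
proof (cases "k = 0")
  case True then show ?thesis using le[OF coset_self[OF x]] by simp
next
  case False
  then have "c / k \<le> \<parallel>z\<parallel>" if "z \<in> coset A I x" for z
    using le[OF that] k by (simp add: field_simps)
  then have "c / k \<le> vnorm (quot A I) (coset A I x)"
    using coset_self[OF x] unfolding quot_def by (auto intro!: cINF_greatest)
  then show ?thesis using k False by (simp add: field_simps)
qed

lemma quot_norm_nonneg: "x \<in> carrier A \<Longrightarrow> 0 \<le> vnorm (quot A I) (coset A I x)"
  using quot_norm_greatest[of x 1 0] by (auto simp: coset_iff norm_nonneg)

lemma quot_norm_approx:
  assumes x: "x \<in> carrier A" and \<epsilon>: "vnorm (quot A I) (coset A I x) < \<epsilon>"
  obtains z where "z \<in> coset A I x" "\<parallel>z\<parallel> < \<epsilon>"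
proof -
  have "\<not> (\<forall>z\<in>coset A I x. \<epsilon> \<le> \<parallel>z\<parallel>)"
    using quot_norm_greatest[OF x, of 1 \<epsilon>] \<epsilon> by auto
  then show ?thesis using that by auto
qed

text \<open>The quotient norm of \<open>x\<close> is already approached by the elements \<open>x - x e\<close>: if \<open>w = x + i\<close>, then
  \<open>x - x e\<close> differs from \<open>w - w e\<close>, whose norm is at most \<open>\<parallel>w\<parallel>\<close>, only by the small \<open>i - i e\<close>.\<close>

lemma approximate_unit_coset:
  assumes x: "x \<in> carrier A" and w: "w \<in> coset A I x" and \<epsilon>: "0 < \<epsilon>"
  obtains e where "e \<in> I" "star_A e = e" "\<parallel>x \<boxminus> x \<boxtimes> e\<parallel> < \<parallel>w\<parallel> + \<epsilon>"
    and "\<And>c. c \<in> carrier A \<Longrightarrow> \<parallel>c \<boxminus> e \<boxtimes> c\<parallel> \<le> \<parallel>c\<parallel>"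
proof -
  have wA: "w \<in> carrier A" and j: "w \<boxminus> x \<in> I" using w x by (auto simp: coset_iff)
  obtain e where e: "e \<in> I" "star_A e = e" "\<parallel>(w \<boxminus> x) \<boxminus> (w \<boxminus> x) \<boxtimes> e\<parallel> < \<epsilon>"
    and left: "\<And>c. c \<in> carrier A \<Longrightarrow> \<parallel>c \<boxminus> e \<boxtimes> c\<parallel> \<le> \<parallel>c\<parallel>"
    and right: "\<And>c. c \<in> carrier A \<Longrightarrow> \<parallel>c \<boxminus> c \<boxtimes> e\<parallel> \<le> \<parallel>c\<parallel>"
    by (rule approximate_unit[OF I j \<epsilon>]) (rule that; assumption)
  have eA: "e \<in> carrier A" using ideal_carrier[OF I e(1)] .
  have "x \<boxminus> x \<boxtimes> e = (w \<boxminus> w \<boxtimes> e) \<boxminus> ((w \<boxminus> x) \<boxminus> (w \<boxtimes> e \<boxminus> x \<boxtimes> e))"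
    by (rule linear_coordinates5[of x w "x \<boxtimes> e" "w \<boxtimes> e" e]) (use x wA eA in simp_all)
  also have "w \<boxtimes> e \<boxminus> x \<boxtimes> e = (w \<boxminus> x) \<boxtimes> e" using x wA eA by (simp add: mult_minus_right)
  finally have "\<parallel>x \<boxminus> x \<boxtimes> e\<parallel> \<le> \<parallel>w \<boxminus> w \<boxtimes> e\<parallel> + \<parallel>(w \<boxminus> x) \<boxminus> (w \<boxminus> x) \<boxtimes> e\<parallel>"
    using norm_triangle[of "w \<boxminus> w \<boxtimes> e" "(- 1) \<cdot> ((w \<boxminus> x) \<boxminus> (w \<boxminus> x) \<boxtimes> e)"]
      norm_minus[of "(w \<boxminus> x) \<boxminus> (w \<boxminus> x) \<boxtimes> e"] x wA eA by simp
  then have "\<parallel>x \<boxminus> x \<boxtimes> e\<parallel> < \<parallel>w\<parallel> + \<epsilon>" using right[OF wA] e(3) by linarith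
  then show ?thesis using that e left by blast
qed


lemma quot_norm_triangle:
  assumes x: "x \<in> carrier A" and y: "y \<in> carrier A"
  shows "vnorm (quot A I) (coset A I (x \<boxplus> y)) \<le>
    vnorm (quot A I) (coset A I x) + vnorm (quot A I) (coset A I y)" (is "?xy \<le> ?x + ?y")
proof -
  have "?xy \<le> \<parallel>z\<parallel> + \<parallel>w\<parallel>" if z: "z \<in> coset A I x" and w: "w \<in> coset A I y" for z w
  proof -
    have c: "z \<in> carrier A" "w \<in> carrier A" using z w x y by (auto simp: coset_iff)
    have "(z \<boxplus> w) \<boxminus> (x \<boxplus> y) = (z \<boxminus> x) \<boxplus> (w \<boxminus> y)"
      using c x y by (simp add: scale_add_right add_ac)
    then have "z \<boxplus> w \<in> coset A I (x \<boxplus> y)"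
      using z w x y c ideal_add[OF I, of "z \<boxminus> x" "w \<boxminus> y"] by (simp add: coset_iff)
    then show ?thesis
      using quot_norm_le[of "x \<boxplus> y" "z \<boxplus> w"] norm_triangle[of z w] x y c by simp
  qed
  then have "?xy - \<parallel>w\<parallel> \<le> 1 * ?x" if w: "w \<in> coset A I y" for w
    using that by (intro quot_norm_greatest[OF x]) (auto simp: algebra_simps)
  then have "?xy - ?x \<le> 1 * ?y"
    by (intro quot_norm_greatest[OF y]) (auto simp: algebra_simps)
  then show ?thesis by simp
qed

lemma quot_norm_scale:
  assumes x: "x \<in> carrier A"
  shows "vnorm (quot A I) (coset A I (c \<cdot> x)) = cmod c * vnorm (quot A I) (coset A I x)"
proof -
  have le: "vnorm (quot A I) (coset A I (k \<cdot> y)) \<le> cmod k * vnorm (quot A I) (coset A I y)"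
    if y: "y \<in> carrier A" for k y
  proof (rule quot_norm_greatest[OF y])
    fix z assume z: "z \<in> coset A I y"
    then have zA: "z \<in> carrier A" using y by (simp add: coset_iff)
    have "k \<cdot> z \<in> coset A I (k \<cdot> y)"
      using z zA y ideal_scale[OF I, of "z \<boxminus> y" k] scale_minus_right[of z y k] by (simp add: coset_iff)
    then show "vnorm (quot A I) (coset A I (k \<cdot> y)) \<le> cmod k * \<parallel>z\<parallel>"
      using quot_norm_le[of "k \<cdot> y" "k \<cdot> z"] y zA by (simp add: norm_scale)
  qed simp
  show ?thesis
  proof (cases "c = 0")
    case True
    then show ?thesis using quot_norm_le_self[of "\<zero>\<^sub>A"] quot_norm_nonneg[of "\<zero>\<^sub>A"] x by simp
  next
    case False
    then have "vnorm (quot A I) (coset A I x) \<le> inverse (cmod c) * vnorm (quot A I) (coset A I (c \<cdot> x))"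
      using le[of "c \<cdot> x" "inverse c"] x by (simp add: scale_scale scale_one norm_inverse)
    then show ?thesis using le[OF x, of c] False by (simp add: field_simps)
  qed
qed

lemma quot_norm_eq_zero_iff:
  assumes x: "x \<in> carrier A"
  shows "vnorm (quot A I) (coset A I x) = 0 \<longleftrightarrow> coset A I x = coset A I \<zero>\<^sub>A"
proof
  assume zero: "vnorm (quot A I) (coset A I x) = 0"
  have "x \<in> I"
  proof (rule closedin_approx[OF ideal_closedin[OF I] x])
    fix \<epsilon> :: real assume "0 < \<epsilon>"
    then obtain z where z: "z \<in> coset A I x" "\<parallel>z\<parallel> < \<epsilon>"
      using quot_norm_approx[OF x, of \<epsilon>] zero by auto
    then have zA: "z \<in> carrier A" and zx: "z \<boxminus> x \<in> I" using x by (auto simp: coset_iff)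
    have "x \<boxminus> z \<in> I" using ideal_scale[OF I zx, of "- 1"] minus_swap[OF zA x] by simp
    moreover have "(x \<boxminus> z) \<boxminus> x = (- 1) \<cdot> z"
      by (rule linear_coordinates2[OF zA x]) simp
    ultimately show "\<exists>s\<in>I. \<parallel>s \<boxminus> x\<parallel> < \<epsilon>"
      using z(2) norm_minus[OF zA] by (metis (no_types, lifting))
  qed
  then show "coset A I x = coset A I \<zero>\<^sub>A" using x by (simp add: coset_eq_iff)
next
  assume "coset A I x = coset A I \<zero>\<^sub>A"
  then show "vnorm (quot A I) (coset A I x) = 0"
    using quot_norm_le_self[of "\<zero>\<^sub>A"] quot_norm_nonneg[of "\<zero>\<^sub>A"] by simp
qed

lemma quot_norm_mult:
  assumes x: "x \<in> carrier A" and y: "y \<in> carrier A"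
  shows "vnorm (quot A I) (coset A I (x \<boxtimes> y)) \<le>
    vnorm (quot A I) (coset A I x) * vnorm (quot A I) (coset A I y)" (is "?xy \<le> ?x * ?y")
proof -
  have "?xy \<le> \<parallel>w\<parallel> * \<parallel>z\<parallel>" if z: "z \<in> coset A I x" and w: "w \<in> coset A I y" for z w
  proof -
    have c: "z \<in> carrier A" "w \<in> carrier A" using z w x y by (auto simp: coset_iff)
    have "coset A I z = coset A I x" "coset A I w = coset A I y"
      using z w x y c by (auto simp: coset_iff coset_eq_iff)
    then have "coset A I (z \<boxtimes> w) = coset A I (x \<boxtimes> y)"
      using quot_mult[OF c] quot_mult[OF x y] by simp
    then show ?thesis
      using quot_norm_le_self[of "z \<boxtimes> w"] norm_mult[of z w] c by (simp add: mult.commute)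
  qed
  then have "?xy \<le> \<parallel>w\<parallel> * ?x" if w: "w \<in> coset A I y" for w
    using that y by (intro quot_norm_greatest[OF x]) (auto simp: coset_iff norm_nonneg)
  then have "?xy \<le> ?x * ?y"
    by (intro quot_norm_greatest[OF y] quot_norm_nonneg[OF x]) (auto simp: mult.commute)
  then show ?thesis .
qed

lemma quot_norm_star:
  assumes x: "x \<in> carrier A"
  shows "vnorm (quot A I) (coset A I (star_A x)) \<le> vnorm (quot A I) (coset A I x)"
proof -
  have "vnorm (quot A I) (coset A I (star_A x)) \<le> 1 * vnorm (quot A I) (coset A I x)"
  proof (rule quot_norm_greatest[OF x])
    fix z assume z: "z \<in> coset A I x"
    then have zA: "z \<in> carrier A" using x by (simp add: coset_iff)
    have "coset A I z = coset A I x" using z zA x by (simp add: coset_iff coset_eq_iff)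
    then have "coset A I (star_A z) = coset A I (star_A x)"
      using quot_star[OF zA] quot_star[OF x] by simp
    then show "vnorm (quot A I) (coset A I (star_A x)) \<le> 1 * \<parallel>z\<parallel>"
      using quot_norm_le_self[of "star_A z"] norm_star[OF zA] zA by simp
  qed simp
  then show ?thesis by simp
qed

text \<open>For the difficult inequality, \<open>\<parallel>x - x e\<parallel>\<^sup>2 = \<parallel>(1 - e) x\<^sup>* x (1 - e)\<parallel> \<le> \<parallel>x\<^sup>* x - x\<^sup>* x e\<parallel>\<close>, and \<open>e\<close> can be chosen
  so that the right-hand side is close to the quotient norm of \<open>x\<^sup>* x\<close>.\<close>

lemma quot_cstar_identity:
  assumes x: "x \<in> carrier A"
  shows "vnorm (quot A I) (coset A I (star_A x \<boxtimes> x)) = (vnorm (quot A I) (coset A I x))\<^sup>2"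
    (is "?a = ?x\<^sup>2")
proof (rule antisym)
  have "?a \<le> vnorm (quot A I) (coset A I (star_A x)) * ?x" using quot_norm_mult[of "star_A x" x] x by simp
  also have "\<dots> \<le> ?x * ?x"
    using quot_norm_star[OF x] quot_norm_nonneg[OF x] by (rule mult_right_mono)
  finally show "?a \<le> ?x\<^sup>2" by (simp add: power2_eq_square)
  let ?b = "star_A x \<boxtimes> x"
  have "?x\<^sup>2 \<le> 1 * ?a"
  proof (rule quot_norm_greatest)
    fix w assume w: "w \<in> coset A I ?b"
    have "?x\<^sup>2 \<le> \<parallel>w\<parallel>"
    proof (rule field_le_epsilon)
      fix \<epsilon> :: real assume \<epsilon>: "0 < \<epsilon>"
      have bA: "?b \<in> carrier A" using x by simp
      obtain e where e: "e \<in> I" "star_A e = e" "\<parallel>?b \<boxminus> ?b \<boxtimes> e\<parallel> < \<parallel>w\<parallel> + \<epsilon>"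
        and left: "\<And>c. c \<in> carrier A \<Longrightarrow> \<parallel>c \<boxminus> e \<boxtimes> c\<parallel> \<le> \<parallel>c\<parallel>"
        by (rule approximate_unit_coset[OF bA w \<epsilon>]) (rule that; assumption)
      have eA: "e \<in> carrier A" using ideal_carrier[OF I e(1)] .
      let ?y = "x \<boxminus> x \<boxtimes> e"
      have "?y \<boxminus> x = (- 1) \<cdot> (x \<boxtimes> e)"
        by (rule linear_coordinates2[of x "x \<boxtimes> e"]) (use x eA in simp_all)
      then have "?y \<in> coset A I x"
        using x eA ideal_scale[OF I ideal_mult_left[OF I x e(1)], of "- 1"] by (simp add: coset_iff)
      then have "?x \<le> \<parallel>?y\<parallel>" using quot_norm_le[OF x] by simp
      then have "?x\<^sup>2 \<le> \<parallel>?y\<parallel>\<^sup>2" using quot_norm_nonneg[OF x] by (rule power_mono)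
      also have "\<dots> = \<parallel>star_A ?y \<boxtimes> ?y\<parallel>" using cstar_identity[of ?y] x eA by simp
      also have "star_A ?y \<boxtimes> ?y = (?b \<boxminus> ?b \<boxtimes> e) \<boxminus> e \<boxtimes> (?b \<boxminus> ?b \<boxtimes> e)"
        using x eA e by (simp add: star_add star_scale star_mult mult_add_left mult_add_right
            mult_scale_left mult_scale_right mult_assoc scale_add_right scale_scale add_ac)
      also have "\<parallel>\<dots>\<parallel> \<le> \<parallel>w\<parallel> + \<epsilon>" using left[of "?b \<boxminus> ?b \<boxtimes> e"] e x eA by simp
      finally show "?x\<^sup>2 \<le> \<parallel>w\<parallel> + \<epsilon>" .
    qed
    then show "?x\<^sup>2 \<le> 1 * \<parallel>w\<parallel>" by simp
  qed (use x in auto)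
  then show "?x\<^sup>2 \<le> ?a" by simp
qed

lemma quot_complete:
  assumes \<sigma>: "\<And>n. \<sigma> n \<in> carrier A"
    and cauchy: "\<And>\<epsilon>. \<epsilon> > 0 \<Longrightarrow> \<exists>N. \<forall>m\<ge>N. \<forall>n\<ge>N. vnorm (quot A I) (coset A I (\<sigma> m \<boxminus> \<sigma> n)) < \<epsilon>"
  obtains l where "l \<in> carrier A" "(\<lambda>n. vnorm (quot A I) (coset A I (\<sigma> n \<boxminus> l))) \<longlonglongrightarrow> 0"
proof -
  let ?q = "\<lambda>x. vnorm (quot A I) (coset A I x)"
  have "\<exists>N. \<forall>m\<ge>N. \<forall>n\<ge>N. ?q (\<sigma> m \<boxminus> \<sigma> n) < (1/2) ^ k" for k :: nat
    using cauchy by simp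
  then obtain N where N: "\<And>k m n. \<lbrakk>m \<ge> N k; n \<ge> N k\<rbrakk> \<Longrightarrow> ?q (\<sigma> m \<boxminus> \<sigma> n) < (1/2) ^ k" by metis
  define M where "M k = (\<Sum>i\<le>k. N i)" for k
  have M: "N k \<le> M k" "N k \<le> M (Suc k)" for k using member_le_sum[of k "{..k}" N] by (simp_all add: M_def trans_le_add1)
  \<comment> \<open>along the subsequence \<open>M k\<close>, representatives can be chosen successively with consecutive
    differences as small in norm as in the quotient\<close>
  have lift: "\<exists>z. z \<in> coset A I (\<sigma> (M (Suc k))) \<and> \<parallel>z \<boxminus> y\<parallel> \<le> (1/2) ^ k"
    if y: "y \<in> coset A I (\<sigma> (M k))" for k y
  proof -
    let ?d = "\<sigma> (M (Suc k)) \<boxminus> \<sigma> (M k)"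
    have "?q ?d < (1/2) ^ k" using N M by simp
    then obtain d where d: "d \<in> coset A I ?d" "\<parallel>d\<parallel> < (1/2) ^ k"
      using quot_norm_approx[of ?d] \<sigma> by auto
    have c: "d \<in> carrier A" "y \<in> carrier A" using d y \<sigma> by (auto simp: coset_iff)
    have "(d \<boxplus> y) \<boxminus> \<sigma> (M (Suc k)) = (d \<boxminus> ?d) \<boxplus> (y \<boxminus> \<sigma> (M k))"
      by (rule linear_coordinates5[of d y "\<sigma> (M (Suc k))" "\<sigma> (M k)" y]) (use c \<sigma> in simp_all)
    then have "d \<boxplus> y \<in> coset A I (\<sigma> (M (Suc k)))"
      using d y \<sigma> c ideal_add[OF I, of "d \<boxminus> ?d" "y \<boxminus> \<sigma> (M k)"] by (simp add: coset_iff)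
    moreover have "(d \<boxplus> y) \<boxminus> y = d" by (rule linear_coordinates2[OF c]) simp
    ultimately show ?thesis using d by (intro exI[of _ "d \<boxplus> y"]) simp
  qed
  obtain y where y: "\<And>k. y k \<in> coset A I (\<sigma> (M k))" "\<And>k. \<parallel>y (Suc k) \<boxminus> y k\<parallel> \<le> (1/2) ^ k"
    using dependent_nat_choice[of "\<lambda>k y. y \<in> coset A I (\<sigma> (M k))" "\<lambda>k y z. \<parallel>z \<boxminus> y\<parallel> \<le> (1/2) ^ k"]
      lift coset_self[OF \<sigma>] by blast
  have yA: "y k \<in> carrier A" for k using y(1)[of k] \<sigma> by (simp add: coset_iff)
  obtain l where l: "tends y l"
    using geometric_tends[of y "1/2" 1] y(2) yA by auto
  then have lA: "l \<in> carrier A" by (simp add: tends_def)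
  have "(\<lambda>n. ?q (\<sigma> n \<boxminus> l)) \<longlonglongrightarrow> 0"
  proof (rule LIMSEQ_I)
    fix \<epsilon> :: real assume \<epsilon>: "0 < \<epsilon>"
    have "(\<lambda>k. (1/2) ^ k + \<parallel>y k \<boxminus> l\<parallel>) \<longlonglongrightarrow> 0 + 0"
      using l unfolding tends_def by (intro tendsto_add LIMSEQ_realpow_zero) auto
    then obtain k where k: "(1/2) ^ k + \<parallel>y k \<boxminus> l\<parallel> < \<epsilon>"
      using order_tendstoD(2)[of _ "0 + 0 :: real" sequentially \<epsilon>] \<epsilon>
      by (force simp: eventually_sequentially)
    have "?q (\<sigma> n \<boxminus> l) < \<epsilon>" if n: "n \<ge> N k" for n
    proof -
      have c: "\<sigma> n \<boxminus> \<sigma> (M k) \<in> carrier A" "\<sigma> (M k) \<boxminus> l \<in> carrier A" using \<sigma> lA by auto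
      have "(\<sigma> (M k) \<boxminus> l) \<boxminus> (y k \<boxminus> l) = (- 1) \<cdot> (y k \<boxminus> \<sigma> (M k))"
        by (rule linear_coordinates3[OF \<sigma>[of "M k"] lA yA[of k]]) simp
      then have "coset A I (\<sigma> (M k) \<boxminus> l) = coset A I (y k \<boxminus> l)"
        using y(1)[of k] \<sigma> lA yA ideal_scale[OF I, of "y k \<boxminus> \<sigma> (M k)" "- 1"]
        by (simp add: coset_iff coset_eq_iff)
      then have "?q (\<sigma> (M k) \<boxminus> l) \<le> \<parallel>y k \<boxminus> l\<parallel>"
        using quot_norm_le_self[of "y k \<boxminus> l"] yA lA by simp
      moreover have "?q (\<sigma> n \<boxminus> \<sigma> (M k)) < (1/2) ^ k" using N n M by simp
      moreover have "?q (\<sigma> n \<boxminus> l) \<le> ?q (\<sigma> n \<boxminus> \<sigma> (M k)) + ?q (\<sigma> (M k) \<boxminus> l)"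
        using quot_norm_triangle[OF c] minus_trans[of "\<sigma> n" "\<sigma> (M k)" l] \<sigma> lA by simp
      ultimately show ?thesis using k by linarith
    qed
    then show "\<exists>n0. \<forall>n\<ge>n0. norm (?q (\<sigma> n \<boxminus> l) - 0) < \<epsilon>"
      using quot_norm_nonneg \<sigma> lA by (intro exI[of _ "N k"]) auto
  qed
  then show ?thesis using that lA by blast
qed

lemma quot_minus:
  "\<lbrakk>x \<in> carrier A; y \<in> carrier A\<rbrakk> \<Longrightarrow>
    vadd (quot A I) (coset A I x) (vscale (quot A I) (- 1) (coset A I y)) = coset A I (x \<boxminus> y)"
  by (simp add: quot_ops)

theorem cstar_quot: "cstar_algebra (quot A I)"
proof (rule cstar_algebra.intro)
  show "comm_group (add_group (quot A I))"
  proof (rule comm_groupI)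
    fix X assume "X \<in> carrier (add_group (quot A I))"
    then obtain x where x: "x \<in> carrier A" "X = coset A I x" by (auto simp: quot_carrier)
    have "(- 1) \<cdot> x \<boxplus> x = \<zero>\<^sub>A" using x minus_self[of x] by (simp add: add_commute)
    then have "coset A I ((- 1) \<cdot> x) \<in> carrier (add_group (quot A I)) \<and>
        coset A I ((- 1) \<cdot> x) \<otimes>\<^bsub>add_group (quot A I)\<^esub> X = \<one>\<^bsub>add_group (quot A I)\<^esub>"
      using x by (simp add: quot_carrier quot_ops)
    then show "\<exists>Y\<in>carrier (add_group (quot A I)). Y \<otimes>\<^bsub>add_group (quot A I)\<^esub> X = \<one>\<^bsub>add_group (quot A I)\<^esub>"
      by blast
  qed (auto simp: quot_carrier quot_ops add_ac)
  have "Metric_space (carrier (quot A I)) (cdist (quot A I))"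
  proof
    show "0 \<le> cdist (quot A I) X Y" for X Y
      by (auto simp: cdist_def quot_carrier quot_minus quot_norm_nonneg)
    show "cdist (quot A I) X Y = cdist (quot A I) Y X" for X Y
    proof -
      have "vnorm (quot A I) (coset A I (x \<boxminus> y)) = vnorm (quot A I) (coset A I (y \<boxminus> x))"
        if "x \<in> carrier A" "y \<in> carrier A" for x y
        using quot_norm_scale[of "x \<boxminus> y" "- 1"] minus_swap[of x y] that by simp
      then show ?thesis by (auto simp: cdist_def quot_carrier quot_minus)
    qed
    show "cdist (quot A I) X Y = 0 \<longleftrightarrow> X = Y"
      if XY: "X \<in> carrier (quot A I)" "Y \<in> carrier (quot A I)" for X Y
    proof -
      obtain x y where "x \<in> carrier A" "y \<in> carrier A" "X = coset A I x" "Y = coset A I y"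
        using XY by (auto simp: quot_carrier)
      then show ?thesis
        by (simp add: cdist_def quot_carrier quot_minus quot_norm_eq_zero_iff coset_eq_iff)
    qed
    show "cdist (quot A I) X Z \<le> cdist (quot A I) X Y + cdist (quot A I) Y Z"
      if XYZ: "X \<in> carrier (quot A I)" "Y \<in> carrier (quot A I)" "Z \<in> carrier (quot A I)" for X Y Z
    proof -
      obtain x y z where c: "x \<in> carrier A" "y \<in> carrier A" "z \<in> carrier A"
        and "X = coset A I x" "Y = coset A I y" "Z = coset A I z"
        using XYZ by (auto simp: quot_carrier)
      then show ?thesis
        using quot_norm_triangle[of "x \<boxminus> y" "y \<boxminus> z"] minus_trans[OF c]
        by (simp add: cdist_def quot_carrier quot_minus)
    qed
  qed
  then show "Metric_space.mcomplete (carrier (quot A I)) (cdist (quot A I))"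
  proof (rule mcomplete_cdistI)
    fix S :: "nat \<Rightarrow> 'a set"
    assume "\<And>n. S n \<in> carrier (quot A I)"
    then have "\<forall>n. \<exists>x. x \<in> carrier A \<and> S n = coset A I x" by (auto simp: quot_carrier)
    then obtain \<sigma> where \<sigma>: "\<And>n. \<sigma> n \<in> carrier A" "\<And>n. S n = coset A I (\<sigma> n)" by metis
    assume cau: "\<And>\<epsilon>. 0 < \<epsilon> \<Longrightarrow> \<exists>N. \<forall>m\<ge>N. \<forall>n\<ge>N.
      vnorm (quot A I) (vadd (quot A I) (S m) (vscale (quot A I) (- 1) (S n))) < \<epsilon>"
    have "\<exists>N. \<forall>m\<ge>N. \<forall>n\<ge>N. vnorm (quot A I) (coset A I (\<sigma> m \<boxminus> \<sigma> n)) < \<epsilon>" if "0 < \<epsilon>" for \<epsilon>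
      using cau[OF that] \<sigma> by (simp add: quot_minus)
    then obtain l where "l \<in> carrier A" "(\<lambda>n. vnorm (quot A I) (coset A I (\<sigma> n \<boxminus> l))) \<longlonglongrightarrow> 0"
      using quot_complete[of \<sigma>, OF \<sigma>(1)] by blast
    then show "\<exists>L\<in>carrier (quot A I).
        (\<lambda>n. vnorm (quot A I) (vadd (quot A I) (S n) (vscale (quot A I) (- 1) L))) \<longlonglongrightarrow> 0"
      using \<sigma> by (intro bexI[of _ "coset A I l"]) (auto simp: quot_minus quot_carrier)
  qed
qed (auto simp: quot_carrier quot_ops scale_add_right scale_add_left scale_scale scale_one mult_assoc
    mult_add_left mult_add_right mult_scale_left mult_scale_right star_star star_add star_scale star_mult
    quot_norm_nonneg quot_norm_eq_zero_iff quot_norm_triangle quot_norm_scale quot_norm_mult quot_cstar_identity)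

end

end

section \<open>Images of P-algebras and of ideals\<close>

lemma star_iso_iff: "star_iso A B f \<longleftrightarrow> bij_betw f (carrier A) (carrier B) \<and> star_hom A B f"
  unfolding star_iso_def star_hom_def bij_betw_def by blast

lemma star_iso_inverse:
  assumes A: "cstar_algebra A" and f: "star_iso A B f"
  obtains g where "star_iso B A g"
proof -
  interpret A: cstar_algebra A by (rule A)
  have bij: "bij_betw f (carrier A) (carrier B)" and hom: "star_hom A B f"
    using f by (auto simp: star_iso_iff)
  let ?g = "the_inv_into (carrier A) f"
  have inj: "inj_on f (carrier A)" and im: "carrier B = f ` carrier A"
    using bij by (auto simp: bij_betw_def)
  have gf: "?g (f x) = x" if "x \<in> carrier A" for x using the_inv_into_f_f[OF inj that] .
  have g: "?g y = x" if "x \<in> carrier A" "f x = y" for x y using gf that by blast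
  note D = star_homD[OF hom]
  have "star_hom B A ?g"
    unfolding star_hom_def im by (auto simp: gf simp flip: D(2-5))
  moreover have "bij_betw ?g (carrier B) (carrier A)" using bij by (rule bij_betw_the_inv_into)
  ultimately show ?thesis using that by (auto simp: star_iso_iff)
qed

lemma star_iso_comp: "star_iso A B f \<Longrightarrow> star_iso B C g \<Longrightarrow> star_iso A C (g \<circ> f)"
  by (auto simp: star_iso_iff star_hom_comp intro: bij_betw_trans)

lemma star_hom_zero:
  assumes "cstar_algebra A" "cstar_algebra B" "star_hom A B f" shows "f (vzero A) = vzero B"
  using star_homD(3)[OF assms(3), of "vzero A" 0] star_homD(1)[OF assms(3), of "vzero A"]
    cstar_algebra.scale_zero_left[OF assms(1)] cstar_algebra.scale_zero_left[OF assms(2)]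
    cstar_algebra.zero_closed[OF assms(1)] by simp

lemma closed_ideal_vimage:
  assumes A: "cstar_algebra A" and B: "cstar_algebra B" and f: "star_hom A B f"
    and K: "K \<in> closed_ideals B"
  shows "{x \<in> carrier A. f x \<in> K} \<in> closed_ideals A" (is "?J \<in> _")
proof -
  interpret A: cstar_algebra A by (rule A)
  interpret B: cstar_algebra B by (rule B)
  note D = star_homD[OF f]
  have clo: "closedin A.mtopology ?J"
    unfolding A.closedin_iff_tends
  proof (intro conjI allI impI)
    fix \<sigma> l assume \<sigma>: "(\<forall>n. \<sigma> n \<in> ?J) \<and> A.tends \<sigma> l"
    then have lA: "l \<in> carrier A" and \<sigma>A: "\<And>n. \<sigma> n \<in> carrier A"
      and lim: "(\<lambda>n. vnorm A (vadd A (\<sigma> n) (vscale A (- 1) l))) \<longlonglongrightarrow> 0"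
      by (auto simp: A.tends_def)
    have "vnorm B (vadd B (f (\<sigma> n)) (vscale B (- 1) (f l))) \<le> vnorm A (vadd A (\<sigma> n) (vscale A (- 1) l))"
      for n
      using star_hom_contractive[OF A B f, of "vadd A (\<sigma> n) (vscale A (- 1) l)"] lA \<sigma>A[of n]
      by (simp add: D)
    then have "(\<lambda>n. vnorm B (vadd B (f (\<sigma> n)) (vscale B (- 1) (f l)))) \<longlonglongrightarrow> 0"
      using lA \<sigma>A lim by (intro tendsto_zero_squeeze[OF _ _ lim] B.norm_nonneg) (auto simp: D)
    then have "B.tends (\<lambda>n. f (\<sigma> n)) (f l)" using lA \<sigma>A by (simp add: B.tends_def D)
    then have "f l \<in> K" using B.ideal_tends[OF K, of "\<lambda>n. f (\<sigma> n)" "f l"] \<sigma> by simp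
    then show "l \<in> ?J" using lA by simp
  qed auto
  have "f (vzero A) \<in> K" using star_hom_zero[OF A B f] B.ideal_zero[OF K] by simp
  then show ?thesis
    unfolding A.closed_ideal_iff
    by (auto simp: D clo B.ideal_add[OF K] B.ideal_scale[OF K] B.ideal_mult_left[OF K]
        B.ideal_mult_right[OF K])
qed

lemma quot_star_hom:
  assumes A: "cstar_algebra A" and I: "I \<in> closed_ideals A"
  shows "star_hom A (quot A I) (coset A I)"
  using cstar_algebra.quot_ops[OF A I] cstar_algebra.quot_carrier[OF A I]
  by (auto simp: star_hom_def)

lemma quot_lift:
  assumes A: "cstar_algebra A" and D: "cstar_algebra D" and I: "I \<in> closed_ideals A"
    and f: "star_hom A D f" and ker: "\<And>x. x \<in> I \<Longrightarrow> f x = vzero D"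
  obtains g where "star_hom (quot A I) D g" "\<And>x. x \<in> carrier A \<Longrightarrow> g (coset A I x) = f x"
proof -
  interpret A: cstar_algebra A by (rule A)
  interpret D: cstar_algebra D by (rule D)
  note hom = star_homD[OF f]
  define g where "g X = f (SOME x. x \<in> X)" for X
  have g: "g (coset A I x) = f x" if x: "x \<in> carrier A" for x
  proof -
    define z where "z = (SOME z. z \<in> coset A I x)"
    have "z \<in> coset A I x" unfolding z_def using A.coset_self[OF I x] by (rule someI)
    then have zA: "z \<in> carrier A" and "vadd A z (vscale A (- 1) x) \<in> I"
      using x by (auto simp: A.coset_iff[OF I])
    then have "vadd D (f z) (vscale D (- 1) (f x)) = vzero D" using ker x by (simp flip: hom(2-5))
    then have "f z = f x" using D.minus_eq_zero_iff[of "f z" "f x"] zA x by (simp add: hom)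
    then show ?thesis by (simp add: g_def z_def)
  qed
  have "star_hom (quot A I) D g"
    unfolding star_hom_def A.quot_carrier[OF I] by (auto simp: A.quot_ops[OF I] g hom)
  then show ?thesis using that g by blast
qed

text \<open>A surjection from a \<open>P\<close>-algebra onto \<open>D\<close> exhibits \<open>D\<close> as a quotient of some \<open>C \<in> P\<close> by the kernel, which
  is closed because homomorphisms are contractive; upper stability then applies. As far as
  membership in \<open>P\<close> is concerned, this subsumes the isomorphism theorems for quotients.\<close>

lemma P_algebra_surjective_image:
  assumes cp: "cstar_property P" and up: "upper_stable P" and B: "P_algebra P B"
    and D: "cstar_algebra D" and \<phi>: "star_hom B D \<phi>" and surj: "carrier D \<subseteq> \<phi> ` carrier B"
  shows "P_algebra P D"
proof -
  have Bc: "cstar_algebra B" using B by (simp add: P_algebra_def)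
  obtain C f where C: "C \<in> P" and f: "star_iso B C f"
    using B by (auto simp: P_algebra_def star_isomorphic_def)
  have Cc: "cstar_algebra C" using cp C unfolding cstar_property_def by blast
  interpret C: cstar_algebra C by (rule Cc)
  interpret D: cstar_algebra D by (rule D)
  obtain g where g: "star_iso C B g" using star_iso_inverse[OF Bc f] .
  define \<psi> where "\<psi> = \<phi> \<circ> g"
  have \<psi>: "star_hom C D \<psi>" using g star_hom_comp[of C B g D \<phi>] \<phi> by (simp add: \<psi>_def star_iso_iff)
  have \<psi>_surj: "\<psi> ` carrier C = carrier D"
  proof -
    have "g ` carrier C = carrier B" using g by (simp add: star_iso_iff bij_betw_def)
    then have "\<psi> ` carrier C = \<phi> ` carrier B" by (simp add: \<psi>_def flip: image_image)
    then show ?thesis using surj \<phi> by (simp add: star_hom_def subset_antisym)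
  qed
  note hom = star_homD[OF \<psi>]
  define K where "K = {x \<in> carrier C. \<psi> x \<in> {vzero D}}"
  have K: "K \<in> closed_ideals C"
    unfolding K_def by (rule closed_ideal_vimage[OF Cc D \<psi> D.zero_closed_ideal])
  have "P_algebra P (quot C K)" using up C K by (simp add: upper_stable_def)
  then obtain E k where E: "E \<in> P" and k: "star_iso (quot C K) E k"
    by (auto simp: P_algebra_def star_isomorphic_def)
  obtain h where h: "star_hom (quot C K) D h" and h_eq: "\<And>x. x \<in> carrier C \<Longrightarrow> h (coset C K x) = \<psi> x"
    by (rule quot_lift[OF Cc D K \<psi>]) (auto simp: K_def)
  have "inj_on h (carrier (quot C K))"
  proof (rule inj_onI)
    fix X Y assume "X \<in> carrier (quot C K)" "Y \<in> carrier (quot C K)" and eq: "h X = h Y"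
    then obtain x y where x: "x \<in> carrier C" "X = coset C K x" and y: "y \<in> carrier C" "Y = coset C K y"
      by (auto simp: C.quot_carrier[OF K])
    then have "\<psi> (vadd C x (vscale C (- 1) y)) = vzero D"
      using eq by (simp add: h_eq hom)
    then have "vadd C x (vscale C (- 1) y) \<in> K" using x y by (simp add: K_def)
    then show "X = Y" using x y C.coset_eq_iff[OF K] by blast
  qed
  moreover have "h ` carrier (quot C K) = carrier D"
    unfolding C.quot_carrier[OF K] \<psi>_surj[symmetric] image_image using h_eq by (rule image_cong[OF refl])
  ultimately have "star_iso (quot C K) D h" using h by (simp add: star_iso_iff bij_betw_def)
  then obtain h' where "star_iso D (quot C K) h'" using star_iso_inverse[OF C.cstar_quot[OF K]] by blast
  then have "star_isomorphic D E"
    using star_iso_comp[OF _ k] unfolding star_isomorphic_def by blast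
  then show ?thesis using D E by (auto simp: P_algebra_def)
qed

text \<open>The two records agree literally, since the quotient operations depend only on the cosets.\<close>

lemma quot_restr_eq: "quot (restr A J) I = restr (quot A I) (coset A I ` J)"
  by (simp add: quot_def restr_def add_group_def RCOSETS_def r_coset_def set_mult_def image_def)
     (auto simp: fun_eq_iff)

context cstar_algebra
begin

lemma closed_ideal_Int:
  assumes "I \<in> closed_ideals A" "J \<in> closed_ideals A" shows "I \<inter> J \<in> closed_ideals A"
  using assms by (auto simp: closed_ideal_iff)

text \<open>The injection of \<open>L / (I \<inter> L)\<close> into \<open>A / I\<close> is isometric, since the elements \<open>x - x e\<close> that
  approach the norm of \<open>x\<close> modulo \<open>I\<close> differ from \<open>x\<close> by elements of \<open>I \<inter> L\<close>.\<close>

lemma quot_norm_Int: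
  assumes I: "I \<in> closed_ideals A" and L: "L \<in> closed_ideals A" and x: "x \<in> L"
  shows "vnorm (quot (restr A L) (I \<inter> L)) (coset A (I \<inter> L) x) = vnorm (quot A I) (coset A I x)"
proof -
  have IL: "I \<inter> L \<in> closed_ideals A" by (rule closed_ideal_Int[OF I L])
  have xA: "x \<in> carrier A" using ideal_carrier[OF L x] .
  have "vnorm (quot A (I \<inter> L)) (coset A (I \<inter> L) x) = vnorm (quot A I) (coset A I x)" (is "?n = ?m")
  proof (rule antisym)
    have "?m \<le> 1 * ?n"
      using quot_norm_le[OF I xA] by (intro quot_norm_greatest[OF IL xA]) (auto simp: coset_iff IL I xA)
    then show "?m \<le> ?n" by simp
    have "?n \<le> 1 * ?m"
    proof (rule quot_norm_greatest[OF I xA])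
      fix w assume w: "w \<in> coset A I x"
      have "?n \<le> \<parallel>w\<parallel>"
      proof (rule field_le_epsilon)
        fix \<epsilon> :: real assume \<epsilon>: "0 < \<epsilon>"
        obtain e where e: "e \<in> I" "\<parallel>x \<boxminus> x \<boxtimes> e\<parallel> < \<parallel>w\<parallel> + \<epsilon>"
          by (rule approximate_unit_coset[OF I xA w \<epsilon>]) (rule that; assumption)
        have eA: "e \<in> carrier A" using ideal_carrier[OF I e(1)] .
        have "x \<boxtimes> e \<in> I \<inter> L"
          using ideal_mult_left[OF I xA e(1)] ideal_mult_right[OF L eA x] by simp
        then have "(- 1) \<cdot> (x \<boxtimes> e) \<in> I \<inter> L" by (rule ideal_scale[OF IL])
        moreover have "(x \<boxminus> x \<boxtimes> e) \<boxminus> x = (- 1) \<cdot> (x \<boxtimes> e)"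
          by (rule linear_coordinates2[of x "x \<boxtimes> e"]) (use xA eA in simp_all)
        ultimately have "x \<boxminus> x \<boxtimes> e \<in> coset A (I \<inter> L) x" using xA eA by (simp add: coset_iff[OF IL])
        then show "?n \<le> \<parallel>w\<parallel> + \<epsilon>" using quot_norm_le[OF IL xA] e by fastforce
      qed
      then show "?n \<le> 1 * \<parallel>w\<parallel>" by simp
    qed simp
    then show "?n \<le> ?m" by simp
  qed
  then show ?thesis by (simp add: quot_restr_eq)
qed

text \<open>The image is closed, being an isometric copy of the complete space \<open>L / (I \<inter> L)\<close>.\<close>

lemma image_closed_ideal_quot:
  assumes I: "I \<in> closed_ideals A" and L: "L \<in> closed_ideals A"
  shows "coset A I ` L \<in> closed_ideals (quot A I)"
proof -
  let ?Q = "quot A I" and ?R = "restr A L" and ?IL = "I \<inter> L"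
  let ?B = "quot ?R ?IL"
  have IL: "?IL \<in> closed_ideals ?R"
    using closed_ideal_Int[OF I L] by (simp add: closed_ideals_restr[OF L])
  interpret Q: cstar_algebra ?Q by (rule cstar_quot[OF I])
  interpret R: cstar_algebra ?R by (rule cstar_restr[OF L])
  interpret B: cstar_algebra ?B by (rule R.cstar_quot[OF IL])
  note LA = ideal_carrier[OF L]
  have norm: "vnorm ?B (vadd ?B (coset A ?IL x) (vscale ?B (- 1) (coset A ?IL y))) =
      vnorm ?Q (vadd ?Q (coset A I x) (vscale ?Q (- 1) (coset A I y)))" if "x \<in> L" "y \<in> L" for x y
    using quot_norm_Int[OF I L, of "x \<boxminus> y"] quot_minus[OF I LA LA, of x y] R.quot_minus[OF IL, of x y]
      that ideal_add[OF L] ideal_scale[OF L] by simp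
  have clo: "closedin Q.mtopology (coset A I ` L)"
    unfolding Q.closedin_iff_tends
  proof (intro conjI allI impI)
    show "coset A I ` L \<subseteq> carrier ?Q" using LA by (auto simp: quot_carrier[OF I])
    fix S T assume S: "(\<forall>n. S n \<in> coset A I ` L) \<and> Q.tends S T"
    then have "\<forall>n. \<exists>x. x \<in> L \<and> S n = coset A I x" by auto
    then obtain \<sigma> where \<sigma>: "\<And>n. \<sigma> n \<in> L" "\<And>n. S n = coset A I (\<sigma> n)" by metis
    let ?S = "\<lambda>n. coset A ?IL (\<sigma> n)"
    have SB: "?S n \<in> carrier ?B" for n using \<sigma> R.quot_carrier[OF IL] by auto
    have "Q.MCauchy S"
    proof -
      have "S n \<in> carrier ?Q" for n using S by (simp add: Q.tends_def)
      then have "limitin Q.mtopology S T sequentially" using S Q.tends_iff_limitin[of S T] by blast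
      then show ?thesis using Q.convergent_imp_MCauchy[of S T] S by (auto simp: Q.tends_def)
    qed
    then have "\<exists>N. \<forall>m\<ge>N. \<forall>n\<ge>N. vnorm ?B (vadd ?B (?S m) (vscale ?B (- 1) (?S n))) < \<epsilon>" if "0 < \<epsilon>" for \<epsilon>
      using that \<sigma> by (simp add: norm Q.MCauchy_iff)
    then obtain T' where T': "B.tends ?S T'" using B.Cauchy_tends[of ?S] SB by blast
    then have "T' \<in> carrier ?B" by (simp add: B.tends_def)
    then obtain l where l: "l \<in> L" "T' = coset A ?IL l" using R.quot_carrier[OF IL] by auto
    have "Q.tends S (coset A I l)"
      using T' l \<sigma> S LA unfolding B.tends_def Q.tends_def by (auto simp: norm quot_carrier[OF I])
    then have "T = coset A I l" using S Q.tends_unique by blast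
    then show "T \<in> coset A I ` L" using l by simp
  qed
  have "a \<in> carrier ?Q \<Longrightarrow> X \<in> coset A I ` L \<Longrightarrow>
      vmult ?Q a X \<in> coset A I ` L \<and> vmult ?Q X a \<in> coset A I ` L" for a X
    using ideal_mult_left[OF L] ideal_mult_right[OF L] LA
    by (auto simp: quot_carrier[OF I] quot_mult[OF I])
  moreover have "vzero ?Q \<in> coset A I ` L" using ideal_zero[OF L] by (auto simp: quot_zero[OF I])
  moreover have "vadd ?Q X Y \<in> coset A I ` L" if "X \<in> coset A I ` L" "Y \<in> coset A I ` L" for X Y
    using that ideal_add[OF L] LA by (auto simp: quot_add[OF I])
  moreover have "vscale ?Q c X \<in> coset A I ` L" if "X \<in> coset A I ` L" for c X
    using that ideal_scale[OF L] LA by (auto simp: quot_scale[OF I])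
  ultimately show ?thesis
    unfolding Q.closed_ideal_iff using clo LA by (auto simp: quot_carrier[OF I])
qed

end

text \<open>The image of \<open>L\<close> in \<open>A / I\<close> is a quotient of \<open>L / K\<close>.\<close>

lemma nonzero_P_ideal_quotI:
  assumes cp: "cstar_property P" and up: "upper_stable P" and A: "cstar_algebra A"
    and KL: "ll P A K L" and I: "I \<in> closed_ideals A" and KI: "K \<subseteq> I" and LI: "\<not> L \<subseteq> I"
  shows "has_nonzero_P_ideal P (quot A I)"
proof -
  interpret A: cstar_algebra A by (rule A)
  have K: "K \<in> closed_ideals A" and L: "L \<in> closed_ideals A" and "K \<subseteq> L"
    and P: "P_algebra P (quot (restr A L) K)" using KL by (auto simp: ll_def)
  let ?R = "restr A L" and ?Y = "coset A I ` L"
  let ?D = "restr (quot A I) ?Y"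
  have R: "cstar_algebra ?R" using A.cstar_restr[OF L] .
  have KR: "K \<in> closed_ideals ?R" using K \<open>K \<subseteq> L\<close> by (simp add: A.closed_ideals_restr[OF L])
  have Y: "?Y \<in> closed_ideals (quot A I)" by (rule A.image_closed_ideal_quot[OF I L])
  have D: "cstar_algebra ?D" by (rule cstar_algebra.cstar_restr[OF A.cstar_quot[OF I] Y])
  note LA = A.ideal_carrier[OF L]
  have hom: "star_hom ?R ?D (coset A I)"
    using LA by (auto simp: star_hom_def A.quot_ops[OF I])
  obtain g where g: "star_hom (quot ?R K) ?D g" "\<And>x. x \<in> L \<Longrightarrow> g (coset A K x) = coset A I x"
  proof (rule quot_lift[OF R D KR hom])
    show "coset A I x = vzero ?D" if "x \<in> K" for x
      using that KI A.ideal_carrier[OF K] A.ideal_carrier[OF I] A.coset_eq_ideal_iff[OF I]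
      by (auto simp: quot_def)
  qed simp
  have "carrier ?D \<subseteq> g ` carrier (quot ?R K)"
    using g(2) cstar_algebra.quot_carrier[OF R KR] by (auto simp: image_image)
  then have "P_algebra P ?D" by (rule P_algebra_surjective_image[OF cp up P D g(1)])
  moreover have "?Y \<noteq> {vzero (quot A I)}"
  proof -
    obtain x where x: "x \<in> L" "x \<notin> I" using LI by blast
    then have "coset A I x \<noteq> vzero (quot A I)"
      using A.coset_eq_ideal_iff[OF I LA[OF x(1)]] by (simp add: quot_def)
    then show ?thesis using x by blast
  qed
  ultimately show ?thesis using Y unfolding has_nonzero_P_ideal_def by (intro bexI[of _ ?Y] conjI)
qed

lemma nonzero_P_ideal_quotE:
  assumes A: "cstar_algebra A" and I: "I \<in> closed_ideals A" and "has_nonzero_P_ideal P (quot A I)"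
  obtains J where "ll P A I J" "\<not> J \<subseteq> I"
proof -
  interpret A: cstar_algebra A by (rule A)
  obtain Y where Y: "Y \<in> closed_ideals (quot A I)" "Y \<noteq> {vzero (quot A I)}"
    and P: "P_algebra P (restr (quot A I) Y)" using assms(3) by (auto simp: has_nonzero_P_ideal_def)
  interpret Q: cstar_algebra "quot A I" by (rule A.cstar_quot[OF I])
  define J where "J = {x \<in> carrier A. coset A I x \<in> Y}"
  have J: "J \<in> closed_ideals A"
    unfolding J_def by (rule closed_ideal_vimage[OF A A.cstar_quot[OF I] quot_star_hom[OF A I] Y(1)])
  have zero: "vzero (quot A I) = I" by (simp add: quot_def)
  have image: "coset A I ` J = Y"
    using Q.ideal_subset[OF Y(1)] by (auto simp: J_def A.quot_carrier[OF I])
  have IJ: "I \<subseteq> J"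
  proof
    fix x assume x: "x \<in> I"
    then have "x \<in> carrier A" by (rule A.ideal_carrier[OF I])
    moreover from this have "coset A I x = I" using x A.coset_eq_ideal_iff[OF I] by blast
    ultimately show "x \<in> J" using Q.ideal_zero[OF Y(1)] by (simp add: J_def zero)
  qed
  have "\<not> J \<subseteq> I"
  proof
    assume "J \<subseteq> I"
    then have "Y \<subseteq> {I}"
      using image A.ideal_carrier[OF I] A.coset_eq_ideal_iff[OF I] by auto
    then show False using Y(2) Q.ideal_zero[OF Y(1)] zero by auto
  qed
  moreover have "ll P A I J" using I J IJ P by (simp add: ll_def quot_restr_eq image)
  ultimately show ?thesis using that by blast
qed

section \<open>Ascending series\<close>

context cstar_algebra
begin

lemma closure_of_iff_tends:
  assumes U: "U \<subseteq> carrier A"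
  shows "x \<in> mtopology closure_of U \<longleftrightarrow> (\<exists>\<sigma>. (\<forall>n. \<sigma> n \<in> U) \<and> tends \<sigma> x)"
proof
  assume x: "x \<in> mtopology closure_of U"
  then have xA: "x \<in> carrier A" using closure_of_subset_topspace by fastforce
  have "\<exists>u\<in>U. \<parallel>u \<boxminus> x\<parallel> < inverse (real (Suc n))" for n
  proof -
    have "0 < inverse (real (Suc n))" by simp
    then obtain u where "u \<in> U" "u \<in> mball x (inverse (real (Suc n)))"
      using x unfolding metric_closure_of by blast
    then show ?thesis
      using U xA norm_minus_commute[of u x] by (intro bexI[of _ u]) (auto simp: cdist_def in_mball)
  qed
  then obtain \<sigma> where \<sigma>: "\<And>n. \<sigma> n \<in> U" "\<And>n. \<parallel>\<sigma> n \<boxminus> x\<parallel> < inverse (real (Suc n))" by metis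
  have \<sigma>A: "\<sigma> n \<in> carrier A" for n using \<sigma>(1) U by blast
  have "(\<lambda>n. \<parallel>\<sigma> n \<boxminus> x\<parallel>) \<longlonglongrightarrow> 0"
    using \<sigma>(2) \<sigma>A xA
    by (intro tendsto_zero_squeeze[OF _ _ LIMSEQ_inverse_real_of_nat])
      (auto simp: norm_nonneg less_imp_le)
  then show "\<exists>\<sigma>. (\<forall>n. \<sigma> n \<in> U) \<and> tends \<sigma> x" using \<sigma>(1) \<sigma>A xA by (auto simp: tends_def)
next
  assume "\<exists>\<sigma>. (\<forall>n. \<sigma> n \<in> U) \<and> tends \<sigma> x"
  moreover have "U \<subseteq> mtopology closure_of U" using U by (simp add: closure_of_subset)
  moreover have "closedin mtopology (mtopology closure_of U)" by simp
  ultimately show "x \<in> mtopology closure_of U" unfolding closedin_iff_tends by blast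
qed

lemma closure_closed_ideal:
  assumes U: "U \<subseteq> carrier A" "\<zero>\<^sub>A \<in> U" "\<And>x y. \<lbrakk>x \<in> U; y \<in> U\<rbrakk> \<Longrightarrow> x \<boxplus> y \<in> U"
    "\<And>c x. x \<in> U \<Longrightarrow> c \<cdot> x \<in> U"
    "\<And>a x. \<lbrakk>a \<in> carrier A; x \<in> U\<rbrakk> \<Longrightarrow> a \<boxtimes> x \<in> U \<and> x \<boxtimes> a \<in> U"
  shows "mtopology closure_of U \<in> closed_ideals A"
proof -
  let ?C = "mtopology closure_of U"
  note iff = closure_of_iff_tends[OF U(1)]
  have sub: "?C \<subseteq> carrier A" using closure_of_subset_topspace by fastforce
  have "x \<boxplus> y \<in> ?C" if xy: "x \<in> ?C" "y \<in> ?C" for x y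
  proof -
    obtain \<sigma> \<tau> where "\<forall>n. \<sigma> n \<in> U" "tends \<sigma> x" "\<forall>n. \<tau> n \<in> U" "tends \<tau> y" using xy unfolding iff by blast
    then have "(\<forall>n. \<sigma> n \<boxplus> \<tau> n \<in> U) \<and> tends (\<lambda>n. \<sigma> n \<boxplus> \<tau> n) (x \<boxplus> y)" using U(3) tends_add by blast
    then show ?thesis unfolding iff by (intro exI[of _ "\<lambda>n. \<sigma> n \<boxplus> \<tau> n"])
  qed
  moreover have "c \<cdot> x \<in> ?C" if x: "x \<in> ?C" for c x
  proof -
    obtain \<sigma> where "\<forall>n. \<sigma> n \<in> U" "tends \<sigma> x" using x unfolding iff by blast
    then have "(\<forall>n. c \<cdot> \<sigma> n \<in> U) \<and> tends (\<lambda>n. c \<cdot> \<sigma> n) (c \<cdot> x)" using U(4) tends_scale by blast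
    then show ?thesis unfolding iff by (intro exI[of _ "\<lambda>n. c \<cdot> \<sigma> n"])
  qed
  moreover have "a \<boxtimes> x \<in> ?C \<and> x \<boxtimes> a \<in> ?C" if x: "x \<in> ?C" and a: "a \<in> carrier A" for a x
  proof -
    obtain \<sigma> where "\<forall>n. \<sigma> n \<in> U" "tends \<sigma> x" using x unfolding iff by blast
    then have "(\<forall>n. a \<boxtimes> \<sigma> n \<in> U) \<and> tends (\<lambda>n. a \<boxtimes> \<sigma> n) (a \<boxtimes> x)"
      "(\<forall>n. \<sigma> n \<boxtimes> a \<in> U) \<and> tends (\<lambda>n. \<sigma> n \<boxtimes> a) (x \<boxtimes> a)"
      using U(5) a tends_mult_left tends_mult_right by blast+
    then show ?thesis
      unfolding iff by (intro conjI exI[of _ "\<lambda>n. a \<boxtimes> \<sigma> n"] exI[of _ "\<lambda>n. \<sigma> n \<boxtimes> a"]) auto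
  qed
  moreover have "\<zero>\<^sub>A \<in> ?C" using closure_of_subset[of U mtopology] U by auto
  ultimately show ?thesis using sub by (simp add: closed_ideal_iff)
qed

lemma closure_Union_chain:
  assumes M: "M \<noteq> {}" "M \<subseteq> closed_ideals A" and chain: "\<And>I J. \<lbrakk>I \<in> M; J \<in> M\<rbrakk> \<Longrightarrow> I \<subseteq> J \<or> J \<subseteq> I"
  shows "mtopology closure_of \<Union>M \<in> closed_ideals A"
proof (rule closure_closed_ideal)
  have MI: "I \<in> closed_ideals A" if "I \<in> M" for I using M that by blast
  show "\<Union>M \<subseteq> carrier A" using MI ideal_subset by blast
  show "\<zero>\<^sub>A \<in> \<Union>M" using M(1) MI ideal_zero by blast
  show "x \<boxplus> y \<in> \<Union>M" if xy: "x \<in> \<Union>M" "y \<in> \<Union>M" for x y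
  proof -
    obtain I J where IJ: "x \<in> I" "I \<in> M" "y \<in> J" "J \<in> M" using xy by blast
    then show ?thesis using chain[of I J] ideal_add[OF MI, of _ x y] by blast
  qed
  show "c \<cdot> x \<in> \<Union>M" if "x \<in> \<Union>M" for c x using that MI ideal_scale by blast
  show "a \<boxtimes> x \<in> \<Union>M \<and> x \<boxtimes> a \<in> \<Union>M" if "a \<in> carrier A" "x \<in> \<Union>M" for a x
    using that MI ideal_mult_left ideal_mult_right by blast
qed

lemma closure_closed_ideal_eq: "I \<in> closed_ideals A \<Longrightarrow> mtopology closure_of I = I"
  using ideal_closedin by (simp add: closure_of_eq)

end

lemma ll_tri_closed_ideals: "ll_tri P A I J \<Longrightarrow> I \<in> closed_ideals A \<and> J \<in> closed_ideals A"
  unfolding ll_tri_def ascending_series_def is_least_def is_greatest_def by blast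

text \<open>The first member of the series that is not contained in \<open>I\<close> is neither the start nor a limit, as \<open>I\<close> is
  closed. Hence it is the successor of a member contained in \<open>I\<close>.\<close>

lemma ll_tri_leaves_ideal:
  fixes A :: "'a cstar"
  assumes series: "ll_tri P A I\<^sub>0 J" and I: "I \<in> closed_ideals A" and I0: "I\<^sub>0 \<subseteq> I" and J: "\<not> J \<subseteq> I"
  obtains K L where "ll P A K L" "K \<subseteq> I" "\<not> L \<subseteq> I" "L \<subseteq> J"
proof -
  obtain r :: "'a set rel" and F :: "'a set \<Rightarrow> 'a set" where s: "ascending_series P A r F I\<^sub>0 J"
    using series by (auto simp: ll_tri_def)
  then obtain a g where wo: "Well_order r" and a: "is_least r a" "F a = I\<^sub>0"
    and g: "is_greatest r g" "F g = J"
    and mono: "\<And>l m. (l, m) \<in> r \<Longrightarrow> F l \<subseteq> F m"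
    and nxt: "\<And>l m. is_next r l m \<Longrightarrow> ll P A (F l) (F m)"
    and lim: "\<And>b. is_limit r b \<Longrightarrow> F b = (ctopology A) closure_of (\<Union>l\<in>underS r b. F l)"
    unfolding ascending_series_def by blast
  interpret W: wo_rel r using wo by (simp add: wo_rel_def)
  let ?B = "{l \<in> Field r. \<not> F l \<subseteq> I}"
  have "?B \<noteq> {}" using g J by (auto simp: is_greatest_def)
  then obtain b where b: "b \<in> ?B" and bm: "\<And>m. m \<in> ?B \<Longrightarrow> (b, m) \<in> r"
    using W.Well_order_isMinim_exists[of ?B] by (auto simp: W.isMinim_def)
  have below: "F l \<subseteq> I" if "(l, b) \<in> r" "l \<noteq> b" for l
  proof (rule ccontr)
    assume "\<not> F l \<subseteq> I"
    then have "(b, l) \<in> r" using bm that by (auto simp: Field_def)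
    then show False using W.ANTISYM that by (auto dest: antisymD)
  qed
  have "\<not> is_least r b"
    using a I0 b mono unfolding is_least_def by blast
  moreover have "\<not> is_limit r b"
  proof
    assume "is_limit r b"
    then have "F b = (ctopology A) closure_of (\<Union>l\<in>underS r b. F l)" by (rule lim)
    also have "\<dots> \<subseteq> I"
      using below I by (intro closure_of_minimal) (auto simp: underS_def closed_ideals_def)
    finally show False using b by blast
  qed
  ultimately obtain l where l: "is_next r l b" using b by (auto simp: is_limit_def)
  then have "F l \<subseteq> I" using below by (simp add: is_next_def)
  moreover have "F b \<subseteq> J" using mono g b by (auto simp: is_greatest_def)
  ultimately show ?thesis using that nxt[OF l] b by blast
qed

text \<open>Iterate a choice function that enlarges an ideal by a \<open>P\<close>-step whenever this is possible, taking
  closures of unions at limits. The Bourbaki-Witt tower above \<open>{0}\<close> is a chain and its greatest element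
  admits no further step. What remains is that inclusion well-orders the tower and that its
  successor and limit members are those required of a series; indexed by itself, the tower is then
  an ascending series.\<close>

lemma maximal_series_exists:
  assumes A: "cstar_algebra A"
  obtains M where "ll_tri P A {vzero A} M" "\<And>J. ll P A M J \<Longrightarrow> J \<subseteq> M"
proof -
  interpret A: cstar_algebra A by (rule A)
  define f where "f I = (if \<exists>J. ll P A I J \<and> \<not> J \<subseteq> I then SOME J. ll P A I J \<and> \<not> J \<subseteq> I else I)" for I
  define lub where "lub M = A.mtopology closure_of \<Union>M" for M
  define leq where "leq = {(I, J). I \<in> closed_ideals A \<and> J \<in> closed_ideals A \<and> I \<subseteq> J}"
  let ?Z = "{vzero A}"
  have f: "f I = I \<or> ll P A I (f I)" for I
    unfolding f_def by (auto intro: someI2_ex)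
  have f_fixed: "J \<subseteq> I" if "f I = I" "ll P A I J" for I J
  proof (rule ccontr)
    assume "\<not> J \<subseteq> I"
    then have ex: "\<exists>J. ll P A I J \<and> \<not> J \<subseteq> I" using that by blast
    then have "\<not> f I \<subseteq> I" using someI_ex[OF ex] by (simp add: f_def)
    then show False using that by simp
  qed
  have f_closed: "f I \<in> closed_ideals A" "I \<subseteq> f I" if "I \<in> closed_ideals A" for I
    using f[of I] that by (auto simp: ll_def)
  have Field: "Field leq = closed_ideals A" by (auto simp: leq_def Field_def)
  have chain: "M \<subseteq> closed_ideals A" "\<And>I J. \<lbrakk>I \<in> M; J \<in> M\<rbrakk> \<Longrightarrow> I \<subseteq> J \<or> J \<subseteq> I" if "M \<in> Chains leq" for M
    using that by (auto simp: Chains_def leq_def)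
  have lub_closed: "lub M \<in> closed_ideals A" if "M \<in> Chains leq" "M \<noteq> {}" for M
    unfolding lub_def using A.closure_Union_chain[OF that(2) chain[OF that(1)]] .
  have lub_upper: "I \<subseteq> lub M" if "M \<in> Chains leq" "I \<in> M" for I M
    unfolding lub_def using chain(1)[OF that(1)] A.ideal_subset that(2)
    by (intro order_trans[OF _ closure_of_subset]) auto
  have lub_least: "lub M \<subseteq> J" if "\<And>I. I \<in> M \<Longrightarrow> I \<subseteq> J" "J \<in> closed_ideals A" for M J
    unfolding lub_def using that A.ideal_closedin by (intro closure_of_minimal) auto
  interpret BW: bourbaki_witt_fixpoint lub leq f
  proof
    show "Partial_order leq"
      unfolding partial_order_on_def preorder_on_def Field
      by (auto simp: leq_def refl_on_def trans_def antisym_def)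
    show "(lub M, J) \<in> leq"
      if "M \<in> Chains leq" "M \<noteq> {}" "\<And>I. I \<in> M \<Longrightarrow> (I, J) \<in> leq" for M J
    proof -
      have "J \<in> closed_ideals A" "\<And>I. I \<in> M \<Longrightarrow> I \<subseteq> J" using that by (auto simp: leq_def)
      then show ?thesis using lub_closed[OF that(1,2)] lub_least[of M J] by (auto simp: leq_def)
    qed
    show "(I, lub M) \<in> leq" if "M \<in> Chains leq" "I \<in> M" for M I
    proof -
      have "M \<noteq> {}" using that by blast
      then show ?thesis
        using lub_closed lub_upper chain(1) that unfolding leq_def by blast
    qed
    show "lub M \<in> Field leq" if "M \<in> Chains leq" "M \<noteq> {}" for M using lub_closed that by (simp add: Field)
    show "(I, f I) \<in> leq" if "I \<in> Field leq" for I
      using f_closed[of I] that[unfolded Field] by (simp add: leq_def)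
  qed
  define T where "T = BW.iterates_above ?Z"
  have Z: "?Z \<in> Field leq" using A.zero_closed_ideal by (simp add: Field)
  have T_closed: "I \<in> closed_ideals A" if "I \<in> T" for I
    using BW.iterates_above_Field[OF that[unfolded T_def] Z] by (simp add: Field)
  have T_Field: "I \<in> Field leq" if "I \<in> T" for I using T_closed[OF that] by (simp add: Field)
  have above: "K \<subseteq> L" if "L \<in> BW.iterates_above K" "K \<in> T" for K L
    using BW.iterates_above_ge[OF that(1) T_Field[OF that(2)]] by (simp add: leq_def)
  have T_zero: "?Z \<in> T" and T_step: "\<And>I. I \<in> T \<Longrightarrow> f I \<in> T"
    unfolding T_def by (rule BW.iterates_above.intros, assumption?)+
  have T_above_zero: "?Z \<subseteq> I" if "I \<in> T" for I using above that T_zero unfolding T_def by blast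
  \<comment> \<open>nothing of the tower lies strictly between an ideal and its successor\<close>
  have gap: "L \<subseteq> K \<or> f K \<subseteq> L" if KL: "K \<in> T" "L \<in> T" for K L
  proof -
    consider "K \<in> BW.iterates_above L" | "L \<in> BW.iterates_above K"
      using BW.iterates_above_triangle[OF KL[unfolded T_def] Z] by blast
    then show ?thesis
    proof cases
      case 1 then show ?thesis using above KL by blast
    next
      case 2
      then have "L = K \<or> L \<in> BW.iterates_above (f K)"
        by (rule BW.iterates_above_successor) (rule T_Field[OF KL(1)])
      then show ?thesis using above T_step KL by blast
    qed
  qed
  have T_chain: "K \<subseteq> L \<or> L \<subseteq> K" if "K \<in> T" "L \<in> T" for K L
    using gap[OF that] f_closed[OF T_closed[OF that(1)]] by blast
  have T_least: "\<exists>K\<in>Q. \<forall>L\<in>Q. K \<subseteq> L" if "X \<in> T" "Q \<subseteq> T" "Y \<in> Q" "Y \<subseteq> X" for X Y Q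
    using that unfolding T_def
  proof (induction X arbitrary: Y)
    case base
    then have "Y \<in> T" by (auto simp: T_def)
    then have "Y = ?Z" using T_above_zero base by blast
    then show ?case using T_above_zero base unfolding T_def by blast
  next
    case (step X)
    show ?case
    proof (cases "\<exists>Y\<in>Q. Y \<subseteq> X")
      case True then show ?thesis using step by blast
    next
      case False
      then have "f X \<subseteq> L" if "L \<in> Q" for L using gap[of X L] step that unfolding T_def by blast
      then show ?thesis using step by blast
    qed
  next
    case (Sup M)
    show ?case
    proof (cases "\<exists>X\<in>M. \<exists>Y\<in>Q. Y \<subseteq> X")
      case True then show ?thesis using Sup by blast
    next
      case False
      have "lub M \<subseteq> L" if "L \<in> Q" for L
      proof (rule lub_least)
        have L: "L \<in> T" using that Sup.prems(1) by (auto simp: T_def)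
        then show "L \<in> closed_ideals A" by (rule T_closed)
        show "X \<subseteq> L" if "X \<in> M" for X
          using T_chain[OF _ L, of X] Sup.hyps(3)[OF that] False that \<open>L \<in> Q\<close> by (auto simp: T_def)
      qed
      then show ?thesis using Sup.prems(2,3) by (meson order_trans)
    qed
  qed
  define r where "r = {(K, L). K \<in> T \<and> L \<in> T \<and> K \<subseteq> L}"
  have r_iff: "(K, L) \<in> r \<longleftrightarrow> K \<in> T \<and> L \<in> T \<and> K \<subseteq> L" for K L by (simp add: r_def)
  have r_Field: "Field r = T" by (auto simp: r_def Field_def)
  have "wf (r - Id)"
    unfolding wf_eq_minimal
  proof (intro allI impI)
    fix Q :: "'a set set" and X assume X: "X \<in> Q"
    show "\<exists>K\<in>Q. \<forall>L. (L, K) \<in> r - Id \<longrightarrow> L \<notin> Q"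
    proof (cases "X \<in> T")
      case True
      then obtain K where "K \<in> Q \<inter> T" "\<And>L. L \<in> Q \<inter> T \<Longrightarrow> K \<subseteq> L"
        using T_least[of X "Q \<inter> T" X] X by blast
      then show ?thesis by (intro bexI[of _ K]) (auto simp: r_def)
    qed (use X in \<open>auto simp: r_def\<close>)
  qed
  moreover have "Refl r" "trans r" "antisym r" "Total r" "r \<subseteq> Field r \<times> Field r"
    using T_chain unfolding r_Field by (auto simp: r_def refl_on_def trans_def antisym_def total_on_def)
  ultimately have wo: "Well_order r"
    by (simp add: well_order_on_def linear_order_on_def partial_order_on_def preorder_on_def)
  define M where "M = BW.fixp_above ?Z"
  have MT: "M \<in> T" unfolding M_def T_def by (rule BW.fixp_iterates_above)
  have top: "I \<subseteq> M" if "I \<in> T" for I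
    using lub_upper[OF BW.chain_iterates_above[OF Z]] that
    by (simp add: M_def T_def BW.fixp_above_inside[OF Z])
  have next_ll: "ll P A K L" if KL: "is_next r K L" for K L
  proof -
    have T: "K \<in> T" "L \<in> T" "K \<subseteq> L" "K \<noteq> L" using KL by (auto simp: is_next_def r_def)
    then have fKL: "f K \<subseteq> L" using gap by blast
    have Kf: "K \<subseteq> f K" using f_closed T_closed T by blast
    have "f K \<noteq> K"
    proof
      \<comment> \<open>then the tower above \<open>K\<close> would consist of \<open>K\<close> alone\<close>
      assume fK: "f K = K"
      have "I = K" if "I \<in> BW.iterates_above K" for I
        using that
      proof induction
        case (Sup N)
        then have "N = {K}" by blast
        then show ?case unfolding lub_def using A.closure_closed_ideal_eq[OF T_closed[OF T(1)]] by simp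
      qed (use fK in auto)
      moreover have "L \<in> BW.iterates_above K"
        using BW.iterates_above_triangle[OF T(1,2)[unfolded T_def] Z] above T by blast
      ultimately show False using T by blast
    qed
    moreover have "f K = K \<or> f K = L"
      using KL T Kf fKL T_step[OF T(1)] unfolding is_next_def r_def by blast
    ultimately show ?thesis using f by metis
  qed
  have limit_or_next: "I = ?Z \<or> (\<exists>K\<in>T. K \<noteq> I \<and> I = f K) \<or>
      I \<subseteq> A.mtopology closure_of \<Union>{K \<in> T. K \<subset> I}" if "I \<in> T" for I
    using that unfolding T_def
  proof induction
    case (step K)
    show ?case
    proof (cases "f K = K")
      case True then show ?thesis using step.IH by simp
    next
      case False then show ?thesis using step.hyps by metis
    qed
  next
    case (Sup N)
    show ?case
    proof (cases "lub N \<in> N")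
      case True then show ?thesis using Sup by blast
    next
      case False
      then have "N \<subseteq> {K \<in> BW.iterates_above ?Z. K \<subset> lub N}"
        using Sup lub_upper[OF Sup(1)] by blast
      then have "lub N \<subseteq> A.mtopology closure_of \<Union>{K \<in> BW.iterates_above ?Z. K \<subset> lub N}"
        unfolding lub_def by (intro closure_of_mono Union_mono)
      then show ?thesis by blast
    qed
  qed blast
  have limit: "I = A.mtopology closure_of (\<Union>K\<in>underS r I. K)" if I: "is_limit r I" for I
  proof -
    have IT: "I \<in> T" and not_next: "\<not> is_next r K I" for K
      using I by (auto simp: is_limit_def r_Field)
    have "\<not> is_least r I" using I by (simp add: is_limit_def)
    then have "I \<noteq> ?Z" using T_above_zero T_zero by (auto simp: is_least_def r_Field r_iff)
    moreover have "\<not> (K \<noteq> I \<and> I = f K)" if K: "K \<in> T" for K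
    proof
      assume "K \<noteq> I \<and> I = f K"
      then have "is_next r K I"
        using gap[OF K] K IT f_closed(2)[OF T_closed[OF K]] unfolding is_next_def r_def by blast
      then show False using not_next by blast
    qed
    ultimately have "I \<subseteq> A.mtopology closure_of \<Union>{K \<in> T. K \<subset> I}" using limit_or_next[OF IT] by blast
    moreover have "{K \<in> T. K \<subset> I} = underS r I" using IT by (auto simp: underS_def r_def)
    moreover have "A.mtopology closure_of (\<Union>K\<in>underS r I. K) \<subseteq> I"
      using A.ideal_closedin[OF T_closed[OF IT]] by (intro closure_of_minimal) (auto simp: underS_def r_def)
    ultimately show ?thesis by auto
  qed
  have "is_least r ?Z" "is_greatest r M"
    using T_zero MT T_above_zero top by (auto simp: is_least_def is_greatest_def r_Field r_iff)
  then have "ascending_series P A r (\<lambda>I. I) ?Z M"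
    unfolding ascending_series_def using wo T_closed next_ll limit
    by (auto simp: r_Field r_iff)
  then have "ll_tri P A ?Z M" unfolding ll_tri_def by blast
  moreover have "f M = M" unfolding M_def using BW.fixp_above_unfold[OF Z] by simp
  ultimately show ?thesis using that f_fixed by blast
qed


lemma P_algebra_quot_zero_iff:
  assumes cp: "cstar_property P" and up: "upper_stable P" and B: "cstar_algebra B"
  shows "P_algebra P (quot B {vzero B}) \<longleftrightarrow> P_algebra P B"
proof -
  interpret B: cstar_algebra B by (rule B)
  let ?Q = "quot B {vzero B}"
  note Z = B.zero_closed_ideal
  have Q: "cstar_algebra ?Q" by (rule B.cstar_quot[OF Z])
  have "star_hom B B (\<lambda>x. x)" by (simp add: star_hom_def)
  then obtain g where g: "star_hom ?Q B g" "\<And>x. x \<in> carrier B \<Longrightarrow> g (coset B {vzero B} x) = x"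
    using quot_lift[OF B B Z, of "\<lambda>x. x"] by auto
  have "carrier B \<subseteq> g ` carrier ?Q"
    using g(2) by (auto simp: B.quot_carrier[OF Z] image_image)
  moreover have "carrier ?Q \<subseteq> coset B {vzero B} ` carrier B" by (simp add: B.quot_carrier[OF Z])
  ultimately show ?thesis
    using P_algebra_surjective_image[OF cp up _ B g(1)]
      P_algebra_surjective_image[OF cp up _ Q quot_star_hom[OF B Z]] by blast
qed

section \<open>The radical\<close>

lemma ll_restr_iff:
  assumes A: "cstar_algebra A" and J: "J \<in> closed_ideals A"
  shows "ll P (restr A J) K L \<longleftrightarrow> ll P A K L \<and> L \<subseteq> J"
  unfolding ll_def cstar_algebra.closed_ideals_restr[OF A J] by auto

lemma ll_radical_eq_top:
  assumes A: "cstar_algebra A" and M: "ll_tri P A {vzero A} M"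
    and top: "\<And>J. ll_tri P A {vzero A} J \<Longrightarrow> J \<subseteq> M"
  shows "ll_radical P A = M"
proof -
  interpret A: cstar_algebra A by (rule A)
  have Mc: "M \<in> closed_ideals A" using ll_tri_closed_ideals[OF M] by simp
  let ?S = "{J \<in> closed_ideals A. ll_tri P A {vzero A} J}"
  have "ideal_sum A ?S = M"
  proof
    have "foldr (vadd A) xs (vzero A) \<in> M" if "set xs \<subseteq> M" for xs
      using that A.ideal_zero[OF Mc] A.ideal_add[OF Mc] by (induction xs) auto
    then show "ideal_sum A ?S \<subseteq> M" using top by (fastforce simp: ideal_sum_def)
    have "foldr (vadd A) [x] (vzero A) = x \<and> set [x] \<subseteq> \<Union>?S" if "x \<in> M" for x
      using that A.ideal_carrier[OF Mc] M Mc by auto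
    then show "M \<subseteq> ideal_sum A ?S" unfolding ideal_sum_def by (smt (verit) mem_Collect_eq subsetI)
  qed
  then show ?thesis using A.closure_closed_ideal_eq[OF Mc] by (simp add: ll_radical_def)
qed

theorem theorem4p6:
  fixes P :: "'u cstar set" and A :: "'a cstar"
  assumes "cstar_property P" and "upper_stable P" and "cstar_algebra A"
  shows
    "(\<comment> \<open>(i)\<close>
      (ll_radical P A \<in> closed_ideals A \<and> GP_algebra P (restr A (ll_radical P A)) \<and>
        (\<forall>J\<in>closed_ideals A. GP_algebra P (restr A J) \<longrightarrow> J \<subseteq> ll_radical P A)) \<and>
      (NGP_algebra P (quot A (ll_radical P A)) \<and>
        (\<forall>I\<in>closed_ideals A. NGP_algebra P (quot A I) \<longrightarrow> ll_radical P A \<subseteq> I)) \<and>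
      ll_tri P A {vzero A} (ll_radical P A)) \<and>
     (\<comment> \<open>(ii)\<close>
      (GP_algebra P A \<longleftrightarrow> carrier A = ll_radical P A) \<and>
      (NGP_algebra P A \<longleftrightarrow> ll_radical P A = {vzero A}))"
proof -
  note cp = assms(1) and up = assms(2) and A = assms(3)
  interpret A: cstar_algebra A by (rule A)
  obtain M where M: "ll_tri P A {vzero A} M" and M_max: "\<And>J. ll P A M J \<Longrightarrow> J \<subseteq> M"
    by (rule maximal_series_exists[OF A, of P]) (rule that)
  have Mc: "M \<in> closed_ideals A" using ll_tri_closed_ideals[OF M] by simp
  have M_NG: "\<not> has_nonzero_P_ideal P (quot A M)"
    using nonzero_P_ideal_quotE[OF A Mc] M_max by metis
  have absorb: "J \<subseteq> I" if J: "ll_tri P A {vzero A} J" and I: "I \<in> closed_ideals A"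
      and NG: "\<not> has_nonzero_P_ideal P (quot A I)" for I J
  proof (rule ccontr)
    assume J_not: "\<not> J \<subseteq> I"
    have "{vzero A} \<subseteq> I" using A.ideal_zero[OF I] by simp
    then obtain K L where "ll P A K L" "K \<subseteq> I" "\<not> L \<subseteq> I"
      using J_not by (rule ll_tri_leaves_ideal[OF J I])
    then show False using nonzero_P_ideal_quotI[OF cp up A _ I] NG by blast
  qed
  have rad: "ll_radical P A = M" using ll_radical_eq_top[OF A M] absorb[OF _ Mc M_NG] by blast
  have M_GP: "GP_algebra P (restr A M)"
    unfolding GP_algebra_def
  proof (intro conjI disjI2 ballI impI)
    let ?R = "restr A M"
    show R: "cstar_algebra ?R" by (rule A.cstar_restr[OF Mc])
    fix I assume IR: "I \<in> closed_ideals ?R"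
      and nonzero: "carrier (quot ?R I) \<noteq> {vzero (quot ?R I)}"
    have I: "I \<in> closed_ideals A" "I \<subseteq> M" using IR by (auto simp: A.closed_ideals_restr[OF Mc])
    have M_not: "\<not> M \<subseteq> I"
    proof
      assume "M \<subseteq> I"
      then have "coset A I x = I" if "x \<in> M" for x
        using that A.coset_eq_ideal_iff[OF I(1)] A.ideal_carrier[OF Mc] by blast
      then have "coset A I ` M = {I}" using A.ideal_zero[OF Mc] by auto
      then show False using nonzero cstar_algebra.quot_carrier[OF R IR] by (simp add: quot_def)
    qed
    have "{vzero A} \<subseteq> I" using A.ideal_zero[OF I(1)] by simp
    then obtain K L where "ll P A K L" "K \<subseteq> I" "\<not> L \<subseteq> I" "L \<subseteq> M"
      using M_not by (rule ll_tri_leaves_ideal[OF M I(1)])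
    then show "has_nonzero_P_ideal P (quot ?R I)"
      using nonzero_P_ideal_quotI[OF cp up R _ IR] ll_restr_iff[OF A Mc] by blast
  qed
  have GP_le: "J \<subseteq> M" if J: "J \<in> closed_ideals A" and GP: "GP_algebra P (restr A J)" for J
  proof (rule ccontr)
    assume "\<not> J \<subseteq> M"
    then obtain x where x: "x \<in> J" "x \<notin> M" by blast
    let ?R = "restr A J" and ?I = "M \<inter> J"
    have R: "cstar_algebra ?R" by (rule A.cstar_restr[OF J])
    have I: "?I \<in> closed_ideals A" by (rule A.closed_ideal_Int[OF Mc J])
    then have IR: "?I \<in> closed_ideals ?R" by (simp add: A.closed_ideals_restr[OF J])
    have "coset A ?I x \<in> carrier (quot ?R ?I)"
      using x cstar_algebra.quot_carrier[OF R IR] by simp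
    moreover have "coset A ?I x \<noteq> vzero (quot ?R ?I)"
      using x A.coset_eq_ideal_iff[OF I] A.ideal_carrier[OF J] by (simp add: quot_def)
    ultimately have "carrier (quot ?R ?I) \<noteq> {vzero (quot ?R ?I)}" by blast
    moreover have "carrier ?R \<noteq> {vzero ?R}" using x A.ideal_zero[OF Mc] by auto
    ultimately have "has_nonzero_P_ideal P (quot ?R ?I)" using GP IR unfolding GP_algebra_def by blast
    then obtain K where "ll P ?R ?I K" "\<not> K \<subseteq> ?I" by (rule nonzero_P_ideal_quotE[OF R IR])
    then have "ll P A ?I K" "\<not> K \<subseteq> M" by (auto simp: ll_restr_iff[OF A J])
    then show False using nonzero_P_ideal_quotI[OF cp up A _ Mc] M_NG by blast
  qed
  have "has_nonzero_P_ideal P A \<longleftrightarrow> M \<noteq> {vzero A}"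
  proof
    assume "has_nonzero_P_ideal P A"
    then obtain K where K: "K \<in> closed_ideals A" "K \<noteq> {vzero A}" and P: "P_algebra P (restr A K)"
      unfolding has_nonzero_P_ideal_def by blast
    have "P_algebra P (quot (restr A K) {vzero A})"
      using P_algebra_quot_zero_iff[OF cp up A.cstar_restr[OF K(1)]] P by simp
    then have "ll P A {vzero A} K" using K(1) A.ideal_zero A.zero_closed_ideal by (simp add: ll_def)
    then show "M \<noteq> {vzero A}" using M_max[of K] K A.ideal_zero[OF K(1)] by blast
  next
    assume "M \<noteq> {vzero A}"
    then have "\<not> M \<subseteq> {vzero A}" using A.ideal_zero[OF Mc] by blast
    then obtain K L where KL: "ll P A K L" "K \<subseteq> {vzero A}" "\<not> L \<subseteq> {vzero A}"
      by (rule ll_tri_leaves_ideal[OF M A.zero_closed_ideal order_refl])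
    then have L: "L \<in> closed_ideals A" and K: "K = {vzero A}"
      using A.ideal_zero[of K] by (auto simp: ll_def)
    have "P_algebra P (quot (restr A L) {vzero (restr A L)})" using KL(1) K by (simp add: ll_def)
    then have "P_algebra P (restr A L)"
      using P_algebra_quot_zero_iff[OF cp up A.cstar_restr[OF L]] by blast
    then show "has_nonzero_P_ideal P A" using L KL(3) unfolding has_nonzero_P_ideal_def by blast
  qed
  then have "NGP_algebra P A \<longleftrightarrow> M = {vzero A}" using A by (simp add: NGP_algebra_def)
  moreover have "GP_algebra P A \<longleftrightarrow> carrier A = M"
    using GP_le[OF A.carrier_closed_ideal] M_GP A.ideal_subset[OF Mc] by auto
  moreover have "NGP_algebra P (quot A M)" using M_NG A.cstar_quot[OF Mc] by (simp add: NGP_algebra_def)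
  moreover have "\<forall>I\<in>closed_ideals A. NGP_algebra P (quot A I) \<longrightarrow> M \<subseteq> I"
    using absorb[OF M] by (simp add: NGP_algebra_def)
  ultimately show ?thesis unfolding rad using Mc M_GP GP_le M by (intro conjI ballI impI) simp_all
qed

end
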